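(* Let $G$ be a residually finite countably infinite group and let $X\subset\Sigma^G$ be a subshift of finite type with the eventual filling property (EFP). Then $\mathfrak L(X)=[\mathfrak L(X),\mathfrak L(X)]$ if one of the following holds: (1) $G=\mathbb Z$; (2) there is a finite set $F\subset G$ such that for every $y\in X|(G\setminus F)$ the number of patterns $z\in\Sigma^F$ such that $y\sqcup z\in X$ is even; (3) $X$ is the full shift $\Sigma^G$, and $G$ has halvable finite-index subgroups, meaning that every finite-index subgroup $H\le G$ has a subgroup $K\le H$ whose index $[H:K]$ is finite and even.
   Context: $\Sigma$ is a finite alphabet, $\Sigma^G$ has the product topology, and $G$ acts by $\sigma_g(x)_h=x_{hg}$. A subshift is a nonempty closed $G$-invariant set $X\subset\Sigma^G$; it is a subshift of finite type (SFT) if $X=\bigcap_{g\in G}\sigma_g(C)$ for some clopen $C\subset\Sigma^G$. For $D\subset G$, $x|D$ is the restriction of $x$ to $D$ and $X|D=\{x|D:x\in X\}$; $y\sqcup z$ is the union of patterns with disjoint domains. EFP: for every finite $F\subset G$ there is a finite $N\subset G$ such that for all $x,y\in X$ there is $z\in X$ with $z|F=x|F$ and $z|(G\setminus N)=y|(G\setminus N)$. A gate on $X$ is a homeomorphism $\chi:X\to X$ for which there is a finite $N\subset G$ with $\chi(x)_g=x_g$ for all $x\in X$, $g\notin N$. For $g\in G$ put $\chi^g=\sigma_g^{-1}\circ\chi\circ\sigma_g$. For $S\subset G$ say $\chi^S$ commutes if $\chi^s$ and $\chi^t$ commute for all $s,t\in S$; then $\chi^S$ denotes the pointwise limit, over finite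 $F\subset S$ ordered by inclusion, of the compositions $\prod_{s\in F}\chi^s$ (this limit always exists). A gate lattice is a map $\chi^{Hg}$ with $\chi$ a gate, $H\le G$ of finite index, $g\in G$, and $\chi^{Hg}$ commuting. $\mathfrak L(X)$ is the group (of homeomorphisms of $X$) generated by gate lattices, and $[\mathfrak L(X),\mathfrak L(X)]$ its commutator subgroup. *)

theory Defs
  imports
    "HOL-Analysis.Analysis"
    "HOL-Algebra.Bij"
    "HOL-Algebra.FiniteProduct"
    "HOL-Algebra.Elementary_Groups"
begin

definition finite_index :: "('g, 'm) monoid_scheme \<Rightarrow> 'g set \<Rightarrow> bool" where
  "finite_index G H \<longleftrightarrow> subgroup H G \<and> finite (rcosets\<^bsub>G\<^esub> H)"

definition residually_finite :: "('g, 'm) monoid_scheme \<Rightarrow> bool" where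
  "residually_finite G \<longleftrightarrow>
     (\<forall>g \<in> carrier G - {\<one>\<^bsub>G\<^esub>}. \<exists>N. N \<lhd> G \<and> finite_index G N \<and> g \<notin> N)"

text \<open>The finiteness conjunct inside \<^const>\<open>finite_index\<close> matters for the parity condition:
  the cardinality of an infinite set of cosets would be \<open>0\<close>, which is even.\<close>

definition halvable_finite_index_subgroups :: "('g, 'm) monoid_scheme \<Rightarrow> bool" where
  "halvable_finite_index_subgroups G \<longleftrightarrow>
     (\<forall>H. finite_index G H \<longrightarrow>
        (\<exists>K. finite_index (G\<lparr>carrier := H\<rparr>) K \<and> even (card (rcosets\<^bsub>G\<lparr>carrier := H\<rparr>\<^esub> K))))"

text \<open>Configurations over the alphabet \<open>A\<close> are functions that are \<^const>\<open>undefined\<close> off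
  \<^term>\<open>carrier G\<close>; patterns on a set \<open>D\<close> are likewise functions in \<^term>\<open>D \<rightarrow>\<^sub>E A\<close>.\<close>

definition full_shift :: "('g, 'm) monoid_scheme \<Rightarrow> 'a set \<Rightarrow> ('g \<Rightarrow> 'a) set" where
  "full_shift G A = carrier G \<rightarrow>\<^sub>E A"

definition shift_topology :: "('g, 'm) monoid_scheme \<Rightarrow> 'a set \<Rightarrow> ('g \<Rightarrow> 'a) topology" where
  "shift_topology G A = product_topology (\<lambda>_. discrete_topology A) (carrier G)"

definition shift :: "('g, 'm) monoid_scheme \<Rightarrow> 'g \<Rightarrow> ('g \<Rightarrow> 'a) \<Rightarrow> 'g \<Rightarrow> 'a" where
  "shift G g x = (\<lambda>h \<in> carrier G. x (h \<otimes>\<^bsub>G\<^esub> g))"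

definition subshift :: "('g, 'm) monoid_scheme \<Rightarrow> 'a set \<Rightarrow> ('g \<Rightarrow> 'a) set \<Rightarrow> bool" where
  "subshift G A X \<longleftrightarrow>
     X \<noteq> {} \<and> closedin (shift_topology G A) X \<and> (\<forall>g \<in> carrier G. shift G g ` X = X)"

definition SFT :: "('g, 'm) monoid_scheme \<Rightarrow> 'a set \<Rightarrow> ('g \<Rightarrow> 'a) set \<Rightarrow> bool" where
  "SFT G A X \<longleftrightarrow> subshift G A X \<and>
     (\<exists>C. openin (shift_topology G A) C \<and> closedin (shift_topology G A) C \<and>
          X = (\<Inter>g \<in> carrier G. shift G g ` C))"

definition EFP :: "('g, 'm) monoid_scheme \<Rightarrow> ('g \<Rightarrow> 'a) set \<Rightarrow> bool" where
  "EFP G X \<longleftrightarrow>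
     (\<forall>F. finite F \<and> F \<subseteq> carrier G \<longrightarrow>
       (\<exists>N. finite N \<and> N \<subseteq> carrier G \<and>
         (\<forall>x \<in> X. \<forall>y \<in> X. \<exists>z \<in> X.
            restrict z F = restrict x F \<and>
            restrict z (carrier G - N) = restrict y (carrier G - N))))"

definition even_fillings :: "('g, 'm) monoid_scheme \<Rightarrow> 'a set \<Rightarrow> ('g \<Rightarrow> 'a) set \<Rightarrow> bool" where
  "even_fillings G A X \<longleftrightarrow>
     (\<exists>F. finite F \<and> F \<subseteq> carrier G \<and>
       (\<forall>y \<in> (\<lambda>x. restrict x (carrier G - F)) ` X.
          even (card {z \<in> F \<rightarrow>\<^sub>E A. merge (carrier G - F) F (y, z) \<in> X})))"

text \<open>Self-maps of \<open>X\<close> are extensional functions, and composition is the multiplication of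
  \<^term>\<open>BijGroup X\<close>.\<close>

definition gate :: "('g, 'm) monoid_scheme \<Rightarrow> 'a set \<Rightarrow> ('g \<Rightarrow> 'a) set
    \<Rightarrow> (('g \<Rightarrow> 'a) \<Rightarrow> ('g \<Rightarrow> 'a)) \<Rightarrow> bool" where
  "gate G A X \<phi> \<longleftrightarrow>
     \<phi> \<in> extensional X \<and>
     homeomorphic_map (subtopology (shift_topology G A) X) (subtopology (shift_topology G A) X) \<phi> \<and>
     (\<exists>N. finite N \<and> N \<subseteq> carrier G \<and> (\<forall>x \<in> X. \<forall>g \<in> carrier G - N. \<phi> x g = x g))"

definition gate_conj :: "('g, 'm) monoid_scheme \<Rightarrow> ('g \<Rightarrow> 'a) set
    \<Rightarrow> (('g \<Rightarrow> 'a) \<Rightarrow> ('g \<Rightarrow> 'a)) \<Rightarrow> 'g \<Rightarrow> (('g \<Rightarrow> 'a) \<Rightarrow> ('g \<Rightarrow> 'a))" where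
  "gate_conj G X \<phi> g =
     inv\<^bsub>BijGroup X\<^esub> (restrict (shift G g) X) \<otimes>\<^bsub>BijGroup X\<^esub> \<phi> \<otimes>\<^bsub>BijGroup X\<^esub> restrict (shift G g) X"

definition conjs_commute :: "('g, 'm) monoid_scheme \<Rightarrow> ('g \<Rightarrow> 'a) set
    \<Rightarrow> (('g \<Rightarrow> 'a) \<Rightarrow> ('g \<Rightarrow> 'a)) \<Rightarrow> 'g set \<Rightarrow> bool" where
  "conjs_commute G X \<phi> S \<longleftrightarrow>
     (\<forall>s \<in> S. \<forall>t \<in> S. gate_conj G X \<phi> s \<otimes>\<^bsub>BijGroup X\<^esub> gate_conj G X \<phi> t =
                      gate_conj G X \<phi> t \<otimes>\<^bsub>BijGroup X\<^esub> gate_conj G X \<phi> s)"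

text \<open>\<^term>\<open>BijGroup X\<close> is not commutative, but \<^const>\<open>finprod\<close> folds multiplication over a finite
  index set, and this is independent of the order as soon as the factors commute pairwise.
  So the following relation, which says that \<open>f\<close> is the pointwise limit of the finite
  products, is meaningful whenever \<^term>\<open>conjs_commute G X \<phi> S\<close>; it then determines \<open>f\<close>
  because the topology is Hausdorff.\<close>

definition is_lattice_limit :: "('g, 'm) monoid_scheme \<Rightarrow> 'a set \<Rightarrow> ('g \<Rightarrow> 'a) set
    \<Rightarrow> (('g \<Rightarrow> 'a) \<Rightarrow> ('g \<Rightarrow> 'a)) \<Rightarrow> 'g set \<Rightarrow> (('g \<Rightarrow> 'a) \<Rightarrow> ('g \<Rightarrow> 'a)) \<Rightarrow> bool" where
  "is_lattice_limit G A X \<phi> S f \<longleftrightarrow>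
     f \<in> extensional X \<and>
     (\<forall>x \<in> X. limitin (subtopology (shift_topology G A) X)
                (\<lambda>F. finprod (BijGroup X) (gate_conj G X \<phi>) F x) (f x)
                (finite_subsets_at_top S))"

definition gate_lattices :: "('g, 'm) monoid_scheme \<Rightarrow> 'a set \<Rightarrow> ('g \<Rightarrow> 'a) set
    \<Rightarrow> (('g \<Rightarrow> 'a) \<Rightarrow> ('g \<Rightarrow> 'a)) set" where
  "gate_lattices G A X =
     {f. \<exists>\<phi> H g. gate G A X \<phi> \<and> finite_index G H \<and> g \<in> carrier G \<and>
           conjs_commute G X \<phi> (H #>\<^bsub>G\<^esub> g) \<and> is_lattice_limit G A X \<phi> (H #>\<^bsub>G\<^esub> g) f}"

definition gate_lattice_group :: "('g, 'm) monoid_scheme \<Rightarrow> 'a set \<Rightarrow> ('g \<Rightarrow> 'a) set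
    \<Rightarrow> (('g \<Rightarrow> 'a) \<Rightarrow> ('g \<Rightarrow> 'a)) set" where
  "gate_lattice_group G A X = generate (BijGroup X) (gate_lattices G A X)"

end

theory Submission
  imports Defs
begin

text \<open>A gate \<open>\<phi>\<close> whose action takes place inside a finite window \<open>V\<close> can be applied simultaneously at
  all elements of a subgroup \<open>K\<close> of finite index for which the translates of \<open>V\<close> are disjoint, and
  \<open>\<phi> \<mapsto> \<phi>\<^sup>K\<close> is then a homomorphism from the group of gates with window \<open>V\<close> to the group of gate
  lattices. Hence a product of commutators of gates becomes a product of commutators of gate lattices
  (\<open>lattice_derived\<close>). An arbitrary gate lattice splits into finitely many sparse ones, one for each
  left coset of a small enough subgroup, so everything reduces to the question which gates, or which
  products of translates of one gate, are products of commutators of gates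
  (\<open>perfect_criterion\<close>).

  In a shift of finite type a gate is a product of swap gates, which exchange two patterns
  on a window \<open>W\<close> that agree near the boundary of \<open>W\<close> (\<open>windowed_as_swaps\<close>). Seen on a larger window
  \<open>V\<close>, a swap gate is a product of transpositions of patterns on \<open>V\<close>, one for each extension of the
  first pattern to \<open>V\<close>. Two such transpositions with the same boundary values are conjugate by a gate
  with window \<open>V\<close>, so their product is a commutator. Modulo commutators only a parity remains: a product of swap
  gates is a product of commutators once, for every boundary condition on \<open>V\<close>, the patterns that
  it acts on are even in number, counted once for each factor (\<open>swaps_in_derived\<close>).

  The three cases make this number even in different ways.
  \<^item> If some finite set always has an even number of fillings, let \<open>V\<close> contain a translate of it
    that is disjoint from \<open>W\<close> (\<open>perfect_even_fillings\<close>).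
  \<^item> On a full shift the number depends only on the cardinality of \<open>W\<close>. Passing from \<open>K\<close> to a
    subgroup of even index, the factors belonging to its cosets can be grouped in pairs, and the two
    counts of a pair coincide (\<open>perfect_full_shift\<close>).
  \<^item> On the integers the cosets of \<open>2t\<int>\<close> in \<open>t\<int>\<close> are paired in the same way. The counts
    now are products of numbers of fillings of a gap to the left and of a gap to the right of \<open>W\<close>, and
    moving \<open>W\<close> by \<open>t\<close> lengthens one gap by \<open>t\<close> and shortens the other. As the parities of these
    numbers, for all words that border a gap, take finitely many values, there are
    arbitrarily large \<open>t\<close> for which the move does not change them (\<open>perfect_integers\<close>).\<close>

section \<open>Products of commuting group elements\<close>

context group
begin

definition commuting :: "('i \<Rightarrow> 'a) \<Rightarrow> 'i set \<Rightarrow> bool" where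
  "commuting \<phi> S \<longleftrightarrow> (\<forall>i\<in>S. \<phi> i \<in> carrier G) \<and> (\<forall>i\<in>S. \<forall>j\<in>S. \<phi> i \<otimes> \<phi> j = \<phi> j \<otimes> \<phi> i)"

lemma commuting_subset: "commuting \<phi> S \<Longrightarrow> T \<subseteq> S \<Longrightarrow> commuting \<phi> T"
  unfolding commuting_def by blast

lemma commuting_cong: "(\<And>i. i \<in> S \<Longrightarrow> \<phi> i = \<psi> i) \<Longrightarrow> commuting \<phi> S \<longleftrightarrow> commuting \<psi> S"
  unfolding commuting_def by simp

lemma commuting_image: "commuting \<phi> (f ` S) \<longleftrightarrow> commuting (\<lambda>i. \<phi> (f i)) S"
  unfolding commuting_def by blast

lemma LCD_commuting:
  assumes "commuting \<phi> S"
  shows "LCD S (carrier G) ((\<otimes>) \<circ> \<phi>)"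
proof
  fix x y z assume xyz: "x \<in> S" "y \<in> S" "z \<in> carrier G"
  then have c: "\<phi> x \<in> carrier G" "\<phi> y \<in> carrier G" and comm: "\<phi> x \<otimes> \<phi> y = \<phi> y \<otimes> \<phi> x"
    using assms unfolding commuting_def by blast+
  have "\<phi> x \<otimes> (\<phi> y \<otimes> z) = (\<phi> x \<otimes> \<phi> y) \<otimes> z"
    using c xyz by (simp add: m_assoc)
  also have "\<dots> = \<phi> y \<otimes> (\<phi> x \<otimes> z)"
    using c xyz by (simp add: m_assoc comm)
  finally show "((\<otimes>) \<circ> \<phi>) x (((\<otimes>) \<circ> \<phi>) y z) = ((\<otimes>) \<circ> \<phi>) y (((\<otimes>) \<circ> \<phi>) x z)" by simp
qed (use assms in \<open>auto simp: commuting_def\<close>)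

lemma finprod_commuting_empty: "finprod G \<phi> {} = \<one>"
  by (simp add: finprod_def)

lemma finprod_commuting_insert:
  assumes "commuting \<phi> (insert i T)" "finite T" "i \<notin> T"
  shows "finprod G \<phi> (insert i T) = \<phi> i \<otimes> finprod G \<phi> T"
  using LCD.foldD_insert[OF LCD_commuting[OF assms(1)] assms(2,3)] assms
  by (simp add: finprod_def subset_insertI)

lemma finprod_commuting_closed:
  assumes "commuting \<phi> T" "finite T"
  shows "finprod G \<phi> T \<in> carrier G"
  using LCD.foldD_closed[OF LCD_commuting[OF assms(1)] assms(2)] assms by (simp add: finprod_def)

lemma finprod_commuting_in_subgroup:
  assumes "finite T" "commuting \<phi> T" "subgroup K G" "\<And>i. i \<in> T \<Longrightarrow> \<phi> i \<in> K"
  shows "finprod G \<phi> T \<in> K"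
  using assms
proof (induction T rule: finite_induct)
  case empty
  then show ?case by (simp add: finprod_commuting_empty subgroup.one_closed)
next
  case (insert i T)
  then have "commuting \<phi> T" using commuting_subset by blast
  with insert show ?case by (simp add: finprod_commuting_insert subgroup.m_closed)
qed

lemma finprod_commuting_commute:
  assumes "finite T" "commuting \<phi> T" "a \<in> carrier G" "\<And>i. i \<in> T \<Longrightarrow> a \<otimes> \<phi> i = \<phi> i \<otimes> a"
  shows "a \<otimes> finprod G \<phi> T = finprod G \<phi> T \<otimes> a"
  using assms
proof (induction T rule: finite_induct)
  case empty
  then show ?case by (simp add: finprod_commuting_empty)
next
  case (insert i T)
  then have cT: "commuting \<phi> T" using commuting_subset by blast
  then have P: "finprod G \<phi> T \<in> carrier G" "\<phi> i \<in> carrier G"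
    using insert finprod_commuting_closed by (auto simp: commuting_def)
  have IH: "a \<otimes> finprod G \<phi> T = finprod G \<phi> T \<otimes> a" using insert cT by auto
  have "a \<otimes> (\<phi> i \<otimes> finprod G \<phi> T) = \<phi> i \<otimes> (a \<otimes> finprod G \<phi> T)"
    using P insert.prems by (metis insertI1 m_assoc)
  also have "\<dots> = \<phi> i \<otimes> finprod G \<phi> T \<otimes> a"
    using P insert.prems IH by (simp add: m_assoc)
  finally show ?case using insert by (simp add: finprod_commuting_insert)
qed

lemma finprod_commuting_mult:
  assumes "finite T" "commuting \<phi> T" "commuting \<psi> T"
    and "\<And>i j. i \<in> T \<Longrightarrow> j \<in> T \<Longrightarrow> i \<noteq> j \<Longrightarrow> \<phi> i \<otimes> \<psi> j = \<psi> j \<otimes> \<phi> i"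
    and "commuting (\<lambda>i. \<phi> i \<otimes> \<psi> i) T"
  shows "finprod G (\<lambda>i. \<phi> i \<otimes> \<psi> i) T = finprod G \<phi> T \<otimes> finprod G \<psi> T"
  using assms
proof (induction T rule: finite_induct)
  case empty
  then show ?case by (simp add: finprod_commuting_empty)
next
  case (insert i T)
  have c: "commuting \<phi> T" "commuting \<psi> T" "commuting (\<lambda>i. \<phi> i \<otimes> \<psi> i) T"
    using insert.prems commuting_subset by blast+
  define P Q where "P = finprod G \<phi> T" and "Q = finprod G \<psi> T"
  have PQ: "P \<in> carrier G" "Q \<in> carrier G"
    using c insert finprod_commuting_closed by (auto simp: P_def Q_def)
  have i: "\<phi> i \<in> carrier G" "\<psi> i \<in> carrier G" using insert by (auto simp: commuting_def)
  have IH: "finprod G (\<lambda>i. \<phi> i \<otimes> \<psi> i) T = P \<otimes> Q"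
    unfolding P_def Q_def using insert c by auto
  have "\<psi> i \<otimes> \<phi> j = \<phi> j \<otimes> \<psi> i" if "j \<in> T" for j
    using insert.prems(3)[of j i] insert.hyps that by force
  then have "\<psi> i \<otimes> P = P \<otimes> \<psi> i"
    unfolding P_def using insert.hyps c i by (intro finprod_commuting_commute) auto
  then have "(\<phi> i \<otimes> \<psi> i) \<otimes> (P \<otimes> Q) = (\<phi> i \<otimes> P) \<otimes> (\<psi> i \<otimes> Q)"
    using PQ i by (metis m_assoc m_closed)
  then show ?case
    using insert finprod_commuting_insert[OF insert.prems(1)] finprod_commuting_insert[OF insert.prems(2)]
      finprod_commuting_insert[OF insert.prems(4)]
    by (simp add: P_def[symmetric] Q_def[symmetric] IH)
qed

lemma finprod_commuting_union:
  assumes "finite T" "finite U" "T \<inter> U = {}" "commuting \<phi> (T \<union> U)"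
  shows "finprod G \<phi> (T \<union> U) = finprod G \<phi> T \<otimes> finprod G \<phi> U"
  using assms
proof (induction T rule: finite_induct)
  case empty
  then show ?case by (simp add: finprod_commuting_empty finprod_commuting_closed)
next
  case (insert i T)
  have c: "commuting \<phi> (T \<union> U)" "commuting \<phi> T" "commuting \<phi> U" "commuting \<phi> (insert i T)"
    using insert.prems commuting_subset[of \<phi> "insert i T \<union> U"] by auto
  have "finprod G \<phi> (insert i T \<union> U) = \<phi> i \<otimes> finprod G \<phi> (T \<union> U)"
    using finprod_commuting_insert[of \<phi> i "T \<union> U"] insert by auto
  also have "\<dots> = (\<phi> i \<otimes> finprod G \<phi> T) \<otimes> finprod G \<phi> U"
  proof -
    have "finprod G \<phi> T \<in> carrier G" "finprod G \<phi> U \<in> carrier G"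
      using finprod_commuting_closed[OF c(2) insert.hyps(1)] finprod_commuting_closed[OF c(3)] insert.prems(1)
      by auto
    moreover have "\<phi> i \<in> carrier G" using c(4) by (simp add: commuting_def)
    moreover have "finprod G \<phi> (T \<union> U) = finprod G \<phi> T \<otimes> finprod G \<phi> U"
      using insert.IH insert.prems c(1) by auto
    ultimately show ?thesis by (simp add: m_assoc)
  qed
  finally show ?case using insert c by (simp add: finprod_commuting_insert)
qed

lemma finprod_commuting_cong:
  assumes "finite T" "commuting \<phi> T" "\<And>i. i \<in> T \<Longrightarrow> \<phi> i = \<psi> i"
  shows "finprod G \<phi> T = finprod G \<psi> T"
  using assms
proof (induction T rule: finite_induct)
  case (insert i T)
  have "commuting \<psi> (insert i T)"
    using insert.prems(1) commuting_cong[of "insert i T" \<phi> \<psi>, OF insert.prems(2)] by blast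
  moreover have "commuting \<phi> T" using insert.prems(1) commuting_subset by blast
  ultimately show ?case using insert by (simp add: finprod_commuting_insert)
qed (simp add: finprod_commuting_empty)

lemma finprod_commuting_reindex:
  assumes "finite T" "inj_on f T" "commuting \<phi> (f ` T)"
  shows "finprod G (\<lambda>i. \<phi> (f i)) T = finprod G \<phi> (f ` T)"
  using assms
proof (induction T rule: finite_induct)
  case (insert i T)
  have "commuting (\<lambda>i. \<phi> (f i)) (insert i T)" using insert.prems(2) commuting_image by blast
  moreover have "commuting \<phi> (f ` T)" using insert.prems(2) commuting_subset by blast
  moreover have "f i \<notin> f ` T" using insert by auto
  ultimately show ?case using insert by (simp add: finprod_commuting_insert)
qed (simp add: finprod_commuting_empty)

lemma mult_interchange:
  assumes "a \<in> carrier G" "b \<in> carrier G" "c \<in> carrier G" "d \<in> carrier G" and comm: "b \<otimes> c = c \<otimes> b"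
  shows "(a \<otimes> b) \<otimes> (c \<otimes> d) = (a \<otimes> c) \<otimes> (b \<otimes> d)"
proof -
  have "(a \<otimes> b) \<otimes> (c \<otimes> d) = a \<otimes> ((b \<otimes> c) \<otimes> d)" using assms(1-4) by (simp add: m_assoc)
  also have "\<dots> = a \<otimes> ((c \<otimes> b) \<otimes> d)" by (simp only: comm)
  also have "\<dots> = (a \<otimes> c) \<otimes> (b \<otimes> d)" using assms(1-4) by (simp add: m_assoc)
  finally show ?thesis .
qed

lemma commuting_mult:
  assumes "commuting \<phi> S" "commuting \<psi> S"
    and cross: "\<And>i j. i \<in> S \<Longrightarrow> j \<in> S \<Longrightarrow> i \<noteq> j \<Longrightarrow> \<phi> i \<otimes> \<psi> j = \<psi> j \<otimes> \<phi> i"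
  shows "commuting (\<lambda>i. \<phi> i \<otimes> \<psi> i) S"
  unfolding commuting_def
proof (intro conjI ballI)
  have c: "\<phi> i \<in> carrier G" "\<psi> i \<in> carrier G" if "i \<in> S" for i
    using assms(1,2) that unfolding commuting_def by blast+
  then show "\<phi> i \<otimes> \<psi> i \<in> carrier G" if "i \<in> S" for i using that by blast
  fix i j assume ij: "i \<in> S" "j \<in> S"
  have comm: "\<phi> i \<otimes> \<phi> j = \<phi> j \<otimes> \<phi> i" "\<psi> i \<otimes> \<psi> j = \<psi> j \<otimes> \<psi> i"
    using assms(1,2) ij unfolding commuting_def by blast+
  show "\<phi> i \<otimes> \<psi> i \<otimes> (\<phi> j \<otimes> \<psi> j) = \<phi> j \<otimes> \<psi> j \<otimes> (\<phi> i \<otimes> \<psi> i)"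
  proof (cases "i = j")
    case False
    have "\<phi> i \<otimes> \<psi> i \<otimes> (\<phi> j \<otimes> \<psi> j) = (\<phi> i \<otimes> \<phi> j) \<otimes> (\<psi> i \<otimes> \<psi> j)"
      using c ij cross[of j i] False by (intro mult_interchange) auto
    also have "\<dots> = (\<phi> j \<otimes> \<phi> i) \<otimes> (\<psi> j \<otimes> \<psi> i)" by (simp only: comm)
    also have "\<dots> = \<phi> j \<otimes> \<psi> j \<otimes> (\<phi> i \<otimes> \<psi> i)"
      using c ij cross[of i j] False by (intro mult_interchange) auto
    finally show ?thesis .
  qed simp
qed

lemma commute_inv:
  assumes "a \<in> carrier G" "b \<in> carrier G" and comm: "a \<otimes> b = b \<otimes> a"
  shows "a \<otimes> inv b = inv b \<otimes> a"
proof -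
  have "a \<otimes> inv b = (inv b \<otimes> b) \<otimes> a \<otimes> inv b" using assms(1,2) by simp
  also have "\<dots> = inv b \<otimes> (b \<otimes> a) \<otimes> inv b" using assms(1,2) by (simp only: m_assoc inv_closed m_closed)
  also have "\<dots> = inv b \<otimes> (a \<otimes> b) \<otimes> inv b" by (simp only: comm)
  also have "\<dots> = inv b \<otimes> a" using assms(1,2) by (simp add: m_assoc)
  finally show ?thesis .
qed

lemma commuting_inv:
  assumes "commuting \<phi> S"
  shows "commuting (\<lambda>i. inv (\<phi> i)) S"
  unfolding commuting_def
proof (intro conjI ballI)
  fix i j assume ij: "i \<in> S" "j \<in> S"
  then have c: "\<phi> i \<in> carrier G" "\<phi> j \<in> carrier G" "\<phi> j \<otimes> \<phi> i = \<phi> i \<otimes> \<phi> j"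
    using assms unfolding commuting_def by blast+
  have "inv (\<phi> j \<otimes> \<phi> i) = inv (\<phi> i \<otimes> \<phi> j)" by (simp only: c(3))
  then show "inv (\<phi> i) \<otimes> inv (\<phi> j) = inv (\<phi> j) \<otimes> inv (\<phi> i)" using c(1,2) by (simp add: inv_mult_group)
qed (use assms in \<open>simp add: commuting_def\<close>)

lemma commutator_in_derived:
  "a \<in> H \<Longrightarrow> b \<in> H \<Longrightarrow> a \<otimes> b \<otimes> inv a \<otimes> inv b \<in> derived G H"
  unfolding derived_def by (rule generate.incl) blast

text \<open>Modulo commutators the order of the factors is irrelevant, so factors with the same label can be
  brought together, where they cancel.\<close>

lemma foldr_mult_in_derived:
  assumes H: "subgroup H G"
    and g: "\<And>a. a \<in> set as \<Longrightarrow> g a \<in> H"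
    and pair: "\<And>a b. a \<in> set as \<Longrightarrow> b \<in> set as \<Longrightarrow> l a = l b \<Longrightarrow> g a \<otimes> g b \<in> derived G H"
    and even: "\<And>c. even (length (filter (\<lambda>a. l a = c) as))"
  shows "foldr (\<lambda>a y. g a \<otimes> y) as \<one> \<in> derived G H"
  using g pair even
proof (induction "length as" arbitrary: as rule: less_induct)
  case less
  let ?D = "derived G H" and ?p = "\<lambda>as. foldr (\<lambda>a y. g a \<otimes> y) as \<one>"
  have HG: "H \<subseteq> carrier G" using H by (rule subgroup.subset)
  have D: "subgroup ?D G" using derived_is_subgroup HG .
  have pH: "?p xs \<in> H" if "set xs \<subseteq> set as" for xs
    using that
  proof (induction xs)
    case Nil then show ?case using H by (simp add: subgroup.one_closed)
  next
    case (Cons x xs) then show ?case using less(2) H by (auto intro: subgroup.m_closed)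
  qed
  have app: "?p (xs @ ys) = ?p xs \<otimes> ?p ys" if "set xs \<subseteq> set as" "set ys \<subseteq> set as" for xs ys
    using that
  proof (induction xs)
    case Nil then show ?case using pH[of ys] HG by auto
  next
    case (Cons x xs)
    then show ?case using pH[of xs] pH[of ys] less(2)[of x] HG by (auto simp: m_assoc subset_iff)
  qed
  show ?case
  proof (cases as)
    case Nil
    then show ?thesis using D by (simp add: subgroup.one_closed)
  next
    case (Cons a as')
    have "filter (\<lambda>b. l b = l a) as' \<noteq> []"
      using less(4)[of "l a"] Cons by (auto split: if_splits)
    then obtain b where b: "b \<in> set as'" "l b = l a" by (auto simp: filter_empty_conv)
    then obtain ys zs where as': "as' = ys @ b # zs" by (meson split_list)
    have sub: "set ys \<subseteq> set as" "set zs \<subseteq> set as" "set (b # zs) \<subseteq> set as" "a \<in> set as" "b \<in> set as"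
      using Cons as' by auto
    have "?p (ys @ zs) \<in> ?D"
    proof (rule less(1))
      show "length (ys @ zs) < length as" using Cons as' by simp
      show "even (length (filter (\<lambda>a. l a = c) (ys @ zs)))" for c
        using less(4)[of c] Cons as' b(2) by (auto split: if_splits)
      show "g a \<in> H" if "a \<in> set (ys @ zs)" for a using sub less(2) that by auto
      show "g a \<otimes> g b \<in> ?D" if "a \<in> set (ys @ zs)" "b \<in> set (ys @ zs)" "l a = l b" for a b
        by (rule less(3)) (use sub that in auto)
    qed
    define Y Z where "Y = ?p ys" and "Z = ?p zs"
    have YZ: "Y \<otimes> Z \<in> ?D" using \<open>?p (ys @ zs) \<in> ?D\<close> app[OF sub(1,2)] by (simp add: Y_def Z_def)
    have inH: "Y \<in> H" "Z \<in> H" "g a \<in> H" "g b \<in> H" using sub less(2) pH by (auto simp: Y_def Z_def)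
    then have inG: "Y \<in> carrier G" "Z \<in> carrier G" "g a \<in> carrier G" "g b \<in> carrier G"
      using HG by auto
    (* Moving g b to the left past Y costs the commutator of inv (g b) and Y. *)
    have "inv (g b) \<otimes> Y \<otimes> inv (inv (g b)) \<otimes> inv Y \<in> ?D"
      using inH H by (intro commutator_in_derived) (auto intro: subgroup.m_inv_closed)
    then have "(g a \<otimes> g b) \<otimes> (inv (g b) \<otimes> Y \<otimes> g b \<otimes> inv Y) \<otimes> (Y \<otimes> Z) \<in> ?D"
      using D YZ less(3)[OF sub(4,5)] b inG by (auto intro: subgroup.m_closed)
    moreover have "(g a \<otimes> g b) \<otimes> (inv (g b) \<otimes> Y \<otimes> g b \<otimes> inv Y) \<otimes> (Y \<otimes> Z) = g a \<otimes> (Y \<otimes> (g b \<otimes> Z))"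
    proof -
      have 1: "inv Y \<otimes> (Y \<otimes> Z) = Z" "g b \<otimes> (inv (g b) \<otimes> (Y \<otimes> (g b \<otimes> Z))) = Y \<otimes> (g b \<otimes> Z)"
        using inG by (metis l_inv l_one m_assoc inv_closed, metis r_inv l_one m_assoc inv_closed m_closed)
      show ?thesis using inG by (simp only: m_assoc m_closed inv_closed 1)
    qed
    moreover have "?p as = g a \<otimes> (Y \<otimes> (g b \<otimes> Z))"
      using app[OF sub(1,3)] Cons as' by (simp add: Y_def Z_def)
    ultimately show ?thesis by simp
  qed
qed

end

section \<open>The group of self-maps of a subshift\<close>

locale shift_space = group G for G :: "('g, 'm) monoid_scheme" (structure) +
  fixes A :: "'a set" and X :: "('g \<Rightarrow> 'a) set"
  assumes finite_A: "finite A" and subshift: "subshift G A X"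
begin

abbreviation gate_mult (infixl "\<star>" 70) where "\<phi> \<star> \<psi> \<equiv> \<phi> \<otimes>\<^bsub>BijGroup X\<^esub> \<psi>"
abbreviation gate_inv where "gate_inv \<phi> \<equiv> inv\<^bsub>BijGroup X\<^esub> \<phi>"
abbreviation gate_one where "gate_one \<equiv> \<one>\<^bsub>BijGroup X\<^esub>"
abbreviation conj where "conj \<phi> g \<equiv> gate_conj G X \<phi> g"

sublocale Sym: group "BijGroup X"
  rewrites "carrier (BijGroup X) = Bij X"
  using group_BijGroup by (simp_all add: BijGroup_def)

lemma carrier_BijGroup [simp]: "carrier (BijGroup X) = Bij X"
  by (simp add: BijGroup_def)

lemma mult_apply: "\<phi> \<in> Bij X \<Longrightarrow> \<psi> \<in> Bij X \<Longrightarrow> x \<in> X \<Longrightarrow> (\<phi> \<star> \<psi>) x = \<phi> (\<psi> x)"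
  by (simp add: BijGroup_def compose_eq)

lemma one_apply: "x \<in> X \<Longrightarrow> gate_one x = x"
  by (simp add: BijGroup_def)

lemma Bij_apply: "\<phi> \<in> Bij X \<Longrightarrow> x \<in> X \<Longrightarrow> \<phi> x \<in> X"
  using Bij_imp_funcset by blast

lemma inv_apply:
  assumes "\<phi> \<in> Bij X" "x \<in> X"
  shows "gate_inv \<phi> (\<phi> x) = x" "\<phi> (gate_inv \<phi> x) = x"
  using assms mult_apply[of "gate_inv \<phi>" \<phi> x] mult_apply[of \<phi> "gate_inv \<phi>" x] one_apply
  by (auto simp del: inv_BijGroup)

lemma Bij_ext:
  assumes "\<phi> \<in> Bij X" "\<psi> \<in> Bij X" "\<And>x. x \<in> X \<Longrightarrow> \<phi> x = \<psi> x"
  shows "\<phi> = \<psi>"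
  using assms Bij_imp_extensional by (metis extensionalityI)

lemma BijI:
  assumes "\<phi> \<in> extensional X" "\<And>x. x \<in> X \<Longrightarrow> \<phi> x \<in> X" "\<And>x. x \<in> X \<Longrightarrow> \<psi> x \<in> X"
    "\<And>x. x \<in> X \<Longrightarrow> \<phi> (\<psi> x) = x" "\<And>x. x \<in> X \<Longrightarrow> \<psi> (\<phi> x) = x"
  shows "\<phi> \<in> Bij X"
  unfolding Bij_def using assms bij_betwI[of \<phi> X X \<psi>] by (auto simp: Pi_iff)

lemma inv_eqI:
  assumes "\<phi> \<in> Bij X" "\<psi> \<in> Bij X" "\<And>x. x \<in> X \<Longrightarrow> \<phi> (\<psi> x) = x"
  shows "gate_inv \<phi> = \<psi>"
proof (rule Bij_ext)
  fix x assume "x \<in> X"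
  then show "gate_inv \<phi> x = \<psi> x"
    by (metis assms Bij_apply inv_apply(1))
qed (use assms in auto)

section \<open>Points\<close>

lemma X_full: "X \<subseteq> carrier G \<rightarrow>\<^sub>E A"
  using subshift closedin_subset unfolding subshift_def shift_topology_def by fastforce

lemma point_ext:
  assumes "x \<in> carrier G \<rightarrow>\<^sub>E A" "y \<in> carrier G \<rightarrow>\<^sub>E A" "\<And>h. h \<in> carrier G \<Longrightarrow> x h = y h"
  shows "x = y"
  using assms by (rule PiE_ext)

lemma X_ext:
  assumes "x \<in> X" "y \<in> X" "\<And>h. h \<in> carrier G \<Longrightarrow> x h = y h"
  shows "x = y"
  using point_ext[OF subsetD[OF X_full assms(1)] subsetD[OF X_full assms(2)] assms(3)] .

lemma shift_apply [simp]: "h \<in> carrier G \<Longrightarrow> shift G g x h = x (h \<otimes> g)"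
  by (simp add: shift_def)

lemma shift_full: "x \<in> carrier G \<rightarrow>\<^sub>E A \<Longrightarrow> g \<in> carrier G \<Longrightarrow> shift G g x \<in> carrier G \<rightarrow>\<^sub>E A"
  by (auto simp: shift_def PiE_iff)

lemma shift_in_X: "x \<in> X \<Longrightarrow> g \<in> carrier G \<Longrightarrow> shift G g x \<in> X"
  using subshift unfolding subshift_def by blast

lemma shift_shift:
  "g \<in> carrier G \<Longrightarrow> h \<in> carrier G \<Longrightarrow> shift G g (shift G h x) = shift G (g \<otimes> h) x"
  by (auto simp: shift_def fun_eq_iff m_assoc)

lemma shift_one: "x \<in> carrier G \<rightarrow>\<^sub>E A \<Longrightarrow> shift G \<one> x = x"
  by (rule point_ext) (auto simp: shift_full)

lemma shift_inv:
  assumes "g \<in> carrier G" "x \<in> carrier G \<rightarrow>\<^sub>E A"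
  shows "shift G g (shift G (inv g) x) = x" "shift G (inv g) (shift G g x) = x"
  using assms by (simp_all add: shift_shift shift_one)

lemma shift_inv_X:
  assumes "g \<in> carrier G" "x \<in> X"
  shows "shift G g (shift G (inv g) x) = x" "shift G (inv g) (shift G g x) = x"
  using assms shift_inv X_full by blast+

lemma openin_cylinder:
  assumes "finite F" "F \<subseteq> carrier G" "x \<in> carrier G \<rightarrow>\<^sub>E A"
  shows "openin (shift_topology G A) {y \<in> carrier G \<rightarrow>\<^sub>E A. \<forall>h\<in>F. y h = x h}"
proof -
  have "openin (shift_topology G A) (\<Pi>\<^sub>E h\<in>carrier G. if h \<in> F then {x h} else A)"
    unfolding shift_topology_def
  proof (rule product_topology_basis)
    show "openin (discrete_topology A) (if h \<in> F then {x h} else A)" for h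
      using assms by (auto simp: PiE_iff)
    have "{i. (if i \<in> F then {x i} else A) \<noteq> A} \<subseteq> F" by auto
    then show "finite {i. (if i \<in> F then {x i} else A) \<noteq> topspace (discrete_topology A)}"
      using finite_subset[OF _ assms(1)] by simp
  qed
  moreover have "(\<Pi>\<^sub>E h\<in>carrier G. if h \<in> F then {x h} else A) = {y \<in> carrier G \<rightarrow>\<^sub>E A. \<forall>h\<in>F. y h = x h}"
    (is "?P = ?Q")
  proof (intro equalityI subsetI)
    fix y assume y: "y \<in> ?P"
    then have *: "y h \<in> (if h \<in> F then {x h} else A)" if "h \<in> carrier G" for h
      using that by (rule PiE_mem)
    have "y h = x h" if "h \<in> F" for h using *[of h] that assms(2) by auto
    moreover have "y h \<in> A" if "h \<in> carrier G" for h
      using *[OF that] PiE_mem[OF assms(3) that] by (auto split: if_splits)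
    ultimately show "y \<in> ?Q" using y by (simp add: PiE_iff)
  next
    fix y assume "y \<in> ?Q"
    then show "y \<in> ?P" by (simp add: PiE_iff)
  qed
  ultimately show ?thesis by simp
qed

lemma cylinder_in_open:
  assumes "openin (shift_topology G A) U" "x \<in> U"
  shows "\<exists>F. finite F \<and> F \<subseteq> carrier G \<and> (\<forall>y\<in>carrier G \<rightarrow>\<^sub>E A. (\<forall>h\<in>F. y h = x h) \<longrightarrow> y \<in> U)"
proof -
  obtain W where W: "finite {i \<in> carrier G. W i \<noteq> A}" "\<And>i. i \<in> carrier G \<Longrightarrow> W i \<subseteq> A"
     "x \<in> Pi\<^sub>E (carrier G) W" "Pi\<^sub>E (carrier G) W \<subseteq> U"
    using assms unfolding shift_topology_def openin_product_topology_alt by fastforce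
  have "y \<in> U" if y: "y \<in> carrier G \<rightarrow>\<^sub>E A" "\<forall>h\<in>{i \<in> carrier G. W i \<noteq> A}. y h = x h" for y
  proof -
    have "y i \<in> W i" if "i \<in> carrier G" for i
      using y(2) y(1) W(3) that by (cases "W i = A") (auto simp: PiE_iff)
    then have "y \<in> Pi\<^sub>E (carrier G) W" using y(1) by (simp add: PiE_iff)
    then show "y \<in> U" using W(4) by blast
  qed
  then show ?thesis using W(1) by (intro exI[of _ "{i \<in> carrier G. W i \<noteq> A}"]) blast
qed

lemma X_closed:
  assumes x: "x \<in> carrier G \<rightarrow>\<^sub>E A"
    and approx: "\<And>F. finite F \<Longrightarrow> F \<subseteq> carrier G \<Longrightarrow> \<exists>y\<in>X. \<forall>h\<in>F. y h = x h"
  shows "x \<in> X"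
proof (rule ccontr)
  assume "x \<notin> X"
  have top: "topspace (shift_topology G A) = carrier G \<rightarrow>\<^sub>E A" by (simp add: shift_topology_def)
  have "openin (shift_topology G A) ((carrier G \<rightarrow>\<^sub>E A) - X)"
    using subshift unfolding subshift_def closedin_def top by blast
  then obtain F where F: "finite F" "F \<subseteq> carrier G"
    "\<forall>y\<in>carrier G \<rightarrow>\<^sub>E A. (\<forall>h\<in>F. y h = x h) \<longrightarrow> y \<in> (carrier G \<rightarrow>\<^sub>E A) - X"
    using cylinder_in_open[of "(carrier G \<rightarrow>\<^sub>E A) - X" x] x \<open>x \<notin> X\<close> by blast
  obtain y where "y \<in> X" "\<forall>h\<in>F. y h = x h" using approx F(1,2) by blast
  then show False using F(3) X_full by blast
qed

text \<open>The cylinders on which \<open>f\<close> is constant cover the compact set \<open>Y\<close>; the windows of a finite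
  subcover suffice.\<close>

lemma finite_dependence:
  assumes Y: "closedin (shift_topology G A) Y"
    and loc: "\<And>x. x \<in> Y \<Longrightarrow> \<exists>F. finite F \<and> F \<subseteq> carrier G \<and>
                (\<forall>y\<in>Y. (\<forall>h\<in>F. y h = x h) \<longrightarrow> f y = f x)"
  shows "\<exists>F. finite F \<and> F \<subseteq> carrier G \<and>
           (\<forall>x\<in>Y. \<forall>y\<in>Y. (\<forall>h\<in>F. y h = x h) \<longrightarrow> f y = f x)"
proof -
  obtain W where W: "\<And>x. x \<in> Y \<Longrightarrow> finite (W x) \<and> W x \<subseteq> carrier G \<and>
                (\<forall>y\<in>Y. (\<forall>h\<in>W x. y h = x h) \<longrightarrow> f y = f x)"
    using loc by metis
  have Y_full: "Y \<subseteq> carrier G \<rightarrow>\<^sub>E A" using closedin_subset[OF Y] by (simp add: shift_topology_def)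
  let ?cyl = "\<lambda>x. {y \<in> carrier G \<rightarrow>\<^sub>E A. \<forall>h\<in>W x. y h = x h}"
  have "compact_space (shift_topology G A)"
    unfolding shift_topology_def
    by (simp add: compact_space_product_topology compact_space_discrete_topology finite_A)
  then have "compactin (shift_topology G A) Y"
    using Y closedin_compact_space by blast
  then obtain \<F> where \<F>: "finite \<F>" "\<F> \<subseteq> ?cyl ` Y" "Y \<subseteq> \<Union>\<F>"
    unfolding compactin_def
  proof (elim conjE allE[where x = "?cyl ` Y"] impE)
    show "Ball (?cyl ` Y) (openin (shift_topology G A)) \<and> Y \<subseteq> \<Union> (?cyl ` Y)"
      using openin_cylinder W Y_full by auto
  qed auto
  then obtain S where S: "S \<subseteq> Y" "finite S" "\<F> = ?cyl ` S"
    by (meson finite_subset_image)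
  have "f y = f x" if xy: "x \<in> Y" "y \<in> Y" "\<forall>h\<in>(\<Union>x\<in>S. W x). y h = x h" for x y
  proof -
    obtain s where s: "s \<in> S" "x \<in> ?cyl s" using \<F>(3) S(3) xy(1) by auto
    then have "\<forall>h\<in>W s. x h = s h" "\<forall>h\<in>W s. y h = s h" using xy(3) by auto
    then have "f x = f s" "f y = f s" using W s(1) S(1) xy(1,2) by blast+
    then show ?thesis by simp
  qed
  moreover have "finite (\<Union>x\<in>S. W x)" "(\<Union>x\<in>S. W x) \<subseteq> carrier G" using S W by auto
  ultimately show ?thesis by (intro exI[of _ "\<Union>x\<in>S. W x"]) blast
qed

section \<open>Gates and their windows\<close>

definition local_on :: "'g set \<Rightarrow> (('g \<Rightarrow> 'a) \<Rightarrow> ('g \<Rightarrow> 'a)) \<Rightarrow> bool" where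
  "local_on V \<phi> \<longleftrightarrow>
     (\<forall>x\<in>X. \<forall>h\<in>carrier G - V. \<phi> x h = x h) \<and>
     (\<forall>x\<in>X. \<forall>y\<in>X. (\<forall>h\<in>V. x h = y h) \<longrightarrow> (\<forall>h\<in>V. \<phi> x h = \<phi> y h))"

text \<open>Asking for locality of the inverse, too, makes these sets subgroups, and on a finite window it
  corresponds to continuity of the inverse.\<close>

definition windowed :: "'g set \<Rightarrow> (('g \<Rightarrow> 'a) \<Rightarrow> ('g \<Rightarrow> 'a)) set" where
  "windowed V = {\<phi> \<in> Bij X. local_on V \<phi> \<and> local_on V (gate_inv \<phi>)}"

lemma windowed_Bij: "\<phi> \<in> windowed V \<Longrightarrow> \<phi> \<in> Bij X"
  by (simp add: windowed_def)

lemma windowed_off: "\<phi> \<in> windowed V \<Longrightarrow> x \<in> X \<Longrightarrow> h \<in> carrier G \<Longrightarrow> h \<notin> V \<Longrightarrow> \<phi> x h = x h"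
  by (simp add: windowed_def local_on_def)

lemma windowed_on:
  "\<phi> \<in> windowed V \<Longrightarrow> x \<in> X \<Longrightarrow> y \<in> X \<Longrightarrow> (\<And>h. h \<in> V \<Longrightarrow> x h = y h) \<Longrightarrow> h \<in> V \<Longrightarrow> \<phi> x h = \<phi> y h"
  unfolding windowed_def local_on_def by blast

lemma local_on_comp:
  assumes "local_on V \<phi>" "local_on V \<psi>" "\<phi> \<in> Bij X" "\<psi> \<in> Bij X"
  shows "local_on V (\<phi> \<star> \<psi>)"
  unfolding local_on_def
proof (intro conjI ballI impI)
  fix x h assume "x \<in> X" "h \<in> carrier G - V"
  then show "(\<phi> \<star> \<psi>) x h = x h"
    using assms(3,4) Bij_apply[of \<psi> x] assms(1,2)[unfolded local_on_def, THEN conjunct1]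
    by (simp add: mult_apply)
next
  fix x y h assume xy: "x \<in> X" "y \<in> X" "\<forall>h\<in>V. x h = y h" "h \<in> V"
  then have "\<forall>h\<in>V. \<psi> x h = \<psi> y h" using assms(2) unfolding local_on_def by blast
  moreover have "\<psi> x \<in> X" "\<psi> y \<in> X" using xy assms Bij_apply by auto
  ultimately have "\<phi> (\<psi> x) h = \<phi> (\<psi> y) h" using assms(1) xy(4) unfolding local_on_def by blast
  then show "(\<phi> \<star> \<psi>) x h = (\<phi> \<star> \<psi>) y h" using xy assms by (simp add: mult_apply)
qed

lemma windowed_subgroup: "subgroup (windowed V) (BijGroup X)"
proof
  have "local_on V gate_one" by (auto simp: local_on_def one_apply)
  then show "gate_one \<in> windowed V" by (simp add: windowed_def)
  show "\<phi> \<star> \<psi> \<in> windowed V" if "\<phi> \<in> windowed V" "\<psi> \<in> windowed V" for \<phi> \<psi>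
  proof -
    have "\<phi> \<in> Bij X" "\<psi> \<in> Bij X" using that by (simp_all add: windowed_def)
    then show ?thesis
      using that unfolding windowed_def by (simp add: local_on_comp Sym.inv_mult_group)
  qed
  show "gate_inv \<phi> \<in> windowed V" if "\<phi> \<in> windowed V" for \<phi>
    using that by (auto simp: windowed_def)
qed (auto simp: windowed_def)

lemma local_on_mono: "local_on V \<phi> \<Longrightarrow> V \<subseteq> W \<Longrightarrow> W \<subseteq> carrier G \<Longrightarrow> local_on W \<phi>"
  unfolding local_on_def
proof (intro conjI ballI impI)
  assume V: "V \<subseteq> W" "W \<subseteq> carrier G"
    and l: "(\<forall>x\<in>X. \<forall>h\<in>carrier G - V. \<phi> x h = x h) \<and>
     (\<forall>x\<in>X. \<forall>y\<in>X. (\<forall>h\<in>V. x h = y h) \<longrightarrow> (\<forall>h\<in>V. \<phi> x h = \<phi> y h))"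
  show "\<phi> x h = x h" if "x \<in> X" "h \<in> carrier G - W" for x h
    using l V that by blast
  show "\<phi> x h = \<phi> y h" if xy: "x \<in> X" "y \<in> X" "\<forall>h\<in>W. x h = y h" and h: "h \<in> W" for x y h
  proof (cases "h \<in> V")
    case True
    then show ?thesis using l xy V(1) by blast
  next
    case False
    then have "\<phi> x h = x h" "\<phi> y h = y h" using l xy(1,2) h V(2) by blast+
    then show ?thesis using xy(3) h by simp
  qed
qed

lemma windowed_mono: "V \<subseteq> W \<Longrightarrow> W \<subseteq> carrier G \<Longrightarrow> windowed V \<subseteq> windowed W"
  unfolding windowed_def using local_on_mono by blast

text \<open>Neither map sees or changes the cells on which the other one acts.\<close>

lemma windowed_commute:
  assumes \<phi>: "\<phi> \<in> windowed V" and \<psi>: "\<psi> \<in> windowed W" and "V \<inter> W = {}" "V \<subseteq> carrier G" "W \<subseteq> carrier G"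
  shows "\<phi> \<star> \<psi> = \<psi> \<star> \<phi>"
proof (rule Bij_ext)
  have B: "\<phi> \<in> Bij X" "\<psi> \<in> Bij X" using \<phi> \<psi> by (simp_all add: windowed_Bij)
  then show "\<phi> \<star> \<psi> \<in> Bij X" "\<psi> \<star> \<phi> \<in> Bij X" by auto
  fix x assume x: "x \<in> X"
  have \<phi>x: "\<phi> x \<in> X" "\<psi> x \<in> X" using B x Bij_apply by auto
  have "\<phi> (\<psi> x) = \<psi> (\<phi> x)"
  proof (rule X_ext)
    show "\<phi> (\<psi> x) \<in> X" "\<psi> (\<phi> x) \<in> X" using B \<phi>x Bij_apply by auto
    fix h assume h: "h \<in> carrier G"
    consider "h \<in> V" "h \<notin> W" | "h \<notin> V" "h \<in> W" | "h \<notin> V" "h \<notin> W" using assms by blast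
    then show "\<phi> (\<psi> x) h = \<psi> (\<phi> x) h"
    proof cases
      case 1
      then have "\<phi> (\<psi> x) h = \<phi> x h"
        using assms x \<phi>x by (intro windowed_on[OF \<phi>]) (auto intro!: windowed_off[OF \<psi>])
      then show ?thesis using windowed_off[OF \<psi> \<phi>x(1) h] 1 by simp
    next
      case 2
      then have "\<psi> (\<phi> x) h = \<psi> x h"
        using assms x \<phi>x by (intro windowed_on[OF \<psi>]) (auto intro!: windowed_off[OF \<phi>])
      then show ?thesis using windowed_off[OF \<phi> \<phi>x(2) h] 2 by simp
    next
      case 3
      then show ?thesis using windowed_off[OF \<phi>] windowed_off[OF \<psi>] \<phi>x x h by simp
    qed
  qed
  then show "(\<phi> \<star> \<psi>) x = (\<psi> \<star> \<phi>) x" using B x by (simp add: mult_apply)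
qed

section \<open>Conjugation\<close>

lemma shift_Bij: "g \<in> carrier G \<Longrightarrow> restrict (shift G g) X \<in> Bij X"
  by (rule BijI[where \<psi> = "shift G (inv g)"]) (auto simp: shift_in_X shift_inv_X)

lemma inv_shift: "g \<in> carrier G \<Longrightarrow> gate_inv (restrict (shift G g) X) = restrict (shift G (inv g)) X"
  by (rule inv_eqI) (auto simp: shift_Bij shift_in_X shift_inv_X)

lemma conj_Bij: "\<phi> \<in> Bij X \<Longrightarrow> g \<in> carrier G \<Longrightarrow> conj \<phi> g \<in> Bij X"
  unfolding gate_conj_def by (simp add: shift_Bij)

lemma conj_apply:
  "\<phi> \<in> Bij X \<Longrightarrow> g \<in> carrier G \<Longrightarrow> x \<in> X \<Longrightarrow> conj \<phi> g x = shift G (inv g) (\<phi> (shift G g x))"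
  unfolding gate_conj_def by (simp add: shift_Bij mult_apply inv_shift shift_in_X Bij_apply)

text \<open>Conjugation by a shift moves windows by right translation, see \<open>windowed_conj\<close> below; as a
  homomorphism it carries products of commutators to products of commutators.\<close>

lemma conj_hom:
  assumes "g \<in> carrier G"
  shows "(\<lambda>\<phi>. conj \<phi> g) \<in> hom (BijGroup X) (BijGroup X)"
proof (rule homI)
  fix \<phi> \<psi> assume "\<phi> \<in> carrier (BijGroup X)" "\<psi> \<in> carrier (BijGroup X)"
  then have B: "\<phi> \<in> Bij X" "\<psi> \<in> Bij X" by (simp_all add: BijGroup_def)
  show "conj (\<phi> \<star> \<psi>) g = conj \<phi> g \<star> conj \<psi> g"
    by (rule Bij_ext) (use B assms in \<open>auto simp: conj_Bij conj_apply mult_apply shift_in_X Bij_apply shift_inv_X\<close>)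
qed (use assms conj_Bij in \<open>auto simp: BijGroup_def\<close>)

lemma conj_mult:
  "\<phi> \<in> Bij X \<Longrightarrow> \<psi> \<in> Bij X \<Longrightarrow> g \<in> carrier G \<Longrightarrow> conj (\<phi> \<star> \<psi>) g = conj \<phi> g \<star> conj \<psi> g"
  using hom_mult[OF conj_hom] by (simp add: BijGroup_def)

lemma conj_one: "g \<in> carrier G \<Longrightarrow> conj gate_one g = gate_one"
  by (rule Bij_ext) (auto simp: conj_Bij conj_apply one_apply shift_in_X shift_inv_X)

lemma conj_inv: "\<phi> \<in> Bij X \<Longrightarrow> g \<in> carrier G \<Longrightarrow> conj (gate_inv \<phi>) g = gate_inv (conj \<phi> g)"
  by (rule inv_eqI[symmetric]) (auto simp: conj_Bij conj_apply shift_in_X shift_inv_X Bij_apply inv_apply)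

lemma conj_conj:
  assumes "\<phi> \<in> Bij X" "g \<in> carrier G" "h \<in> carrier G"
  shows "conj (conj \<phi> g) h = conj \<phi> (g \<otimes> h)"
proof (rule Bij_ext)
  fix x assume "x \<in> X"
  then show "conj (conj \<phi> g) h x = conj \<phi> (g \<otimes> h) x"
    using assms by (simp add: conj_Bij conj_apply shift_in_X Bij_apply shift_shift inv_mult_group)
qed (use assms in \<open>auto simp: conj_Bij\<close>)

lemma conj_at_one: "\<phi> \<in> Bij X \<Longrightarrow> conj \<phi> \<one> = \<phi>"
  by (rule Bij_ext) (use X_full Bij_apply in \<open>auto simp: conj_Bij conj_apply shift_one subset_iff\<close>)

lemma local_on_conj:
  assumes "\<phi> \<in> Bij X" "g \<in> carrier G" "V \<subseteq> carrier G" "local_on V \<phi>"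
  shows "local_on (V #> g) (conj \<phi> g)"
proof -
  have mem: "h \<otimes> inv g \<in> V \<longleftrightarrow> h \<in> V #> g" if "h \<in> carrier G" for h
    using assms that unfolding r_coset_def by (force simp: m_assoc subset_iff)
  show ?thesis
    unfolding local_on_def
  proof (intro conjI ballI impI)
    fix x h assume "x \<in> X" "h \<in> carrier G - (V #> g)"
    then show "conj \<phi> g x h = x h"
      using assms(1-3) assms(4)[unfolded local_on_def, THEN conjunct1] mem[of h]
      by (simp add: conj_apply shift_in_X m_assoc)
  next
    fix x y h assume xy: "x \<in> X" "y \<in> X" "\<forall>h\<in>V #> g. x h = y h" and h: "h \<in> V #> g"
    have "h \<in> carrier G" using h assms r_coset_subset_G by blast
    moreover have "\<forall>k\<in>V. shift G g x k = shift G g y k"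
      using xy(3) assms(3) unfolding r_coset_def by auto
    moreover have "shift G g x \<in> X" "shift G g y \<in> X" using xy assms(2) shift_in_X by auto
    ultimately have "\<forall>k\<in>V. \<phi> (shift G g x) k = \<phi> (shift G g y) k"
      using assms(4) unfolding local_on_def by blast
    then have "\<phi> (shift G g x) (h \<otimes> inv g) = \<phi> (shift G g y) (h \<otimes> inv g)"
      using mem[of h] h \<open>h \<in> carrier G\<close> by blast
    then show "conj \<phi> g x h = conj \<phi> g y h"
      using assms(1,2) xy(1,2) \<open>h \<in> carrier G\<close> by (simp add: conj_apply)
  qed
qed

lemma windowed_conj:
  assumes "\<phi> \<in> windowed V" "g \<in> carrier G" "V \<subseteq> carrier G"
  shows "conj \<phi> g \<in> windowed (V #> g)"
  using assms unfolding windowed_def by (auto simp: conj_Bij local_on_conj conj_inv[symmetric])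

end

context shift_space
begin

section \<open>Infinite products of commuting gates\<close>

definition moves :: "(('g \<Rightarrow> 'a) \<Rightarrow> ('g \<Rightarrow> 'a)) \<Rightarrow> 'g \<Rightarrow> bool" where
  "moves \<phi> h \<longleftrightarrow> (\<exists>x\<in>X. \<phi> x h \<noteq> x h)"

text \<open>The limit of the finite products. The factors that do not move the cell \<open>h\<close> may be
  applied last because of commutativity, and then they leave the content of \<open>h\<close> alone; so the value at
  \<open>h\<close> is that of one finite product.\<close>

definition inf_prod :: "('i \<Rightarrow> ('g \<Rightarrow> 'a) \<Rightarrow> ('g \<Rightarrow> 'a)) \<Rightarrow> 'i set \<Rightarrow> ('g \<Rightarrow> 'a) \<Rightarrow> ('g \<Rightarrow> 'a)" where
  "inf_prod \<phi> S = (\<lambda>x\<in>X. \<lambda>h\<in>carrier G. finprod (BijGroup X) \<phi> {i \<in> S. moves (\<phi> i) h} x h)"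

text \<open>What makes the infinite product of a family of gates meaningful and invertible.\<close>

definition tame :: "('i \<Rightarrow> ('g \<Rightarrow> 'a) \<Rightarrow> ('g \<Rightarrow> 'a)) \<Rightarrow> 'i set \<Rightarrow> bool" where
  "tame \<phi> S \<longleftrightarrow> Sym.commuting \<phi> S \<and>
     (\<forall>i\<in>S. \<exists>V. finite V \<and> V \<subseteq> carrier G \<and> \<phi> i \<in> windowed V) \<and>
     (\<forall>h\<in>carrier G. finite {i \<in> S. moves (\<phi> i) h})"

lemma tame_commuting: "tame \<phi> S \<Longrightarrow> T \<subseteq> S \<Longrightarrow> Sym.commuting \<phi> T"
  unfolding tame_def using Sym.commuting_subset by blast

lemma tame_commuting_self: "tame \<phi> S \<Longrightarrow> Sym.commuting \<phi> S"
  unfolding tame_def by blast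

lemma tame_Bij: "tame \<phi> S \<Longrightarrow> i \<in> S \<Longrightarrow> \<phi> i \<in> Bij X"
  unfolding tame_def Sym.commuting_def by blast

lemma tame_finite: "tame \<phi> S \<Longrightarrow> h \<in> carrier G \<Longrightarrow> finite {i \<in> S. moves (\<phi> i) h}"
  unfolding tame_def by blast

lemma tame_finprod_Bij: "tame \<phi> S \<Longrightarrow> T \<subseteq> S \<Longrightarrow> finite T \<Longrightarrow> finprod (BijGroup X) \<phi> T \<in> Bij X"
  using Sym.finprod_commuting_closed tame_commuting by blast

lemma finprod_windowed:
  assumes "tame \<phi> S" "T \<subseteq> S" "finite T"
  shows "\<exists>V. finite V \<and> V \<subseteq> carrier G \<and> finprod (BijGroup X) \<phi> T \<in> windowed V"
proof -
  obtain V where V: "\<And>i. i \<in> S \<Longrightarrow> finite (V i) \<and> V i \<subseteq> carrier G \<and> \<phi> i \<in> windowed (V i)"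
    using assms(1) unfolding tame_def by metis
  let ?V = "\<Union>i\<in>T. V i"
  have "finprod (BijGroup X) \<phi> T \<in> windowed ?V"
  proof (rule Sym.finprod_commuting_in_subgroup[OF assms(3) _ windowed_subgroup])
    show "Sym.commuting \<phi> T" using tame_commuting assms by blast
    show "\<phi> i \<in> windowed ?V" if "i \<in> T" for i
    proof -
      have "V i \<subseteq> ?V" "?V \<subseteq> carrier G" using that V assms(2) by blast+
      then show ?thesis using windowed_mono[of "V i" ?V] V that assms(2) by blast
    qed
  qed
  moreover have "finite ?V" "?V \<subseteq> carrier G" using V assms(2,3) by auto
  ultimately show ?thesis by blast
qed

lemma finprod_fixes:
  assumes "finite T" "Sym.commuting \<phi> T" "\<And>i. i \<in> T \<Longrightarrow> \<not> moves (\<phi> i) h" "x \<in> X"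
  shows "finprod (BijGroup X) \<phi> T x h = x h"
  using assms
proof (induction T rule: finite_induct)
  case empty
  then show ?case by (simp add: Sym.finprod_commuting_empty one_apply)
next
  case (insert i T)
  have c: "Sym.commuting \<phi> T" using insert.prems(1) Sym.commuting_subset by blast
  have B: "finprod (BijGroup X) \<phi> T \<in> Bij X" "\<phi> i \<in> Bij X"
    using Sym.finprod_commuting_closed[OF c insert.hyps(1)] insert.prems(1) unfolding Sym.commuting_def
    by blast+
  then have "finprod (BijGroup X) \<phi> T x \<in> X" using Bij_apply insert.prems(3) by blast
  then have "\<phi> i (finprod (BijGroup X) \<phi> T x) h = finprod (BijGroup X) \<phi> T x h"
    using insert.prems(2)[of i] unfolding moves_def by blast
  then show ?case
    using insert c B by (simp add: Sym.finprod_commuting_insert mult_apply)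
qed

text \<open>Enlarging the index set beyond the factors that move \<open>h\<close> adds only factors that fix \<open>h\<close>, and by
  commutativity these can be put in front, that is, applied last.\<close>

lemma inf_prod_eq:
  assumes "tame \<phi> S" "finite T" "T \<subseteq> S" "{i \<in> S. moves (\<phi> i) h} \<subseteq> T" "x \<in> X" "h \<in> carrier G"
  shows "inf_prod \<phi> S x h = finprod (BijGroup X) \<phi> T x h"
proof -
  let ?M = "{i \<in> S. moves (\<phi> i) h}"
  have c: "Sym.commuting \<phi> T" "Sym.commuting \<phi> (T - ?M)" "Sym.commuting \<phi> ?M"
    using assms tame_commuting by blast+
  have fin: "finite (T - ?M)" "finite ?M" using assms finite_subset by auto
  have un: "(T - ?M) \<union> ?M = T" using assms(4) by blast
  have "finprod (BijGroup X) \<phi> ((T - ?M) \<union> ?M) = finprod (BijGroup X) \<phi> (T - ?M) \<star> finprod (BijGroup X) \<phi> ?M"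
    using Sym.finprod_commuting_union[OF fin] c unfolding un by blast
  then have "finprod (BijGroup X) \<phi> T = finprod (BijGroup X) \<phi> (T - ?M) \<star> finprod (BijGroup X) \<phi> ?M"
    unfolding un .
  moreover have B: "finprod (BijGroup X) \<phi> (T - ?M) \<in> Bij X" "finprod (BijGroup X) \<phi> ?M \<in> Bij X"
    using Sym.finprod_commuting_closed c fin by auto
  moreover have "finprod (BijGroup X) \<phi> (T - ?M) (finprod (BijGroup X) \<phi> ?M x) h = finprod (BijGroup X) \<phi> ?M x h"
    using c fin assms(3) Bij_apply[OF B(2) assms(5)] by (intro finprod_fixes) auto
  ultimately show ?thesis using assms by (simp add: inf_prod_def mult_apply)
qed

lemma inf_prod_approx:
  assumes "tame \<phi> S" "finite F" "F \<subseteq> carrier G"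
  obtains T where "finite T" "T \<subseteq> S"
    "\<And>U x h. finite U \<Longrightarrow> T \<subseteq> U \<Longrightarrow> U \<subseteq> S \<Longrightarrow> x \<in> X \<Longrightarrow> h \<in> F
       \<Longrightarrow> inf_prod \<phi> S x h = finprod (BijGroup X) \<phi> U x h"
proof
  show "finite (\<Union>h\<in>F. {i \<in> S. moves (\<phi> i) h})" using assms tame_finite by blast
  fix U x h assume "finite U" "(\<Union>h\<in>F. {i \<in> S. moves (\<phi> i) h}) \<subseteq> U" "U \<subseteq> S" "x \<in> X" "h \<in> F"
  then show "inf_prod \<phi> S x h = finprod (BijGroup X) \<phi> U x h"
    using assms by (intro inf_prod_eq) auto
qed auto

text \<open>On each finite set of cells the infinite product agrees with a point of \<open>X\<close>, a finite product
  applied to \<open>x\<close>, and \<open>X\<close> is closed.\<close>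

lemma inf_prod_in_X:
  assumes "tame \<phi> S" "x \<in> X"
  shows "inf_prod \<phi> S x \<in> X"
proof (rule X_closed)
  have approx: "\<exists>y\<in>X. \<forall>h\<in>F. y h = inf_prod \<phi> S x h" if F: "finite F" "F \<subseteq> carrier G" for F
  proof -
    obtain T where T: "finite T" "T \<subseteq> S"
      "\<And>U x h. finite U \<Longrightarrow> T \<subseteq> U \<Longrightarrow> U \<subseteq> S \<Longrightarrow> x \<in> X \<Longrightarrow> h \<in> F
         \<Longrightarrow> inf_prod \<phi> S x h = finprod (BijGroup X) \<phi> U x h"
      using inf_prod_approx[OF assms(1) F] by blast
    have "finprod (BijGroup X) \<phi> T x \<in> X"
      using Bij_apply[OF tame_finprod_Bij[OF assms(1) T(2,1)] assms(2)] .
    then show ?thesis using T(3)[OF T(1) subset_refl T(2) assms(2)] by metis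
  qed
  then show "\<And>F. finite F \<Longrightarrow> F \<subseteq> carrier G \<Longrightarrow> \<exists>y\<in>X. \<forall>h\<in>F. y h = inf_prod \<phi> S x h" .
  show "inf_prod \<phi> S x \<in> carrier G \<rightarrow>\<^sub>E A"
  proof (rule PiE_I)
    fix h assume h: "h \<in> carrier G"
    then obtain y where "y \<in> X" "y h = inf_prod \<phi> S x h" using approx[of "{h}"] by auto
    then show "inf_prod \<phi> S x h \<in> A" using X_full h by (metis PiE_mem subsetD)
  qed (use assms in \<open>simp add: inf_prod_def\<close>)
qed

lemma inf_prod_extensional: "inf_prod \<phi> S \<in> extensional X"
  by (simp add: inf_prod_def)

lemma moves_comp:
  assumes "\<phi> \<in> Bij X" "\<psi> \<in> Bij X" "moves (\<phi> \<star> \<psi>) h"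
  shows "moves \<phi> h \<or> moves \<psi> h"
proof -
  obtain x where "x \<in> X" "\<phi> (\<psi> x) h \<noteq> x h" using assms by (auto simp: moves_def mult_apply)
  then show ?thesis using Bij_apply[OF assms(2)] unfolding moves_def by metis
qed

lemma moves_inv: "\<phi> \<in> Bij X \<Longrightarrow> moves (gate_inv \<phi>) h \<Longrightarrow> moves \<phi> h"
  unfolding moves_def using inv_apply Bij_apply Sym.inv_closed by metis

lemma tame_mult:
  assumes "tame \<phi> S" "tame \<psi> S"
    and cross: "\<And>i j. i \<in> S \<Longrightarrow> j \<in> S \<Longrightarrow> i \<noteq> j \<Longrightarrow> \<phi> i \<star> \<psi> j = \<psi> j \<star> \<phi> i"
  shows "tame (\<lambda>i. \<phi> i \<star> \<psi> i) S"
  unfolding tame_def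
proof (intro conjI ballI)
  show "Sym.commuting (\<lambda>i. \<phi> i \<star> \<psi> i) S"
    by (rule Sym.commuting_mult[OF tame_commuting_self[OF assms(1)] tame_commuting_self[OF assms(2)] cross])
next
  fix i assume i: "i \<in> S"
  then obtain V W where V: "finite V" "V \<subseteq> carrier G" "\<phi> i \<in> windowed V"
      and W: "finite W" "W \<subseteq> carrier G" "\<psi> i \<in> windowed W"
    using assms unfolding tame_def by meson
  then have "\<phi> i \<in> windowed (V \<union> W)" "\<psi> i \<in> windowed (V \<union> W)"
    using windowed_mono[of V "V \<union> W"] windowed_mono[of W "V \<union> W"] by auto
  then have "\<phi> i \<star> \<psi> i \<in> windowed (V \<union> W)" using subgroup.m_closed[OF windowed_subgroup] by blast
  then show "\<exists>V. finite V \<and> V \<subseteq> carrier G \<and> \<phi> i \<star> \<psi> i \<in> windowed V" using V W by (meson finite_UnI le_sup_iff)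
next
  fix h assume h: "h \<in> carrier G"
  have "{i \<in> S. moves (\<phi> i \<star> \<psi> i) h} \<subseteq> {i \<in> S. moves (\<phi> i) h} \<union> {i \<in> S. moves (\<psi> i) h}"
    using moves_comp[OF tame_Bij[OF assms(1)] tame_Bij[OF assms(2)]] by blast
  then show "finite {i \<in> S. moves (\<phi> i \<star> \<psi> i) h}"
    by (rule finite_subset) (use tame_finite[OF assms(1) h] tame_finite[OF assms(2) h] in simp)
qed

text \<open>Both sides are compared at one cell. The finite product that computes the outer factor there reads
  finitely many cells, and on these the inner factor agrees with a finite product as well. So one finite
  index set serves all three infinite products.\<close>

lemma inf_prod_mult:
  assumes "tame \<phi> S" "tame \<psi> S"
    and cross: "\<And>i j. i \<in> S \<Longrightarrow> j \<in> S \<Longrightarrow> i \<noteq> j \<Longrightarrow> \<phi> i \<star> \<psi> j = \<psi> j \<star> \<phi> i"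
    and x: "x \<in> X"
  shows "inf_prod (\<lambda>i. \<phi> i \<star> \<psi> i) S x = inf_prod \<phi> S (inf_prod \<psi> S x)"
proof (rule X_ext)
  have tm: "tame (\<lambda>i. \<phi> i \<star> \<psi> i) S" by (rule tame_mult[OF assms(1,2) cross])
  show "inf_prod (\<lambda>i. \<phi> i \<star> \<psi> i) S x \<in> X" using inf_prod_in_X[OF tm x] .
  show "inf_prod \<phi> S (inf_prod \<psi> S x) \<in> X" using inf_prod_in_X[OF assms(1) inf_prod_in_X[OF assms(2) x]] .
  fix h assume h: "h \<in> carrier G"
  let ?P = "finprod (BijGroup X)"
  let ?T1 = "{i \<in> S. moves (\<phi> i) h}"
  have T1: "finite ?T1" "?T1 \<subseteq> S" using tame_finite[OF assms(1) h] by auto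
  then obtain V where V: "finite V" "V \<subseteq> carrier G" "?P \<phi> ?T1 \<in> windowed V"
    using finprod_windowed[OF assms(1) T1(2,1)] by blast
  obtain T2 where T2: "finite T2" "T2 \<subseteq> S"
      "\<And>U x k. finite U \<Longrightarrow> T2 \<subseteq> U \<Longrightarrow> U \<subseteq> S \<Longrightarrow> x \<in> X \<Longrightarrow> k \<in> insert h V
         \<Longrightarrow> inf_prod \<psi> S x k = ?P \<psi> U x k"
    using inf_prod_approx[OF assms(2), of "insert h V"] V h by auto
  define T where "T = ?T1 \<union> T2 \<union> {i \<in> S. moves (\<phi> i \<star> \<psi> i) h}"
  have T: "finite T" "T \<subseteq> S" "?T1 \<subseteq> T" "T2 \<subseteq> T" "{i \<in> S. moves (\<phi> i \<star> \<psi> i) h} \<subseteq> T"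
    unfolding T_def using T1 T2(1,2) tame_finite[OF tm h] by auto
  have B: "?P \<phi> T \<in> Bij X" "?P \<psi> T \<in> Bij X"
    using tame_finprod_Bij[OF assms(1) T(2,1)] tame_finprod_Bij[OF assms(2) T(2,1)] .
  define y where "y = ?P \<psi> T x"
  have y: "y \<in> X" using B x Bij_apply by (simp add: y_def)
  have z: "inf_prod \<psi> S x \<in> X" using inf_prod_in_X[OF assms(2) x] .
  have agree: "inf_prod \<psi> S x k = y k" if "k \<in> insert h V" for k
    unfolding y_def using T2(3) T that x by blast
  have "?P (\<lambda>i. \<phi> i \<star> \<psi> i) T = ?P \<phi> T \<star> ?P \<psi> T"
    using T(2) by (intro Sym.finprod_commuting_mult[OF T(1)] tame_commuting[OF assms(1)]
        tame_commuting[OF assms(2)] tame_commuting[OF tm] cross) blast+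
  then have "inf_prod (\<lambda>i. \<phi> i \<star> \<psi> i) S x h = ?P \<phi> T y h"
    using inf_prod_eq[OF tm T(1,2,5) x h] B x by (simp add: mult_apply y_def)
  also have "\<dots> = inf_prod \<phi> S y h" using inf_prod_eq[OF assms(1) T(1,2,3) y h] by simp
  also have "\<dots> = ?P \<phi> ?T1 y h" using inf_prod_eq[OF assms(1) T1 subset_refl y h] .
  also have "\<dots> = ?P \<phi> ?T1 (inf_prod \<psi> S x) h"
  proof (cases "h \<in> V")
    case True
    then show ?thesis using agree by (intro windowed_on[OF V(3) y z]) auto
  next
    case False
    then show ?thesis using windowed_off[OF V(3) _ h] y z agree by simp
  qed
  also have "\<dots> = inf_prod \<phi> S (inf_prod \<psi> S x) h"
    using inf_prod_eq[OF assms(1) T1 subset_refl z h] by simp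
  finally show "inf_prod (\<lambda>i. \<phi> i \<star> \<psi> i) S x h = inf_prod \<phi> S (inf_prod \<psi> S x) h" .
qed

lemma inf_prod_cong:
  assumes "tame \<phi> S" "\<And>i. i \<in> S \<Longrightarrow> \<phi> i = \<psi> i"
  shows "inf_prod \<phi> S = inf_prod \<psi> S"
proof -
  have eq: "{i \<in> S. moves (\<phi> i) h} = {i \<in> S. moves (\<psi> i) h}" for h using assms(2) by auto
  have "finprod (BijGroup X) \<phi> {i \<in> S. moves (\<phi> i) h} = finprod (BijGroup X) \<psi> {i \<in> S. moves (\<phi> i) h}"
    if "h \<in> carrier G" for h
    using tame_finite[OF assms(1) that] assms by (intro Sym.finprod_commuting_cong tame_commuting[OF assms(1)]) auto
  then show ?thesis unfolding inf_prod_def eq[symmetric] by (intro restrict_ext) auto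
qed

lemma moves_one: "\<not> moves gate_one h"
  by (simp add: moves_def one_apply)

lemma tame_inv:
  assumes "tame \<phi> S"
  shows "tame (\<lambda>i. gate_inv (\<phi> i)) S"
  unfolding tame_def
proof (intro conjI ballI)
  show "Sym.commuting (\<lambda>i. gate_inv (\<phi> i)) S"
    using assms Sym.commuting_inv unfolding tame_def by blast
  show "\<exists>V. finite V \<and> V \<subseteq> carrier G \<and> gate_inv (\<phi> i) \<in> windowed V" if "i \<in> S" for i
    using assms that subgroup.m_inv_closed[OF windowed_subgroup] unfolding tame_def by blast
  fix h assume "h \<in> carrier G"
  moreover have "{i \<in> S. moves (gate_inv (\<phi> i)) h} \<subseteq> {i \<in> S. moves (\<phi> i) h}"
    using moves_inv tame_Bij[OF assms] by blast
  ultimately show "finite {i \<in> S. moves (gate_inv (\<phi> i)) h}"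
    using tame_finite[OF assms] finite_subset by blast
qed

lemma inf_prod_Bij:
  assumes "tame \<phi> S"
  shows "inf_prod \<phi> S \<in> Bij X"
proof (rule BijI[OF inf_prod_extensional])
  have ti: "tame (\<lambda>i. gate_inv (\<phi> i)) S" using tame_inv[OF assms] .
  have one: "inf_prod \<psi> S x = x" if "\<And>i. i \<in> S \<Longrightarrow> \<psi> i = gate_one" "x \<in> X" for \<psi> x
  proof -
    have empty: "{i \<in> S. moves (\<psi> i) h} = {}" for h using that(1) moves_one by auto
    have "inf_prod \<psi> S x = restrict x (carrier G)"
      unfolding inf_prod_def empty using that(2) by (simp add: Sym.finprod_commuting_empty one_apply)
    then show ?thesis using PiE_restrict[OF subsetD[OF X_full that(2)]] by simp
  qed
  have comm: "\<phi> i \<star> gate_inv (\<phi> j) = gate_inv (\<phi> j) \<star> \<phi> i" if "i \<in> S" "j \<in> S" for i j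
  proof (rule Sym.commute_inv)
    show "\<phi> i \<in> Bij X" "\<phi> j \<in> Bij X" using tame_Bij[OF assms] that by auto
    show "\<phi> i \<star> \<phi> j = \<phi> j \<star> \<phi> i" using assms that unfolding tame_def Sym.commuting_def by blast
  qed
  fix x assume x: "x \<in> X"
  show "inf_prod \<phi> S x \<in> X" "inf_prod (\<lambda>i. gate_inv (\<phi> i)) S x \<in> X"
    using assms ti x inf_prod_in_X by auto
  have "inf_prod (\<lambda>i. \<phi> i \<star> gate_inv (\<phi> i)) S x = inf_prod \<phi> S (inf_prod (\<lambda>i. gate_inv (\<phi> i)) S x)"
    by (rule inf_prod_mult[OF assms ti comm x])
  then show "inf_prod \<phi> S (inf_prod (\<lambda>i. gate_inv (\<phi> i)) S x) = x"
    using one tame_Bij[OF assms] x by simp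
  have "inf_prod (\<lambda>i. gate_inv (\<phi> i) \<star> \<phi> i) S x = inf_prod (\<lambda>i. gate_inv (\<phi> i)) S (inf_prod \<phi> S x)"
    by (rule inf_prod_mult[OF ti assms comm[symmetric] x])
  then show "inf_prod (\<lambda>i. gate_inv (\<phi> i)) S (inf_prod \<phi> S x) = x"
    using one tame_Bij[OF assms] x by simp
qed

lemma inf_prod_hom:
  assumes "tame \<phi> S" "tame \<psi> S"
    and cross: "\<And>i j. i \<in> S \<Longrightarrow> j \<in> S \<Longrightarrow> i \<noteq> j \<Longrightarrow> \<phi> i \<star> \<psi> j = \<psi> j \<star> \<phi> i"
  shows "inf_prod (\<lambda>i. \<phi> i \<star> \<psi> i) S = inf_prod \<phi> S \<star> inf_prod \<psi> S"
proof (rule Bij_ext)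
  show "inf_prod (\<lambda>i. \<phi> i \<star> \<psi> i) S \<in> Bij X" using tame_mult[OF assms] inf_prod_Bij by blast
  show "inf_prod \<phi> S \<star> inf_prod \<psi> S \<in> Bij X" using assms(1,2) inf_prod_Bij by auto
  show "inf_prod (\<lambda>i. \<phi> i \<star> \<psi> i) S x = (inf_prod \<phi> S \<star> inf_prod \<psi> S) x" if "x \<in> X" for x
    using inf_prod_mult[OF assms that] mult_apply[OF inf_prod_Bij[OF assms(1)] inf_prod_Bij[OF assms(2)] that]
    by simp
qed

lemma tame_subset:
  assumes "tame \<phi> S" "T \<subseteq> S" shows "tame \<phi> T"
  unfolding tame_def
proof (intro conjI ballI)
  fix h assume "h \<in> carrier G"
  then show "finite {i \<in> T. moves (\<phi> i) h}"
    using tame_finite[OF assms(1)] assms(2) finite_subset[of "{i \<in> T. moves (\<phi> i) h}" "{i \<in> S. moves (\<phi> i) h}"]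
    by blast
next
  show "Sym.commuting \<phi> T" using assms tame_commuting by blast
  show "\<exists>V. finite V \<and> V \<subseteq> carrier G \<and> \<phi> i \<in> windowed V" if "i \<in> T" for i
    using assms that unfolding tame_def by blast
qed

text \<open>Filling up a family with identities turns products over disjoint index sets into products over one
  index set, so that \<open>inf_prod_hom\<close> also gives \<open>inf_prod_union\<close>.\<close>

lemma inf_prod_extend:
  assumes "tame \<phi> S" "T \<subseteq> S"
  shows "tame (\<lambda>i. if i \<in> T then \<phi> i else gate_one) S"
    and "inf_prod (\<lambda>i. if i \<in> T then \<phi> i else gate_one) S = inf_prod \<phi> T"
proof -
  let ?\<psi> = "\<lambda>i. if i \<in> T then \<phi> i else gate_one"
  have eq: "{i \<in> S. moves (?\<psi> i) h} = {i \<in> T. moves (\<phi> i) h}" for h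
    using assms(2) moves_one by auto
  show "tame ?\<psi> S"
    unfolding tame_def eq
  proof (intro conjI ballI)
    show "Sym.commuting ?\<psi> S"
      unfolding Sym.commuting_def
    proof (intro conjI ballI)
      have B: "\<phi> i \<in> Bij X" if "i \<in> S" for i using tame_Bij[OF assms(1) that] .
      then show "?\<psi> i \<in> Bij X" if "i \<in> S" for i using that by simp
      show "?\<psi> i \<star> ?\<psi> j = ?\<psi> j \<star> ?\<psi> i" if "i \<in> S" "j \<in> S" for i j
      proof (cases "i \<in> T \<and> j \<in> T")
        case True
        have "\<phi> i \<star> \<phi> j = \<phi> j \<star> \<phi> i" using assms(1) that unfolding tame_def Sym.commuting_def by blast
        then show ?thesis using True by simp
      next
        case False
        then show ?thesis using B that by auto
      qed
    qed
    show "\<exists>V. finite V \<and> V \<subseteq> carrier G \<and> ?\<psi> i \<in> windowed V" if "i \<in> S" for i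
    proof (cases "i \<in> T")
      case True
      moreover have "\<exists>V. finite V \<and> V \<subseteq> carrier G \<and> \<phi> i \<in> windowed V"
        using assms(1) that unfolding tame_def by blast
      ultimately show ?thesis by simp
    next
      case False
      then show ?thesis
        using subgroup.one_closed[OF windowed_subgroup, of "{}"] by (intro exI[of _ "{}"]) simp
    qed
    show "finite {i \<in> T. moves (\<phi> i) h}" if "h \<in> carrier G" for h
      using tame_finite[OF tame_subset[OF assms] that] .
  qed
  have "finprod (BijGroup X) ?\<psi> {i \<in> T. moves (\<phi> i) h} = finprod (BijGroup X) \<phi> {i \<in> T. moves (\<phi> i) h}"
    if "h \<in> carrier G" for h
    using tame_finite[OF tame_subset[OF assms] that] tame_commuting[OF tame_subset[OF assms]]
    by (intro Sym.finprod_commuting_cong[symmetric]) auto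
  then show "inf_prod ?\<psi> S = inf_prod \<phi> T"
    unfolding inf_prod_def eq by (intro restrict_ext) auto
qed

lemma inf_prod_union:
  assumes "tame \<phi> (S \<union> T)" "S \<inter> T = {}"
  shows "inf_prod \<phi> (S \<union> T) = inf_prod \<phi> S \<star> inf_prod \<phi> T"
proof -
  let ?f = "\<lambda>i. if i \<in> S then \<phi> i else gate_one" and ?g = "\<lambda>i. if i \<in> T then \<phi> i else gate_one"
  have B: "\<phi> i \<in> Bij X" if "i \<in> S \<union> T" for i using tame_Bij[OF assms(1) that] .
  have comm: "\<phi> i \<star> \<phi> j = \<phi> j \<star> \<phi> i" if "i \<in> S \<union> T" "j \<in> S \<union> T" for i j
    using assms that unfolding tame_def Sym.commuting_def by blast
  have "inf_prod \<phi> (S \<union> T) = inf_prod (\<lambda>i. ?f i \<star> ?g i) (S \<union> T)"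
    using assms B by (intro inf_prod_cong) auto
  also have "\<dots> = inf_prod ?f (S \<union> T) \<star> inf_prod ?g (S \<union> T)"
  proof (rule inf_prod_hom)
    show "?f i \<star> ?g j = ?g j \<star> ?f i" if "i \<in> S \<union> T" "j \<in> S \<union> T" for i j
      using B[OF that(1)] B[OF that(2)] comm[OF that] by simp
  qed (rule inf_prod_extend(1)[OF assms(1)], blast)+
  also have "\<dots> = inf_prod \<phi> S \<star> inf_prod \<phi> T"
    using inf_prod_extend(2)[OF assms(1)] by simp
  finally show ?thesis .
qed

lemma inf_prod_reindex:
  assumes "tame \<phi> (f ` S)" "inj_on f S"
  shows "inf_prod (\<lambda>i. \<phi> (f i)) S = inf_prod \<phi> (f ` S)"
proof -
  have eq: "{i \<in> f ` S. moves (\<phi> i) h} = f ` {i \<in> S. moves (\<phi> (f i)) h}" for h by auto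
  have "finprod (BijGroup X) (\<lambda>i. \<phi> (f i)) {i \<in> S. moves (\<phi> (f i)) h} =
        finprod (BijGroup X) \<phi> {i \<in> f ` S. moves (\<phi> i) h}" if "h \<in> carrier G" for h
  proof -
    have "inj_on f {i \<in> S. moves (\<phi> (f i)) h}" using assms(2) by (rule inj_on_subset) auto
    moreover from this have "finite {i \<in> S. moves (\<phi> (f i)) h}"
      using tame_finite[OF assms(1) that] unfolding eq by (simp add: finite_image_iff)
    ultimately show ?thesis
      unfolding eq by (intro Sym.finprod_commuting_reindex tame_commuting[OF assms(1)]) auto
  qed
  then show ?thesis unfolding inf_prod_def by (intro restrict_ext) auto
qed

end

context shift_space
begin

section \<open>Gates are the bijections with a finite window\<close>

lemma topspace_X: "topspace (subtopology (shift_topology G A) X) = X"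
  using X_full by (auto simp: shift_topology_def)

text \<open>To know \<open>\<phi> x\<close> on finitely many cells it suffices to know \<open>x\<close> on these and on \<open>V\<close>.\<close>

lemma local_on_continuous:
  assumes V: "finite V" "V \<subseteq> carrier G" and l: "local_on V \<phi>" and fX: "\<And>x. x \<in> X \<Longrightarrow> \<phi> x \<in> X"
  shows "continuous_map (subtopology (shift_topology G A) X) (subtopology (shift_topology G A) X) \<phi>"
proof -
  have full: "x \<in> X \<Longrightarrow> x \<in> carrier G \<rightarrow>\<^sub>E A" for x using X_full by blast
  have top: "\<phi> \<in> X \<rightarrow> topspace (shift_topology G A)" using fX full by (auto simp: shift_topology_def)
  have pre: "openin (subtopology (shift_topology G A) X) {x \<in> X. \<phi> x \<in> U}"
    if U: "openin (shift_topology G A) U" for U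
  proof (subst openin_subopen, intro ballI)
    fix x assume "x \<in> {x \<in> X. \<phi> x \<in> U}"
    then have x: "x \<in> X" "\<phi> x \<in> U" by auto
    obtain F where F: "finite F" "F \<subseteq> carrier G"
      "\<forall>y\<in>carrier G \<rightarrow>\<^sub>E A. (\<forall>h\<in>F. y h = \<phi> x h) \<longrightarrow> y \<in> U"
      using cylinder_in_open[OF U x(2)] by blast
    let ?T = "X \<inter> {y \<in> carrier G \<rightarrow>\<^sub>E A. \<forall>h\<in>F \<union> V. y h = x h}"
    have "openin (subtopology (shift_topology G A) X) ?T"
    proof (rule openin_subtopology_Int2, rule openin_cylinder)
      show "finite (F \<union> V)" "F \<union> V \<subseteq> carrier G" using F(1,2) V by simp_all
      show "x \<in> carrier G \<rightarrow>\<^sub>E A" by (rule full[OF x(1)])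
    qed
    moreover have "?T \<subseteq> {x \<in> X. \<phi> x \<in> U}"
    proof
      fix y assume y: "y \<in> ?T"
      have "\<phi> y h = \<phi> x h" if "h \<in> F" for h
      proof (cases "h \<in> V")
        case True
        moreover have "\<forall>h\<in>V. y h = x h" "y \<in> X" using y by auto
        ultimately show ?thesis using l x(1) unfolding local_on_def by blast
      next
        case False
        then have "\<phi> y h = y h" "\<phi> x h = x h" using l x(1) y that F(2) unfolding local_on_def by blast+
        then show ?thesis using y that by simp
      qed
      moreover have "y \<in> X" "\<phi> y \<in> carrier G \<rightarrow>\<^sub>E A" using y fX full by simp_all
      ultimately show "y \<in> {x \<in> X. \<phi> x \<in> U}" using F(3) by simp
    qed
    ultimately show "\<exists>T. openin (subtopology (shift_topology G A) X) T \<and> x \<in> T \<and> T \<subseteq> {x \<in> X. \<phi> x \<in> U}"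
      using x full by blast
  qed
  show ?thesis
    unfolding continuous_map_in_subtopology continuous_map_def[of _ "shift_topology G A"] topspace_X
    using fX top pre by blast
qed

text \<open>By compactness the finitely many cells that \<open>\<phi>\<close> may change depend on finitely many cells;
  these together form the window.\<close>

lemma continuous_local_on:
  assumes c: "continuous_map (subtopology (shift_topology G A) X) (subtopology (shift_topology G A) X) \<phi>"
    and N: "finite N" "N \<subseteq> carrier G" "\<And>x h. x \<in> X \<Longrightarrow> h \<in> carrier G - N \<Longrightarrow> \<phi> x h = x h"
  obtains V where "finite V" "V \<subseteq> carrier G" "local_on V \<phi>"
proof -
  have full: "x \<in> X \<Longrightarrow> x \<in> carrier G \<rightarrow>\<^sub>E A" for x using X_full by blast
  have \<phi>X: "\<phi> x \<in> X" if "x \<in> X" for x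
    using continuous_map_image_subset_topspace[OF c] that unfolding topspace_X by blast
  have loc: "\<exists>F. finite F \<and> F \<subseteq> carrier G \<and>
          (\<forall>y\<in>X. (\<forall>h\<in>F. y h = x h) \<longrightarrow> restrict (\<phi> y) N = restrict (\<phi> x) N)" if x: "x \<in> X" for x
  proof -
    let ?U = "{y \<in> carrier G \<rightarrow>\<^sub>E A. \<forall>h\<in>N. y h = \<phi> x h}"
    have "openin (subtopology (shift_topology G A) X) (?U \<inter> X)"
      using openin_cylinder[OF N(1,2) full[OF \<phi>X[OF x]]] by (rule openin_subtopology_Int)
    then have "openin (subtopology (shift_topology G A) X) {y \<in> X. \<phi> y \<in> ?U \<inter> X}"
      using c unfolding continuous_map_def topspace_X by blast
    then obtain T where T: "openin (shift_topology G A) T" "{y \<in> X. \<phi> y \<in> ?U \<inter> X} = T \<inter> X"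
      unfolding openin_subtopology by blast
    have "x \<in> T" using T(2) x \<phi>X[OF x] full by blast
    then obtain F where F: "finite F" "F \<subseteq> carrier G"
      "\<forall>y\<in>carrier G \<rightarrow>\<^sub>E A. (\<forall>h\<in>F. y h = x h) \<longrightarrow> y \<in> T"
      using cylinder_in_open[OF T(1) \<open>x \<in> T\<close>] by blast
    have "restrict (\<phi> y) N = restrict (\<phi> x) N" if "y \<in> X" "\<forall>h\<in>F. y h = x h" for y
    proof -
      have "y \<in> T \<inter> X" using bspec[OF F(3) full[OF that(1)]] that by simp
      then have "\<phi> y \<in> ?U" using T(2) by blast
      then show ?thesis by (intro restrict_ext) blast
    qed
    then show ?thesis using F by blast
  qed
  have cl: "closedin (shift_topology G A) X" using subshift unfolding subshift_def by blast
  obtain F where F: "finite F" "F \<subseteq> carrier G"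
    "\<forall>x\<in>X. \<forall>y\<in>X. (\<forall>h\<in>F. y h = x h) \<longrightarrow> restrict (\<phi> y) N = restrict (\<phi> x) N"
    using finite_dependence[OF cl, of "\<lambda>x. restrict (\<phi> x) N", OF loc] by blast
  show ?thesis
  proof
    show "finite (N \<union> F)" "N \<union> F \<subseteq> carrier G" using N F by auto
    show "local_on (N \<union> F) \<phi>"
      unfolding local_on_def
    proof (intro conjI ballI impI)
      show "\<phi> x h = x h" if "x \<in> X" "h \<in> carrier G - (N \<union> F)" for x h using N(3) that by blast
      fix x y h assume xy: "x \<in> X" "y \<in> X" "\<forall>h\<in>N \<union> F. x h = y h" and h: "h \<in> N \<union> F"
      show "\<phi> x h = \<phi> y h"
      proof (cases "h \<in> N")
        case True
        have "restrict (\<phi> x) N = restrict (\<phi> y) N" using F(3) xy by blast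
        then show ?thesis using True by (metis restrict_apply')
      next
        case False
        then have "h \<in> carrier G - N" using h F(2) by blast
        then show ?thesis using N(3)[OF xy(1)] N(3)[OF xy(2)] xy(3) h by simp
      qed
    qed
  qed
qed

lemma gate_iff_windowed: "gate G A X \<phi> \<longleftrightarrow> (\<exists>V. finite V \<and> V \<subseteq> carrier G \<and> \<phi> \<in> windowed V)"
proof
  let ?T = "subtopology (shift_topology G A) X"
  assume g: "gate G A X \<phi>"
  then obtain N where N: "finite N" "N \<subseteq> carrier G" "\<And>x h. x \<in> X \<Longrightarrow> h \<in> carrier G - N \<Longrightarrow> \<phi> x h = x h"
    unfolding gate_def by blast
  obtain \<psi> where \<psi>: "homeomorphic_maps ?T ?T \<phi> \<psi>"
    using g unfolding gate_def homeomorphic_map_maps by blast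
  then have c: "continuous_map ?T ?T \<phi>" "continuous_map ?T ?T \<psi>"
    and inv: "\<And>x. x \<in> X \<Longrightarrow> \<psi> (\<phi> x) = x" "\<And>x. x \<in> X \<Longrightarrow> \<phi> (\<psi> x) = x"
    unfolding homeomorphic_maps_def topspace_X by blast+
  have \<phi>X: "\<phi> x \<in> X" "\<psi> x \<in> X" if "x \<in> X" for x
    using continuous_map_image_subset_topspace[OF c(1)] continuous_map_image_subset_topspace[OF c(2)] that
    unfolding topspace_X by blast+
  have B: "\<phi> \<in> Bij X"
    using g inv \<phi>X by (intro BijI[where \<psi> = \<psi>]) (auto simp: gate_def)
  have inv_eq: "gate_inv \<phi> x = \<psi> x" if "x \<in> X" for x
    using inv_apply(1)[OF B \<phi>X(2)[OF that]] inv(2)[OF that] by simp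
  have N': "\<psi> x h = x h" if "x \<in> X" "h \<in> carrier G - N" for x h
    using N(3)[OF \<phi>X(2)[OF that(1)] that(2)] inv(2)[OF that(1)] by simp
  obtain V where V: "finite V" "V \<subseteq> carrier G" "local_on V \<phi>"
    using continuous_local_on[OF c(1) N] by blast
  obtain W where W: "finite W" "W \<subseteq> carrier G" "local_on W \<psi>"
    using continuous_local_on[OF c(2) N(1,2) N'] by blast
  have "local_on W (gate_inv \<phi>) \<longleftrightarrow> local_on W \<psi>"
    unfolding local_on_def by (simp add: inv_eq)
  with W(3) have "\<phi> \<in> windowed (V \<union> W)"
    using local_on_mono[of V \<phi> "V \<union> W"] local_on_mono[of W "gate_inv \<phi>" "V \<union> W"] V W B
    by (simp add: windowed_def)
  then show "\<exists>V. finite V \<and> V \<subseteq> carrier G \<and> \<phi> \<in> windowed V"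
    using V W by (intro exI[of _ "V \<union> W"]) simp
next
  let ?T = "subtopology (shift_topology G A) X"
  assume "\<exists>V. finite V \<and> V \<subseteq> carrier G \<and> \<phi> \<in> windowed V"
  then obtain V where V: "finite V" "V \<subseteq> carrier G" "\<phi> \<in> windowed V" by blast
  then have B: "\<phi> \<in> Bij X" and l: "local_on V \<phi>" "local_on V (gate_inv \<phi>)" by (auto simp: windowed_def)
  have "homeomorphic_maps ?T ?T \<phi> (gate_inv \<phi>)"
    unfolding homeomorphic_maps_def topspace_X
    using V l B Bij_apply inv_apply by (auto intro!: local_on_continuous)
  then have "homeomorphic_map ?T ?T \<phi>" unfolding homeomorphic_map_maps by blast
  moreover have "\<phi> x h = x h" if "x \<in> X" "h \<in> carrier G - V" for x h
    using l(1) that unfolding local_on_def by blast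
  ultimately show "gate G A X \<phi>"
    unfolding gate_def using V Bij_imp_extensional[OF B] by blast
qed

section \<open>Gate lattices are infinite products\<close>

lemma tame_conj:
  assumes \<phi>: "\<phi> \<in> windowed V" and V: "finite V" "V \<subseteq> carrier G" and S: "S \<subseteq> carrier G"
    and comm: "conjs_commute G X \<phi> S"
  shows "tame (conj \<phi>) S"
  unfolding tame_def Sym.commuting_def
proof (intro conjI ballI)
  show "conj \<phi> s \<in> Bij X" if "s \<in> S" for s
    using conj_Bij windowed_Bij[OF \<phi>] S that by blast
  show "conj \<phi> s \<star> conj \<phi> t = conj \<phi> t \<star> conj \<phi> s" if "s \<in> S" "t \<in> S" for s t
    using comm that unfolding conjs_commute_def by blast
  have w: "conj \<phi> s \<in> windowed (V #> s)" if "s \<in> S" for s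
    using windowed_conj[OF \<phi> _ V(2)] S that by blast
  show "\<exists>W. finite W \<and> W \<subseteq> carrier G \<and> conj \<phi> s \<in> windowed W" if "s \<in> S" for s
    using w[OF that] V r_coset_subset_G[OF V(2)] that S
    by (intro exI[of _ "V #> s"]) (auto simp: r_coset_def)
  fix h assume h: "h \<in> carrier G"
  have "{s \<in> S. moves (conj \<phi> s) h} \<subseteq> (\<lambda>v. inv v \<otimes> h) ` V"
  proof
    fix s assume "s \<in> {s \<in> S. moves (conj \<phi> s) h}"
    then have s: "s \<in> S" "moves (conj \<phi> s) h" by auto
    then have "h \<in> V #> s" using windowed_off[OF w[OF s(1)] _ h] unfolding moves_def by blast
    then obtain v where v: "v \<in> V" "h = v \<otimes> s" unfolding r_coset_def by blast
    then have "inv v \<otimes> h = s" using V(2) S s(1) by (simp add: m_assoc[symmetric] subset_iff)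
    then show "s \<in> (\<lambda>v. inv v \<otimes> h) ` V" using v(1) by blast
  qed
  then show "finite {s \<in> S. moves (conj \<phi> s) h}" using V(1) finite_surj by blast
qed

lemma limitin_discrete: "limitin (discrete_topology A) c l F \<longleftrightarrow> l \<in> A \<and> eventually (\<lambda>i. c i = l) F"
proof
  assume L: "limitin (discrete_topology A) c l F"
  then have l: "l \<in> A" using limitin_topspace by force
  then have "eventually (\<lambda>i. c i \<in> {l}) F" using limitinD[OF L, of "{l}"] by simp
  then show "l \<in> A \<and> eventually (\<lambda>i. c i = l) F" using l by simp
next
  assume "l \<in> A \<and> eventually (\<lambda>i. c i = l) F"
  then show "limitin (discrete_topology A) c l F"
    unfolding limitin_def by (auto elim: eventually_mono)
qed

lemma is_lattice_limit_iff:
  assumes "tame (conj \<phi>) S"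
  shows "is_lattice_limit G A X \<phi> S f \<longleftrightarrow> f = inf_prod (conj \<phi>) S"
proof -
  let ?P = "\<lambda>F. finprod (BijGroup X) (conj \<phi>) F" and ?I = "inf_prod (conj \<phi>) S"
  have full: "x \<in> X \<Longrightarrow> x \<in> carrier G \<rightarrow>\<^sub>E A" for x using X_full by blast
  have ev: "eventually (\<lambda>F. ?P F x h = ?I x h) (finite_subsets_at_top S)" if "x \<in> X" "h \<in> carrier G" for x h
  proof -
    have F: "finite {h}" "{h} \<subseteq> carrier G" using that by auto
    obtain T where T: "finite T" "T \<subseteq> S"
      "\<And>U x k. finite U \<Longrightarrow> T \<subseteq> U \<Longrightarrow> U \<subseteq> S \<Longrightarrow> x \<in> X \<Longrightarrow> k \<in> {h} \<Longrightarrow> ?I x k = ?P U x k"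
      using inf_prod_approx[OF assms F] by blast
    have "?P U x h = ?I x h" if "finite U" "T \<subseteq> U" "U \<subseteq> S" for U
      using T(3)[OF that \<open>x \<in> X\<close>, of h] by simp
    then show ?thesis using T(1,2) unfolding eventually_finite_subsets_at_top by blast
  qed
  have evX: "eventually (\<lambda>F. ?P F x \<in> X) (finite_subsets_at_top S)" if "x \<in> X" for x
    unfolding eventually_finite_subsets_at_top
    using Bij_apply[OF tame_finprod_Bij[OF assms] that] by blast
  have lim: "limitin (subtopology (shift_topology G A) X) (\<lambda>F. ?P F x) y (finite_subsets_at_top S) \<longleftrightarrow>
      y \<in> X \<and> (\<forall>h\<in>carrier G. eventually (\<lambda>F. ?P F x h = y h) (finite_subsets_at_top S))" if x: "x \<in> X" for x y
  proof -
    have "eventually (\<lambda>F. ?P F x \<in> topspace (product_topology (\<lambda>_. discrete_topology A) (carrier G))) (finite_subsets_at_top S)"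
      using evX[OF x] by (rule eventually_mono) (use full in auto)
    moreover have "y \<in> extensional (carrier G) \<and> (\<forall>h\<in>carrier G. y h \<in> A)" if "y \<in> X"
      using full[OF that] by (simp add: PiE_iff)
    ultimately show ?thesis
      unfolding limitin_subtopology shift_topology_def limitin_componentwise limitin_discrete
      using evX[OF x] by blast
  qed
  show ?thesis
  proof
    assume f: "is_lattice_limit G A X \<phi> S f"
    show "f = ?I"
    proof (rule extensionalityI)
      show "f \<in> extensional X" using f unfolding is_lattice_limit_def by blast
      show "?I \<in> extensional X" by (rule inf_prod_extensional)
      fix x assume x: "x \<in> X"
      have l: "f x \<in> X" "\<forall>h\<in>carrier G. eventually (\<lambda>F. ?P F x h = f x h) (finite_subsets_at_top S)"
        using f lim[OF x] x unfolding is_lattice_limit_def by blast+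
      show "f x = ?I x"
      proof (rule X_ext[OF l(1) inf_prod_in_X[OF assms x]])
        fix h assume h: "h \<in> carrier G"
        have "eventually (\<lambda>F. f x h = ?I x h) (finite_subsets_at_top S)"
          using eventually_conj[OF ev[OF x h] bspec[OF l(2) h]] by (rule eventually_mono) metis
        then show "f x h = ?I x h" by (simp add: eventually_const_iff)
      qed
    qed
  next
    assume "f = ?I"
    then show "is_lattice_limit G A X \<phi> S f"
      unfolding is_lattice_limit_def using lim ev inf_prod_in_X[OF assms] inf_prod_extensional by auto
  qed
qed

abbreviation lattice_group where "lattice_group \<equiv> gate_lattice_group G A X"

lemma gate_latticesE:
  assumes "f \<in> gate_lattices G A X"
  obtains \<phi> V H g where "\<phi> \<in> windowed V" "finite V" "V \<subseteq> carrier G" "finite_index G H" "g \<in> carrier G"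
    "tame (conj \<phi>) (H #> g)" "f = inf_prod (conj \<phi>) (H #> g)"
proof -
  obtain \<phi> H g where f: "gate G A X \<phi>" "finite_index G H" "g \<in> carrier G"
    "conjs_commute G X \<phi> (H #> g)" "is_lattice_limit G A X \<phi> (H #> g) f"
    using assms unfolding gate_lattices_def by blast
  obtain V where V: "finite V" "V \<subseteq> carrier G" "\<phi> \<in> windowed V" using f(1) gate_iff_windowed by blast
  have "H #> g \<subseteq> carrier G" using f(2,3) subgroup.subset r_coset_subset_G unfolding finite_index_def by metis
  then have t: "tame (conj \<phi>) (H #> g)" using tame_conj V f(4) by blast
  show ?thesis using that[OF V(3,1,2) f(2,3) t] is_lattice_limit_iff[OF t] f(5) by blast
qed

lemma gate_lattices_Bij: "gate_lattices G A X \<subseteq> Bij X"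
  using gate_latticesE inf_prod_Bij by (metis subsetI)

lemma lattice_subgroup: "subgroup lattice_group (BijGroup X)"
  unfolding gate_lattice_group_def using Sym.generate_is_subgroup gate_lattices_Bij by simp

lemma inf_prod_in_lattice_group:
  assumes "\<phi> \<in> windowed V" "finite V" "V \<subseteq> carrier G" "finite_index G K" "tame (conj \<phi>) K"
  shows "inf_prod (conj \<phi>) K \<in> lattice_group"
proof -
  have K: "K #> \<one> = K" using assms(4) subgroup.subset coset_mult_one unfolding finite_index_def by blast
  have "conjs_commute G X \<phi> K"
    using tame_commuting_self[OF assms(5)] unfolding conjs_commute_def Sym.commuting_def by blast
  moreover have "is_lattice_limit G A X \<phi> K (inf_prod (conj \<phi>) K)"
    using is_lattice_limit_iff[OF assms(5)] by simp
  moreover have "gate G A X \<phi>" using gate_iff_windowed assms(1-3) by blast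
  ultimately have "inf_prod (conj \<phi>) K \<in> gate_lattices G A X"
    unfolding gate_lattices_def mem_Collect_eq
    by (intro exI[of _ \<phi>] exI[of _ K] exI[of _ \<one>]) (simp add: K assms(4))
  then show ?thesis unfolding gate_lattice_group_def by (rule generate.incl)
qed

definition separated :: "'g set \<Rightarrow> 'g set \<Rightarrow> bool" where
  "separated K V \<longleftrightarrow> (\<forall>k\<in>K. \<forall>l\<in>K. k \<noteq> l \<longrightarrow> (V #> k) \<inter> (V #> l) = {})"

definition lattice :: "'g set \<Rightarrow> (('g \<Rightarrow> 'a) \<Rightarrow> ('g \<Rightarrow> 'a)) \<Rightarrow> (('g \<Rightarrow> 'a) \<Rightarrow> ('g \<Rightarrow> 'a))" where
  "lattice K \<phi> = inf_prod (conj \<phi>) K"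

text \<open>On a sparse subgroup different conjugates act on disjoint windows. So even different gates with
  window \<open>V\<close> do not interfere, which makes \<open>lattice K\<close> a homomorphism on \<open>windowed V\<close>.\<close>

lemma separated_cross:
  assumes "separated K V" "K \<subseteq> carrier G" "V \<subseteq> carrier G" "\<phi> \<in> windowed V" "\<psi> \<in> windowed V"
    "k \<in> K" "l \<in> K" "k \<noteq> l"
  shows "conj \<phi> k \<star> conj \<psi> l = conj \<psi> l \<star> conj \<phi> k"
proof -
  have kl: "k \<in> carrier G" "l \<in> carrier G" using assms by auto
  have "(V #> k) \<inter> (V #> l) = {}" using assms unfolding separated_def by blast
  then show ?thesis
    using windowed_commute windowed_conj[OF assms(4) kl(1) assms(3)] windowed_conj[OF assms(5) kl(2) assms(3)]
      r_coset_subset_G[OF assms(3)] kl by blast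
qed

lemma separated_tame:
  assumes "separated K V" "K \<subseteq> carrier G" "finite V" "V \<subseteq> carrier G" "\<phi> \<in> windowed V"
  shows "tame (conj \<phi>) K"
proof (rule tame_conj[OF assms(5,3,4,2)])
  have "conj \<phi> k \<star> conj \<phi> l = conj \<phi> l \<star> conj \<phi> k" if "k \<in> K" "l \<in> K" for k l
    using separated_cross[OF assms(1,2,4,5,5) that] by blast
  then show "conjs_commute G X \<phi> K" unfolding conjs_commute_def by blast
qed

lemma lattice_mult:
  assumes "separated K V" "K \<subseteq> carrier G" "finite V" "V \<subseteq> carrier G" "\<phi> \<in> windowed V" "\<psi> \<in> windowed V"
  shows "lattice K (\<phi> \<star> \<psi>) = lattice K \<phi> \<star> lattice K \<psi>"
proof -
  have w: "\<phi> \<star> \<psi> \<in> windowed V" using assms subgroup.m_closed[OF windowed_subgroup] by blast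
  have "inf_prod (conj (\<phi> \<star> \<psi>)) K = inf_prod (\<lambda>k. conj \<phi> k \<star> conj \<psi> k) K"
    using separated_tame[OF assms(1-4) w] conj_mult assms(2) windowed_Bij[OF assms(5)] windowed_Bij[OF assms(6)]
    by (intro inf_prod_cong) auto
  also have "\<dots> = inf_prod (conj \<phi>) K \<star> inf_prod (conj \<psi>) K"
    using separated_tame[OF assms(1-4)] separated_cross[OF assms(1,2,4)] assms(5,6)
    by (intro inf_prod_hom) blast+
  finally show ?thesis unfolding lattice_def .
qed

lemma lattice_hom:
  assumes "separated K V" "K \<subseteq> carrier G" "finite V" "V \<subseteq> carrier G"
  shows "lattice K \<in> hom (BijGroup X\<lparr>carrier := windowed V\<rparr>) (BijGroup X)"
proof (rule homI)
  fix \<phi> \<psi> assume w: "\<phi> \<in> carrier (BijGroup X\<lparr>carrier := windowed V\<rparr>)" "\<psi> \<in> carrier (BijGroup X\<lparr>carrier := windowed V\<rparr>)"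
  then show "lattice K \<phi> \<in> carrier (BijGroup X)"
    using inf_prod_Bij[OF separated_tame[OF assms]] by (simp add: lattice_def)
  show "lattice K (\<phi> \<otimes>\<^bsub>BijGroup X\<lparr>carrier := windowed V\<rparr>\<^esub> \<psi>) = lattice K \<phi> \<star> lattice K \<psi>"
    using lattice_mult[OF assms] w by simp
qed

text \<open>The homomorphism \<open>lattice K\<close> maps commutators of gates with window \<open>V\<close> to commutators of gate
  lattices.\<close>

lemma lattice_derived:
  assumes sep: "separated K V" and K: "finite_index G K" and V: "finite V" "V \<subseteq> carrier G"
    and \<phi>: "\<phi> \<in> derived (BijGroup X) (windowed V)"
  shows "lattice K \<phi> \<in> derived (BijGroup X) lattice_group"
proof -
  let ?W = "BijGroup X\<lparr>carrier := windowed V\<rparr>"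
  have KG: "K \<subseteq> carrier G" using K subgroup.subset unfolding finite_index_def by blast
  interpret h: group_hom ?W "BijGroup X" "lattice K"
    using lattice_hom[OF sep KG V] group_BijGroup Sym.subgroup_imp_group[OF windowed_subgroup[of V]]
    by (simp add: group_hom_def group_hom_axioms_def)
  have "derived (BijGroup X) (lattice K ` windowed V) = lattice K ` derived ?W (windowed V)"
    using h.derived_img[of "windowed V"] by simp
  also have "derived ?W (windowed V) = derived (BijGroup X) (windowed V)"
    by (rule Sym.derived_consistent[OF subset_refl windowed_subgroup])
  finally have "lattice K \<phi> \<in> derived (BijGroup X) (lattice K ` windowed V)" using \<phi> by blast
  moreover have "lattice K ` windowed V \<subseteq> lattice_group"
    using inf_prod_in_lattice_group[OF _ V K separated_tame[OF sep KG V]] by (auto simp: lattice_def)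
  ultimately show ?thesis using Sym.mono_derived by blast
qed

lemma derived_conj:
  assumes "\<phi> \<in> derived (BijGroup X) (windowed V)" "g \<in> carrier G" "V \<subseteq> carrier G"
  shows "conj \<phi> g \<in> derived (BijGroup X) (windowed (V #> g))"
proof -
  interpret h: group_hom "BijGroup X" "BijGroup X" "\<lambda>\<phi>. conj \<phi> g"
    using conj_hom[OF assms(2)] group_BijGroup by (simp add: group_hom_def group_hom_axioms_def)
  have "windowed V \<subseteq> carrier (BijGroup X)" by (auto simp: windowed_def)
  then have "derived (BijGroup X) ((\<lambda>\<phi>. conj \<phi> g) ` windowed V) =
      (\<lambda>\<phi>. conj \<phi> g) ` derived (BijGroup X) (windowed V)"
    by (rule h.derived_img)
  then have "conj \<phi> g \<in> derived (BijGroup X) ((\<lambda>\<phi>. conj \<phi> g) ` windowed V)" using assms(1) by blast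
  moreover have "(\<lambda>\<phi>. conj \<phi> g) ` windowed V \<subseteq> windowed (V #> g)" using windowed_conj assms by blast
  ultimately show ?thesis using Sym.mono_derived by blast
qed

end

section \<open>Permutations as products of transpositions\<close>

abbreviation transposition :: "'b \<Rightarrow> 'b \<Rightarrow> 'b \<Rightarrow> 'b" where
  "transposition \<equiv> Transposition.transpose"

text \<open>The label \<open>r\<close> will be the restriction of a pattern to the boundary: a permutation that preserves it
  is a product of transpositions that preserve it, since following \<open>\<pi>\<close> by the transposition of \<open>a\<close>
  and \<open>\<pi> a\<close> fixes the additional point \<open>a\<close>.\<close>

lemma perm_as_transpositions:
  assumes "finite P" "\<pi> permutes P" "\<And>a. a \<in> P \<Longrightarrow> r (\<pi> a) = r a"
  shows "\<exists>ps. (\<forall>(a, b) \<in> set ps. a \<in> P \<and> b \<in> P \<and> r a = r b) \<and>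
              \<pi> = foldr (\<lambda>(a, b) \<rho>. transposition a b \<circ> \<rho>) ps id"
  using assms(2,3)
proof (induction "card {a. \<pi> a \<noteq> a}" arbitrary: \<pi> rule: less_induct)
  case less
  show ?case
  proof (cases "\<pi> = id")
    case True
    then show ?thesis by (intro exI[of _ "[]"]) simp
  next
    case False
    then obtain a where a: "\<pi> a \<noteq> a" by (metis eq_id_iff)
    have aP: "a \<in> P" "\<pi> a \<in> P" using a less.prems(1) permutes_in_image permutes_not_in by metis+
    let ?t = "transposition a (\<pi> a)"
    have sub: "{c. (?t \<circ> \<pi>) c \<noteq> c} \<subseteq> {c. \<pi> c \<noteq> c} - {a}"
    proof
      fix c assume "c \<in> {c. (?t \<circ> \<pi>) c \<noteq> c}"
      then have c: "?t (\<pi> c) \<noteq> c" by simp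
      then have "c \<noteq> a" by auto
      moreover have "\<pi> c \<noteq> c"
      proof
        assume eq: "\<pi> c = c"
        then have "c \<noteq> \<pi> a" using a permutes_inj[OF less.prems(1)] by (metis injD)
        then show False using c eq \<open>c \<noteq> a\<close> by simp
      qed
      ultimately show "c \<in> {c. \<pi> c \<noteq> c} - {a}" by simp
    qed
    have "{c. \<pi> c \<noteq> c} \<subseteq> P" using less.prems(1) permutes_not_in by fastforce
    then have "finite {c. \<pi> c \<noteq> c}" using assms(1) finite_subset by blast
    then have "card {c. (?t \<circ> \<pi>) c \<noteq> c} < card {c. \<pi> c \<noteq> c}"
      using sub a by (intro psubset_card_mono) auto
    moreover have "?t \<circ> \<pi> permutes P"
      by (rule permutes_compose[OF less.prems(1) permutes_swap_id[OF aP]])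
    moreover have "r ((?t \<circ> \<pi>) c) = r c" if "c \<in> P" for c
      using less.prems(2)[OF that] less.prems(2)[OF aP(1)] by (auto simp: Transposition.transpose_def)
    ultimately obtain ps where ps: "\<forall>(a, b) \<in> set ps. a \<in> P \<and> b \<in> P \<and> r a = r b"
       "?t \<circ> \<pi> = foldr (\<lambda>(a, b) \<rho>. transposition a b \<circ> \<rho>) ps id"
      using less.hyps by blast
    have "\<pi> = ?t \<circ> (?t \<circ> \<pi>)" by (simp add: fun_eq_iff)
    then show ?thesis using ps aP less.prems(2)[OF aP(1)]
      by (intro exI[of _ "(a, \<pi> a) # ps"]) auto
  qed
qed

text \<open>For an involution, one representative of each two-element orbit gives the list of transpositions
  explicitly, so that they can be counted later.\<close>

lemma involution_as_transpositions:
  assumes inv: "\<And>c. \<pi> (\<pi> c) = c" and "distinct as" and disj: "set as \<inter> \<pi> ` set as = {}"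
  shows "foldr (\<lambda>(a, b) \<rho>. transposition a b \<circ> \<rho>) (map (\<lambda>a. (a, \<pi> a)) as) id c =
         (if c \<in> set as \<union> \<pi> ` set as then \<pi> c else c)"
  using assms(2,3)
proof (induction as)
  case (Cons a as)
  define f where "f = foldr (\<lambda>(a, b) \<rho>. transposition a b \<circ> \<rho>) (map (\<lambda>a. (a, \<pi> a)) as) id"
  have IH: "f c = (if c \<in> set as \<union> \<pi> ` set as then \<pi> c else c)"
    unfolding f_def by (rule Cons.IH) (use Cons.prems in auto)
  have step: "foldr (\<lambda>(a, b) \<rho>. transposition a b \<circ> \<rho>) (map (\<lambda>a. (a, \<pi> a)) (a # as)) id c =
      transposition a (\<pi> a) (f c)"
    by (simp add: f_def)
  show ?case
  proof (cases "c \<in> set as \<union> \<pi> ` set as")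
    case True
    have "a \<notin> set as" "a \<notin> \<pi> ` set as" using Cons.prems by auto
    then have "\<pi> c \<noteq> a" "c \<noteq> a" using True inv by auto
    then have "\<pi> c \<noteq> \<pi> a" using inv by metis
    then show ?thesis using IH True \<open>\<pi> c \<noteq> a\<close> unfolding step by auto
  next
    case False
    then show ?thesis using IH inv unfolding step by (auto simp: Transposition.transpose_def)
  qed
qed simp

context shift_space
begin

section \<open>Gluing in shifts of finite type\<close>

text \<open>Membership in a shift of finite type is tested on the translates \<open>B g\<close> of a finite set. Those that
  meet \<open>D\<close> without being contained in it meet it in boundary cells only, so the rest of \<open>D\<close> does
  not interact with the outside.\<close>

definition boundary :: "'g set \<Rightarrow> 'g set \<Rightarrow> 'g set" where
  "boundary B D = {h \<in> D. \<exists>g\<in>carrier G. h \<in> B #> g \<and> \<not> B #> g \<subseteq> D}"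

definition glue :: "'g set \<Rightarrow> ('g \<Rightarrow> 'a) \<Rightarrow> ('g \<Rightarrow> 'a) \<Rightarrow> ('g \<Rightarrow> 'a)" where
  "glue D x y = (\<lambda>h\<in>carrier G. if h \<in> D then x h else y h)"

definition gluing :: "'g set \<Rightarrow> bool" where
  "gluing B \<longleftrightarrow> finite B \<and> B \<subseteq> carrier G \<and>
     (\<forall>D x y. D \<subseteq> carrier G \<longrightarrow> x \<in> X \<longrightarrow> y \<in> X \<longrightarrow> (\<forall>h\<in>boundary B D. x h = y h) \<longrightarrow> glue D x y \<in> X)"

lemma gluing_mono:
  assumes "gluing B" "B \<subseteq> B'" "finite B'" "B' \<subseteq> carrier G"
  shows "gluing B'"
proof -
  have "boundary B D \<subseteq> boundary B' D" for D
    using assms(2) unfolding boundary_def r_coset_def by blast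
  then show ?thesis using assms unfolding gluing_def by (metis subsetD)
qed

lemma glue_full: "x \<in> carrier G \<rightarrow>\<^sub>E A \<Longrightarrow> y \<in> carrier G \<rightarrow>\<^sub>E A \<Longrightarrow> glue D x y \<in> carrier G \<rightarrow>\<^sub>E A"
  by (auto simp: glue_def PiE_iff)

lemma full_shift_gluing: "X = full_shift G A \<Longrightarrow> gluing {}"
  unfolding gluing_def using glue_full by (auto simp: full_shift_def)

text \<open>The clopen set that defines the shift depends on finitely many cells \<open>B\<close>. Through the translate
  \<open>B g\<close>, the glued point looks like \<open>x\<close> if \<open>B g\<close> lies in \<open>D\<close>, and otherwise like \<open>y\<close>, because then \<open>B g\<close>
  meets \<open>D\<close> only in the boundary.\<close>

lemma SFT_gluing:
  assumes "SFT G A X"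
  shows "\<exists>B. gluing B"
proof -
  let ?T = "shift_topology G A" and ?F = "carrier G \<rightarrow>\<^sub>E A"
  obtain C where C: "openin ?T C" "closedin ?T C" "X = (\<Inter>g\<in>carrier G. shift G g ` C)"
    using assms unfolding SFT_def by blast
  have top: "topspace ?T = ?F" by (simp add: shift_topology_def)
  have CF: "C \<subseteq> ?F" using closedin_subset[OF C(2)] top by simp
  have loc: "\<exists>F. finite F \<and> F \<subseteq> carrier G \<and> (\<forall>y\<in>?F. (\<forall>h\<in>F. y h = x h) \<longrightarrow> (y \<in> C) = (x \<in> C))"
    if x: "x \<in> ?F" for x
  proof (cases "x \<in> C")
    case True
    then obtain F where "finite F" "F \<subseteq> carrier G"
      "\<forall>y\<in>?F. (\<forall>h\<in>F. y h = x h) \<longrightarrow> y \<in> C"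
      using cylinder_in_open[OF C(1) True] by blast
    then show ?thesis using True by blast
  next
    case False
    have o: "openin ?T (?F - C)" using C(2) unfolding closedin_def top by blast
    then obtain F where "finite F" "F \<subseteq> carrier G"
      "\<forall>y\<in>?F. (\<forall>h\<in>F. y h = x h) \<longrightarrow> y \<in> ?F - C"
      using cylinder_in_open[OF o, of x] x False by blast
    then show ?thesis using False by blast
  qed
  have "closedin ?T ?F" using closedin_topspace[of ?T] unfolding top .
  then obtain B where B: "finite B" "B \<subseteq> carrier G"
    "\<forall>x\<in>?F. \<forall>y\<in>?F. (\<forall>h\<in>B. y h = x h) \<longrightarrow> (y \<in> C) = (x \<in> C)"
    using finite_dependence[of ?F "\<lambda>x. x \<in> C", OF _ loc] by blast
  have window: "y \<in> C" if "x \<in> C" "x \<in> ?F" "y \<in> ?F" "\<And>h. h \<in> B \<Longrightarrow> y h = x h" for x y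
    using B(3) that by blast
  have mem: "x \<in> X \<longleftrightarrow> (\<forall>g\<in>carrier G. shift G g x \<in> C)" if x: "x \<in> ?F" for x
  proof
    assume "x \<in> X"
    show "\<forall>g\<in>carrier G. shift G g x \<in> C"
    proof
      fix g assume g: "g \<in> carrier G"
      then obtain c where "c \<in> C" "x = shift G (inv g) c" using \<open>x \<in> X\<close> C(3) by (metis INT_E imageE inv_closed)
      then show "shift G g x \<in> C" using shift_inv(1)[OF g] CF by auto
    qed
  next
    assume c: "\<forall>g\<in>carrier G. shift G g x \<in> C"
    have "x \<in> shift G g ` C" if g: "g \<in> carrier G" for g
      using c shift_inv(1)[OF g x] g by (metis imageI inv_closed)
    then show "x \<in> X" using C(3) by blast
  qed
  have "glue D x y \<in> X" if D: "D \<subseteq> carrier G" and xy: "x \<in> X" "y \<in> X"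
    and eq: "\<forall>h\<in>boundary B D. x h = y h" for D x y
  proof -
    have full: "x \<in> ?F" "y \<in> ?F" using xy X_full by auto
    have "shift G g (glue D x y) \<in> C" if g: "g \<in> carrier G" for g
    proof (cases "B #> g \<subseteq> D")
      case True
      have "shift G g (glue D x y) b = shift G g x b" if "b \<in> B" for b
      proof -
        have "b \<otimes> g \<in> D" using True that unfolding r_coset_def by blast
        then show ?thesis using that B(2) g by (simp add: glue_def subset_iff)
      qed
      moreover have "shift G g x \<in> C" using mem[OF full(1)] xy(1) g by blast
      ultimately show ?thesis
        by (intro window[OF _ shift_full[OF full(1) g] shift_full[OF glue_full[OF full] g]])
    next
      case False
      have "shift G g (glue D x y) b = shift G g y b" if "b \<in> B" for b
      proof -
        have "b \<otimes> g \<in> B #> g" using that unfolding r_coset_def by blast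
        then have "b \<otimes> g \<in> D \<Longrightarrow> x (b \<otimes> g) = y (b \<otimes> g)"
          using eq False g unfolding boundary_def by blast
        then show ?thesis using that B(2) g by (simp add: glue_def subset_iff)
      qed
      moreover have "shift G g y \<in> C" using mem[OF full(2)] xy(2) g by blast
      ultimately show ?thesis
        by (intro window[OF _ shift_full[OF full(2) g] shift_full[OF glue_full[OF full] g]])
    qed
    then show ?thesis using mem[OF glue_full[OF full]] by blast
  qed
  then have "gluing B" unfolding gluing_def using B(1,2) by blast
  then show ?thesis ..
qed

end

locale glued_shift = shift_space G A X
  for G :: "('g, 'm) monoid_scheme" (structure) and A :: "'a set" and X +
  fixes B :: "'g set"
  assumes gluing: "gluing B"
begin

abbreviation bd where "bd \<equiv> boundary B"

lemma bd_subset: "bd V \<subseteq> V" by (auto simp: boundary_def)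

lemma glue_in_X:
  "D \<subseteq> carrier G \<Longrightarrow> x \<in> X \<Longrightarrow> y \<in> X \<Longrightarrow> (\<And>h. h \<in> bd D \<Longrightarrow> x h = y h) \<Longrightarrow> glue D x y \<in> X"
  using gluing unfolding gluing_def by blast

lemma glue_apply [simp]: "h \<in> carrier G \<Longrightarrow> glue D x y h = (if h \<in> D then x h else y h)"
  by (simp add: glue_def)

text \<open>Padding keeps \<open>U\<close> off the boundary of the larger set, see \<open>padded_bd\<close> below.\<close>

definition padded :: "'g set \<Rightarrow> 'g set" where
  "padded U = U \<union> (\<Union>g\<in>{g \<in> carrier G. (B #> g) \<inter> U \<noteq> {}}. B #> g)"

lemma B_finite: "finite B" "B \<subseteq> carrier G" using gluing unfolding gluing_def by auto

lemma padded_finite: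
  assumes "finite U" "U \<subseteq> carrier G"
  shows "finite (padded U)" "padded U \<subseteq> carrier G" "U \<subseteq> padded U"
proof -
  have "{g \<in> carrier G. (B #> g) \<inter> U \<noteq> {}} \<subseteq> (\<lambda>(b, u). inv b \<otimes> u) ` (B \<times> U)"
  proof
    fix g assume "g \<in> {g \<in> carrier G. (B #> g) \<inter> U \<noteq> {}}"
    then obtain b where g: "g \<in> carrier G" "b \<in> B" "b \<otimes> g \<in> U"
      unfolding r_coset_def by blast
    then have "inv b \<otimes> (b \<otimes> g) = g" using B_finite(2) by (simp add: m_assoc[symmetric] subset_iff)
    then show "g \<in> (\<lambda>(b, u). inv b \<otimes> u) ` (B \<times> U)" using g by (intro image_eqI[of _ _ "(b, b \<otimes> g)"]) auto
  qed
  then have fin: "finite {g \<in> carrier G. (B #> g) \<inter> U \<noteq> {}}"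
    using assms(1) B_finite(1) by (meson finite_SigmaI finite_surj)
  have "finite (B #> g)" for g using B_finite(1) by (simp add: r_coset_def)
  then show "finite (padded U)" unfolding padded_def using assms(1) fin by simp
  show "padded U \<subseteq> carrier G" unfolding padded_def using assms(2) r_coset_subset_G[OF B_finite(2)] by blast
  show "U \<subseteq> padded U" unfolding padded_def by blast
qed

lemma padded_bd:
  assumes "padded U \<subseteq> D" "h \<in> U"
  shows "h \<notin> bd D"
proof
  assume "h \<in> bd D"
  then obtain g where g: "g \<in> carrier G" "h \<in> B #> g" "\<not> B #> g \<subseteq> D" unfolding boundary_def by blast
  then have "g \<in> {g \<in> carrier G. (B #> g) \<inter> U \<noteq> {}}" using assms(2) by blast
  then have "B #> g \<subseteq> padded U" unfolding padded_def by blast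
  then show False using assms(1) g(3) by blast
qed

lemma bd_mono: "W \<subseteq> V \<Longrightarrow> h \<in> bd V \<Longrightarrow> h \<in> W \<Longrightarrow> h \<in> bd W"
  unfolding boundary_def by blast

section \<open>Gates from permutations of patterns\<close>

definition patterns :: "'g set \<Rightarrow> ('g \<Rightarrow> 'a) set" where
  "patterns V = (\<lambda>x. restrict x V) ` X"

text \<open>Permutations that change boundary values could produce points outside of \<open>X\<close>.\<close>

definition perms :: "'g set \<Rightarrow> (('g \<Rightarrow> 'a) \<Rightarrow> ('g \<Rightarrow> 'a)) set" where
  "perms V = {\<pi>. \<pi> permutes patterns V \<and> (\<forall>a\<in>patterns V. \<forall>h\<in>bd V. \<pi> a h = a h)}"

definition pattern_gate :: "'g set \<Rightarrow> (('g \<Rightarrow> 'a) \<Rightarrow> ('g \<Rightarrow> 'a)) \<Rightarrow> (('g \<Rightarrow> 'a) \<Rightarrow> ('g \<Rightarrow> 'a))" where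
  "pattern_gate V \<pi> = (\<lambda>x\<in>X. glue V (\<pi> (restrict x V)) x)"

lemma finite_patterns:
  assumes "finite V" "V \<subseteq> carrier G"
  shows "finite (patterns V)"
proof (rule finite_subset)
  show "finite (V \<rightarrow>\<^sub>E A)" using assms(1) finite_A by (intro finite_PiE) auto
  show "patterns V \<subseteq> V \<rightarrow>\<^sub>E A" unfolding patterns_def using X_full assms(2) by (fastforce simp: PiE_iff)
qed

lemma patternsI: "x \<in> X \<Longrightarrow> restrict x V \<in> patterns V"
  by (simp add: patterns_def)

lemma perms_pattern: "\<pi> \<in> perms V \<Longrightarrow> a \<in> patterns V \<Longrightarrow> \<pi> a \<in> patterns V"
  by (auto simp: perms_def permutes_in_image)

lemma perms_bd: "\<pi> \<in> perms V \<Longrightarrow> a \<in> patterns V \<Longrightarrow> h \<in> bd V \<Longrightarrow> \<pi> a h = a h"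
  by (auto simp: perms_def)

lemma perms_comp: "\<pi> \<in> perms V \<Longrightarrow> \<rho> \<in> perms V \<Longrightarrow> \<pi> \<circ> \<rho> \<in> perms V"
  using perms_pattern[of \<rho>] by (auto simp: perms_def intro: permutes_compose)

lemma perms_id: "id \<in> perms V"
  by (simp add: perms_def permutes_id)

lemma perms_inv:
  assumes "\<pi> \<in> perms V"
  shows "Hilbert_Choice.inv \<pi> \<in> perms V"
proof -
  have p: "\<pi> permutes patterns V" using assms by (simp add: perms_def)
  then have "Hilbert_Choice.inv \<pi> permutes patterns V" by (rule permutes_inv)
  moreover have "Hilbert_Choice.inv \<pi> a h = a h" if "a \<in> patterns V" "h \<in> bd V" for a h
    using perms_bd[OF assms _ that(2), of "Hilbert_Choice.inv \<pi> a"] permutes_inverses(1)[OF p, of a]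
      permutes_in_image[OF calculation, of a] that(1) by simp
  ultimately show ?thesis by (simp add: perms_def)
qed

lemma pattern_gate_restrict:
  assumes "\<pi> \<in> perms V" "x \<in> X" "V \<subseteq> carrier G"
  shows "restrict (pattern_gate V \<pi> x) V = \<pi> (restrict x V)"
proof -
  obtain y where y: "y \<in> X" "\<pi> (restrict x V) = restrict y V"
    using perms_pattern[OF assms(1) patternsI[OF assms(2)]] unfolding patterns_def by blast
  show ?thesis unfolding y(2) by (rule ext) (use assms y(2) in \<open>auto simp: pattern_gate_def restrict_def\<close>)
qed

lemma pattern_gate_off: "x \<in> X \<Longrightarrow> h \<in> carrier G \<Longrightarrow> h \<notin> V \<Longrightarrow> pattern_gate V \<pi> x h = x h"
  by (simp add: pattern_gate_def)

lemma pattern_gate_in_X: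
  assumes "\<pi> \<in> perms V" "x \<in> X" "V \<subseteq> carrier G"
  shows "pattern_gate V \<pi> x \<in> X"
proof -
  obtain y where y: "y \<in> X" "\<pi> (restrict x V) = restrict y V"
    using perms_pattern[OF assms(1) patternsI[OF assms(2)]] unfolding patterns_def by blast
  have "pattern_gate V \<pi> x = glue V y x"
    using assms(2) y(2) by (auto simp: pattern_gate_def glue_def fun_eq_iff)
  moreover have "y h = x h" if "h \<in> bd V" for h
  proof -
    have "h \<in> V" using that bd_subset by blast
    then show ?thesis using perms_bd[OF assms(1) patternsI[OF assms(2)] that] y(2) by simp
  qed
  ultimately show ?thesis using glue_in_X[OF assms(3) y(1) assms(2)] by simp
qed

lemma pattern_gate_comp:
  assumes "\<pi> \<in> perms V" "\<rho> \<in> perms V" "x \<in> X" "V \<subseteq> carrier G"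
  shows "pattern_gate V (\<pi> \<circ> \<rho>) x = pattern_gate V \<pi> (pattern_gate V \<rho> x)"
proof -
  have "pattern_gate V \<rho> x \<in> X" using pattern_gate_in_X assms by blast
  then have "pattern_gate V \<pi> (pattern_gate V \<rho> x) = glue V (\<pi> (\<rho> (restrict x V))) (pattern_gate V \<rho> x)"
    using pattern_gate_restrict[OF assms(2-4)] by (simp add: pattern_gate_def)
  then show ?thesis using assms(3) by (auto simp: pattern_gate_def glue_def fun_eq_iff)
qed

lemma pattern_gate_id: "x \<in> X \<Longrightarrow> pattern_gate V id x = x"
  using X_full by (auto simp: pattern_gate_def glue_def fun_eq_iff PiE_iff extensional_def subset_iff)

lemma pattern_gate_Bij:
  assumes "\<pi> \<in> perms V" "V \<subseteq> carrier G"
  shows "pattern_gate V \<pi> \<in> Bij X"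
    and "gate_inv (pattern_gate V \<pi>) = pattern_gate V (Hilbert_Choice.inv \<pi>)"
proof -
  have p: "\<pi> permutes patterns V" using assms by (simp add: perms_def)
  have B: "pattern_gate V \<rho> \<in> Bij X" if \<rho>: "\<rho> \<in> perms V" for \<rho>
  proof (rule BijI[where \<psi> = "pattern_gate V (Hilbert_Choice.inv \<rho>)"])
    have i: "\<rho> \<circ> Hilbert_Choice.inv \<rho> = id" "Hilbert_Choice.inv \<rho> \<circ> \<rho> = id"
      using \<rho> permutes_inv_o unfolding perms_def by blast+
    show "pattern_gate V \<rho> (pattern_gate V (Hilbert_Choice.inv \<rho>) x) = x"
      "pattern_gate V (Hilbert_Choice.inv \<rho>) (pattern_gate V \<rho> x) = x" if "x \<in> X" for x
      using pattern_gate_comp[OF \<rho> perms_inv[OF \<rho>] that assms(2)]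
        pattern_gate_comp[OF perms_inv[OF \<rho>] \<rho> that assms(2)] pattern_gate_id[OF that] i by simp_all
  qed (use \<rho> perms_inv pattern_gate_in_X assms(2) in \<open>auto simp: pattern_gate_def\<close>)
  show "pattern_gate V \<pi> \<in> Bij X" using B assms by blast
  show "gate_inv (pattern_gate V \<pi>) = pattern_gate V (Hilbert_Choice.inv \<pi>)"
  proof (rule inv_eqI)
    show "pattern_gate V \<pi> \<in> Bij X" "pattern_gate V (Hilbert_Choice.inv \<pi>) \<in> Bij X"
      using B assms perms_inv by auto
    show "pattern_gate V \<pi> (pattern_gate V (Hilbert_Choice.inv \<pi>) x) = x" if "x \<in> X" for x
      using pattern_gate_comp[OF assms(1) perms_inv[OF assms(1)] that assms(2)]
        pattern_gate_id[OF that] permutes_inv_o(1)[OF p] by simp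
  qed
qed

lemma pattern_gate_windowed:
  assumes "\<pi> \<in> perms V" "V \<subseteq> carrier G"
  shows "pattern_gate V \<pi> \<in> windowed V"
proof -
  have "local_on V (pattern_gate V \<rho>)" for \<rho>
    unfolding local_on_def
  proof (intro conjI ballI impI)
    fix x y h assume xy: "x \<in> X" "y \<in> X" "\<forall>h\<in>V. x h = y h" and h: "h \<in> V"
    have "restrict x V = restrict y V" using xy(3) by (intro restrict_ext) blast
    then show "pattern_gate V \<rho> x h = pattern_gate V \<rho> y h"
      using xy(1,2) h assms(2) by (simp add: pattern_gate_def subset_iff)
  qed (simp add: pattern_gate_off)
  then show ?thesis using pattern_gate_Bij[OF assms] by (simp add: windowed_def)
qed

lemma pattern_gate_mult:
  assumes "\<pi> \<in> perms V" "\<rho> \<in> perms V" "V \<subseteq> carrier G"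
  shows "pattern_gate V (\<pi> \<circ> \<rho>) = pattern_gate V \<pi> \<star> pattern_gate V \<rho>"
  by (rule Bij_ext) (use assms pattern_gate_Bij perms_comp pattern_gate_comp in \<open>auto simp: mult_apply\<close>)

lemma pattern_gate_one: "V \<subseteq> carrier G \<Longrightarrow> pattern_gate V id = gate_one"
  by (rule Bij_ext) (auto simp: pattern_gate_Bij perms_id pattern_gate_id one_apply)

text \<open>A gate with window \<open>V\<close> maps the pattern of \<open>x\<close> on \<open>V\<close> to one that depends on this pattern only,
  which defines \<open>\<pi>\<close>. It is surjective because the gate is, hence injective by finiteness.\<close>

lemma windowed_pattern_gate:
  assumes V: "finite V" "V \<subseteq> carrier G" and \<phi>: "\<phi> \<in> windowed V"
    and bd: "\<And>x h. x \<in> X \<Longrightarrow> h \<in> bd V \<Longrightarrow> \<phi> x h = x h"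
  obtains \<pi> where "\<pi> \<in> perms V" "\<phi> = pattern_gate V \<pi>"
    "\<And>x. x \<in> X \<Longrightarrow> \<pi> (restrict x V) = restrict (\<phi> x) V"
proof -
  define \<pi> where "\<pi> a = (if a \<in> patterns V then restrict (\<phi> (SOME x. x \<in> X \<and> restrict x V = a)) V else a)" for a
  have B: "\<phi> \<in> Bij X" using \<phi> by (rule windowed_Bij)
  have \<pi>: "\<pi> (restrict x V) = restrict (\<phi> x) V" if x: "x \<in> X" for x
  proof -
    define y where "y = (SOME y. y \<in> X \<and> restrict y V = restrict x V)"
    have y: "y \<in> X" "restrict y V = restrict x V"
      unfolding y_def using someI_ex[of "\<lambda>y. y \<in> X \<and> restrict y V = restrict x V"] x by blast+
    have "y h = x h" if "h \<in> V" for h using y(2) that by (metis restrict_apply')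
    then have "restrict (\<phi> y) V = restrict (\<phi> x) V"
      using windowed_on[OF \<phi> y(1) x] by (intro restrict_ext) blast
    then show ?thesis unfolding \<pi>_def y_def using patternsI[OF x] by simp
  qed
  have maps: "\<pi> ` patterns V = patterns V"
  proof
    show "\<pi> ` patterns V \<subseteq> patterns V" using \<pi> Bij_apply[OF B] unfolding patterns_def by auto
    show "patterns V \<subseteq> \<pi> ` patterns V"
    proof
      fix a assume "a \<in> patterns V"
      then obtain x where x: "x \<in> X" "a = restrict x V" unfolding patterns_def by blast
      have ix: "gate_inv \<phi> x \<in> X" using B x(1) Bij_apply Sym.inv_closed by blast
      then have "\<pi> (restrict (gate_inv \<phi> x) V) = a" using \<pi> inv_apply(2)[OF B x(1)] x(2) by simp
      then show "a \<in> \<pi> ` patterns V" using patternsI[OF ix] by blast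
    qed
  qed
  then have "inj_on \<pi> (patterns V)" using finite_patterns[OF V] by (simp add: eq_card_imp_inj_on)
  then have "\<pi> permutes patterns V"
    using maps by (intro bij_imp_permutes) (auto simp: bij_betw_def \<pi>_def)
  moreover have "\<pi> a h = a h" if "a \<in> patterns V" "h \<in> bd V" for a h
  proof -
    obtain x where x: "x \<in> X" "a = restrict x V" using \<open>a \<in> patterns V\<close> unfolding patterns_def by blast
    have "h \<in> V" using that(2) bd_subset by blast
    then show ?thesis using \<pi>[OF x(1)] bd[OF x(1) that(2)] x(2) by simp
  qed
  ultimately have p: "\<pi> \<in> perms V" by (simp add: perms_def)
  have "\<phi> = pattern_gate V \<pi>"
  proof (rule Bij_ext[OF B pattern_gate_Bij(1)[OF p V(2)]])
    fix x assume x: "x \<in> X"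
    show "\<phi> x = pattern_gate V \<pi> x"
    proof (rule X_ext[OF Bij_apply[OF B x] pattern_gate_in_X[OF p x V(2)]])
      fix h assume "h \<in> carrier G"
      then show "\<phi> x h = pattern_gate V \<pi> x h"
        using x \<pi>[OF x] windowed_off[OF \<phi> x] by (simp add: pattern_gate_def)
    qed
  qed
  then show ?thesis using that p \<pi> by blast
qed

lemma transposition_perms:
  assumes "a \<in> patterns V" "b \<in> patterns V" "restrict a (bd V) = restrict b (bd V)"
  shows "transposition a b \<in> perms V"
proof -
  have "a h = b h" if "h \<in> bd V" for h using assms(3) that by (metis restrict_apply')
  then show ?thesis unfolding perms_def using permutes_swap_id[OF assms(1,2)]
    by (auto simp: Transposition.transpose_def)
qed

abbreviation gate_product where
  "gate_product f ps \<equiv> foldr (\<lambda>p y. f p \<star> y) ps gate_one"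

lemma pattern_gate_product:
  assumes "V \<subseteq> carrier G"
    and "\<And>a b. (a, b) \<in> set ps \<Longrightarrow> a \<in> patterns V \<and> b \<in> patterns V \<and> restrict a (bd V) = restrict b (bd V)"
  shows "foldr (\<lambda>(a, b) \<rho>. transposition a b \<circ> \<rho>) ps id \<in> perms V \<and>
    pattern_gate V (foldr (\<lambda>(a, b) \<rho>. transposition a b \<circ> \<rho>) ps id) =
         gate_product (\<lambda>(a, b). pattern_gate V (transposition a b)) ps"
  using assms(2)
proof (induction ps)
  case Nil
  show ?case using perms_id[unfolded id_def] pattern_gate_one[OF assms(1), unfolded id_def] by (simp add: id_def)
next
  case (Cons p ps)
  obtain a b where p: "p = (a, b)" by fastforce
  have t: "transposition a b \<in> perms V" 
  proof -
    have "(a, b) \<in> set (p # ps)" using p by simp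
    then show ?thesis using Cons.prems transposition_perms by blast
  qed
  define F where "F = foldr (\<lambda>(a, b) \<rho>. transposition a b \<circ> \<rho>) ps id"
  define Q where "Q = gate_product (\<lambda>(a, b). pattern_gate V (transposition a b)) ps"
  have IH: "F \<in> perms V \<and> pattern_gate V F = Q"
    unfolding F_def Q_def by (rule Cons.IH, rule Cons.prems, simp)
  have F: "foldr (\<lambda>(a, b) \<rho>. transposition a b \<circ> \<rho>) (p # ps) id = transposition a b \<circ> F"
    unfolding F_def p by simp
  have Q: "gate_product (\<lambda>(a, b). pattern_gate V (transposition a b)) (p # ps) =
      pattern_gate V (transposition a b) \<star> Q"
    unfolding Q_def p by simp
  show ?case unfolding F Q using pattern_gate_mult[OF t _ assms(1)] perms_comp[OF t] IH by blast
qed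

end

context glued_shift
begin

section \<open>Swap gates\<close>

definition swappable :: "'g set \<Rightarrow> ('g \<Rightarrow> 'a) \<Rightarrow> ('g \<Rightarrow> 'a) \<Rightarrow> bool" where
  "swappable V p q \<longleftrightarrow> p \<in> X \<and> q \<in> X \<and> (\<forall>h\<in>bd V. p h = q h)"

definition swap :: "'g set \<Rightarrow> ('g \<Rightarrow> 'a) \<Rightarrow> ('g \<Rightarrow> 'a) \<Rightarrow> (('g \<Rightarrow> 'a) \<Rightarrow> ('g \<Rightarrow> 'a))" where
  "swap V p q = pattern_gate V (transposition (restrict p V) (restrict q V))"

lemma restrict_eq_iff: "restrict x V = restrict y V \<longleftrightarrow> (\<forall>h\<in>V. x h = y h)"
  by (metis restrict_apply' restrict_ext)

lemma swappable_perms: "swappable V p q \<Longrightarrow> transposition (restrict p V) (restrict q V) \<in> perms V"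
  using transposition_perms[of "restrict p V" V "restrict q V"] patternsI bd_subset
  unfolding swappable_def by (auto simp: restrict_eq_iff subset_iff)

lemma swap_windowed: "swappable V p q \<Longrightarrow> V \<subseteq> carrier G \<Longrightarrow> swap V p q \<in> windowed V"
  unfolding swap_def using swappable_perms pattern_gate_windowed by blast

lemma swap_apply:
  assumes "x \<in> X" "V \<subseteq> carrier G"
  shows "swap V p q x = (if restrict x V = restrict p V then glue V q x
                         else if restrict x V = restrict q V then glue V p x else x)"
proof -
  have eq: "glue V (restrict y V) x = glue V y x" for y by (auto simp: glue_def)
  have "glue V x x = x" using assms(1) X_full by (auto simp: glue_def fun_eq_iff PiE_iff extensional_def subset_iff)
  then show ?thesis using assms(1) by (auto simp: swap_def pattern_gate_def Transposition.transpose_def eq)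
qed

lemma swap_swap:
  assumes "swappable V p q" "V \<subseteq> carrier G" "x \<in> X"
  shows "swap V p q (swap V p q x) = x"
  using pattern_gate_comp[OF swappable_perms[OF assms(1)] swappable_perms[OF assms(1)] assms(3,2)]
    pattern_gate_id[OF assms(3)] unfolding swap_def by simp

lemma r_coset_mem: "h \<in> carrier G \<Longrightarrow> g \<in> carrier G \<Longrightarrow> V \<subseteq> carrier G \<Longrightarrow> h \<in> V #> g \<longleftrightarrow> h \<otimes> inv g \<in> V"
  unfolding r_coset_def by (force simp: m_assoc subset_iff)

lemma restrict_shift_iff:
  assumes "g \<in> carrier G" "V \<subseteq> carrier G"
  shows "restrict (shift G g x) V = restrict p V \<longleftrightarrow>
         restrict x (V #> g) = restrict (shift G (inv g) p) (V #> g)"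
proof -
  have "(\<forall>h\<in>V #> g. x h = shift G (inv g) p h) \<longleftrightarrow> (\<forall>v\<in>V. x (v \<otimes> g) = p v)"
    using assms by (auto simp: r_coset_def m_assoc subset_iff)
  then show ?thesis using assms by (auto simp: restrict_eq_iff subset_iff)
qed

lemma shift_glue:
  assumes "g \<in> carrier G" "V \<subseteq> carrier G" "x \<in> carrier G \<rightarrow>\<^sub>E A"
  shows "shift G (inv g) (glue V q (shift G g x)) = glue (V #> g) (shift G (inv g) q) x"
proof
  fix h
  show "shift G (inv g) (glue V q (shift G g x)) h = glue (V #> g) (shift G (inv g) q) x h"
  proof (cases "h \<in> carrier G")
    case True
    then show ?thesis using assms r_coset_mem[OF True assms(1,2)] by (simp add: m_assoc)
  qed (simp add: shift_def glue_def)
qed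

text \<open>Describing a swap by points rather than by patterns makes its translates swaps of the shifted
  points.\<close>

lemma conj_swap:
  assumes "swappable V p q" "V \<subseteq> carrier G" "g \<in> carrier G"
  shows "conj (swap V p q) g = swap (V #> g) (shift G (inv g) p) (shift G (inv g) q)"
proof -
  have B: "swap V p q \<in> Bij X" using swap_windowed[OF assms(1,2)] windowed_Bij by blast
  have Vg: "V #> g \<subseteq> carrier G" using r_coset_subset_G assms by blast
  have eq: "conj (swap V p q) g x = swap (V #> g) (shift G (inv g) p) (shift G (inv g) q) x" if x: "x \<in> X" for x
  proof -
    have full: "x \<in> carrier G \<rightarrow>\<^sub>E A" using x X_full by blast
    show ?thesis
      using x assms(3) shift_in_X[OF x assms(3)] shift_inv(2)[OF assms(3) full]
      by (simp add: conj_apply[OF B] swap_apply[OF _ assms(2)] swap_apply[OF _ Vg]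
          restrict_shift_iff[OF assms(3,2)] shift_glue[OF assms(3,2) full])
  qed
  show ?thesis
  proof (rule extensionalityI)
    show "conj (swap V p q) g \<in> extensional X" using conj_Bij[OF B assms(3)] Bij_imp_extensional by blast
    show "swap (V #> g) (shift G (inv g) p) (shift G (inv g) q) \<in> extensional X"
      by (simp add: swap_def pattern_gate_def)
  qed (rule eq)
qed

lemma boundary_shift:
  assumes "V \<subseteq> carrier G" "g \<in> carrier G" "h \<in> bd (V #> g)"
  shows "h \<otimes> inv g \<in> bd V"
proof -
  have h: "h \<in> V #> g" using assms(3) bd_subset by blast
  then have hG: "h \<in> carrier G" using r_coset_subset_G assms by blast
  obtain k where k: "k \<in> carrier G" "h \<in> B #> k" "\<not> B #> k \<subseteq> V #> g"
    using assms(3) unfolding boundary_def by blast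
  have "h \<otimes> inv g \<in> B #> (k \<otimes> inv g)"
    using k(1,2) assms(2) B_finite(2) by (auto simp: r_coset_def m_assoc subset_iff)
  moreover have "\<not> B #> (k \<otimes> inv g) \<subseteq> V"
  proof
    assume sub: "B #> (k \<otimes> inv g) \<subseteq> V"
    have "b \<otimes> k \<in> V #> g" if "b \<in> B" for b
    proof -
      have "b \<otimes> (k \<otimes> inv g) \<in> V" using sub that unfolding r_coset_def by blast
      moreover have "b \<in> carrier G" using that B_finite(2) by blast
      ultimately show ?thesis using k(1) assms r_coset_mem[of "b \<otimes> k" g V] by (simp add: m_assoc)
    qed
    then show False using k(3) unfolding r_coset_def by blast
  qed
  moreover have "h \<otimes> inv g \<in> V" using h r_coset_mem[OF hG assms(2,1)] by blast
  ultimately show ?thesis using k(1) assms(2) unfolding boundary_def by blast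
qed

lemma swappable_shift:
  assumes "swappable V p q" "V \<subseteq> carrier G" "g \<in> carrier G"
  shows "swappable (V #> g) (shift G (inv g) p) (shift G (inv g) q)"
  unfolding swappable_def
proof (intro conjI ballI)
  show "shift G (inv g) p \<in> X" "shift G (inv g) q \<in> X"
    using assms shift_in_X unfolding swappable_def by auto
  fix h assume h: "h \<in> bd (V #> g)"
  then have "h \<in> V #> g" using bd_subset by blast
  then have "h \<in> carrier G" using r_coset_subset_G[OF assms(2,3)] by blast
  then show "shift G (inv g) p h = shift G (inv g) q h"
    using boundary_shift[OF assms(2,3) h] assms(1) unfolding swappable_def by simp
qed

lemma gate_product_windowed:
  "(\<And>s. s \<in> set ss \<Longrightarrow> f s \<in> windowed V) \<Longrightarrow> gate_product f ss \<in> windowed V"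
  by (induction ss) (auto intro: subgroup.m_closed[OF windowed_subgroup] subgroup.one_closed[OF windowed_subgroup])

lemma gate_product_append:
  assumes "\<And>s. s \<in> set (ss @ ts) \<Longrightarrow> f s \<in> windowed V"
  shows "gate_product f (ss @ ts) = gate_product f ss \<star> gate_product f ts"
  using assms
proof (induction ss)
  case Nil
  then show ?case using gate_product_windowed[of ts f V] windowed_Bij by simp
next
  case (Cons s ss)
  have "f s \<in> Bij X" "gate_product f ss \<in> Bij X" "gate_product f ts \<in> Bij X"
    using Cons.prems gate_product_windowed[of ss f V] gate_product_windowed[of ts f V] windowed_Bij by auto
  then show ?case using Cons by (simp add: Sym.m_assoc)
qed

text \<open>On a window that contains \<open>padded U\<close> the gate does not touch the boundary. So it is given by a
  permutation of patterns with fixed boundary values, which is a product of transpositions.\<close>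

lemma windowed_as_swaps:
  assumes "\<phi> \<in> windowed U" "padded U \<subseteq> W" "finite W" "W \<subseteq> carrier G"
  shows "\<exists>ss. (\<forall>(p, q) \<in> set ss. swappable W p q) \<and> \<phi> = gate_product (\<lambda>(p, q). swap W p q) ss"
proof -
  have UW: "U \<subseteq> W" using assms(2) unfolding padded_def by blast
  then have "\<phi> \<in> windowed W" using windowed_mono assms by blast
  moreover have "\<phi> x h = x h" if "x \<in> X" "h \<in> bd W" for x h
    using windowed_off[OF assms(1) that(1)] padded_bd[OF assms(2)] that(2) bd_subset assms(4) by blast
  ultimately obtain \<pi> where \<pi>: "\<pi> \<in> perms W" "\<phi> = pattern_gate W \<pi>"
    using windowed_pattern_gate[OF assms(3,4)] by blast
  have "\<exists>ps. (\<forall>(a, b) \<in> set ps. a \<in> patterns W \<and> b \<in> patterns W \<and> restrict a (bd W) = restrict b (bd W)) \<and>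
              \<pi> = foldr (\<lambda>(a, b) \<rho>. transposition a b \<circ> \<rho>) ps id"
    using perms_bd[OF \<pi>(1)] \<pi>(1)
    by (intro perm_as_transpositions finite_patterns assms(3,4)) (auto simp: perms_def restrict_eq_iff)
  then obtain ps where ps: "\<And>a b. (a, b) \<in> set ps \<Longrightarrow> a \<in> patterns W \<and> b \<in> patterns W \<and> restrict a (bd W) = restrict b (bd W)"
     "\<pi> = foldr (\<lambda>(a, b) \<rho>. transposition a b \<circ> \<rho>) ps id" by blast
  have "\<phi> = gate_product (\<lambda>(a, b). pattern_gate W (transposition a b)) ps"
    using pattern_gate_product[OF assms(4) ps(1)] \<pi>(2) ps(2) by simp
  moreover have "\<exists>ss. (\<forall>(p, q) \<in> set ss. swappable W p q) \<and>
      gate_product (\<lambda>(a, b). pattern_gate W (transposition a b)) ps = gate_product (\<lambda>(p, q). swap W p q) ss"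
    using ps(1)
  proof (induction ps)
    case Nil
    then show ?case by (intro exI[of _ "[]"]) simp
  next
    case (Cons c ps)
    obtain a b where c: "c = (a, b)" by fastforce
    have ab: "a \<in> patterns W" "b \<in> patterns W" "restrict a (bd W) = restrict b (bd W)"
    proof -
      have "(a, b) \<in> set (c # ps)" using c by simp
      from Cons.prems[OF this] show "a \<in> patterns W" "b \<in> patterns W" "restrict a (bd W) = restrict b (bd W)"
        by blast+
    qed
    then obtain p q where pq: "p \<in> X" "q \<in> X" "a = restrict p W" "b = restrict q W" unfolding patterns_def by blast
    have "p h = q h" if "h \<in> bd W" for h
    proof -
      have "h \<in> W" using that bd_subset by blast
      moreover have "a h = b h" using ab(3) that unfolding restrict_eq_iff by blast
      ultimately show ?thesis using pq by simp
    qed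
    then have "swappable W p q" using pq unfolding swappable_def by blast
    moreover obtain ss where "\<forall>(p, q) \<in> set ss. swappable W p q"
      "gate_product (\<lambda>(a, b). pattern_gate W (transposition a b)) ps = gate_product (\<lambda>(p, q). swap W p q) ss"
      using Cons by (metis list.set_intros(2))
    ultimately show ?case using pq c by (intro exI[of _ "(p, q) # ss"]) (simp add: swap_def)
  qed
  ultimately show ?thesis by simp
qed

section \<open>Parity\<close>

text \<open>Two transpositions with the same boundary values are conjugate, so their product is a commutator.\<close>

lemma transposition_pair_derived:
  assumes V: "V \<subseteq> carrier G"
    and pat: "a \<in> patterns V" "b \<in> patterns V" "c \<in> patterns V" "d \<in> patterns V"
    and bd: "restrict a (bd V) = restrict b (bd V)" "restrict a (bd V) = restrict c (bd V)" "restrict a (bd V) = restrict d (bd V)"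
    and ne: "a \<noteq> b" "c \<noteq> d"
  shows "pattern_gate V (transposition a b) \<star> pattern_gate V (transposition c d) \<in> derived (BijGroup X) (windowed V)"
proof -
  have "\<exists>\<rho>\<in>perms V. (\<rho> a = c \<and> \<rho> b = d) \<or> (\<rho> a = d \<and> \<rho> b = c)"
  (* If b = c, sending a to c would collide with b; then c and d are taken in the other order. *)
  proof (cases "b = c")
    case True
    have "transposition a d \<in> perms V" using pat bd by (intro transposition_perms) auto
    moreover have "transposition a d a = d" "transposition a d b = c" using True ne by auto
    ultimately show ?thesis by blast
  next
    case False
    have "transposition b d \<circ> transposition a c \<in> perms V"
      using pat bd by (intro perms_comp transposition_perms) auto
    moreover have "(transposition b d \<circ> transposition a c) a = c" "(transposition b d \<circ> transposition a c) b = d"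
      using False ne by auto
    ultimately show ?thesis by blast
  qed
  then obtain \<rho> where \<rho>: "\<rho> \<in> perms V" "(\<rho> a = c \<and> \<rho> b = d) \<or> (\<rho> a = d \<and> \<rho> b = c)" by blast
  have bij: "bij \<rho>" using \<rho>(1) permutes_bij unfolding perms_def by blast
  have cd': "transposition (\<rho> a) (\<rho> b) = transposition c d"
    using \<rho>(2) Transposition.transpose_commute[of c d] by metis
  have "transposition (\<rho> a) (\<rho> b) \<circ> \<rho> = \<rho> \<circ> transposition a b"
    using Transposition.transpose_comp_eq[OF bij, of "\<rho> a" "\<rho> b"]
    unfolding inv_f_f[OF bij_is_inj[OF bij]] .
  moreover have "\<rho> \<circ> Hilbert_Choice.inv \<rho> = id" using bij_is_surj[OF bij] unfolding surj_iff .
  ultimately have cd: "transposition c d = \<rho> \<circ> transposition a b \<circ> Hilbert_Choice.inv \<rho>"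
    unfolding cd' by (metis comp_assoc comp_id)
  have ab: "transposition a b \<in> perms V" using pat bd by (intro transposition_perms) auto
  define g where "g = pattern_gate V (transposition a b)"
  define k where "k = pattern_gate V \<rho>"
  have gk: "g \<in> windowed V" "k \<in> windowed V"
    unfolding g_def k_def using ab \<rho>(1) V by (auto intro: pattern_gate_windowed)
  have inv_g: "gate_inv g = g"
    unfolding g_def using pattern_gate_Bij(2)[OF ab V] by simp
  have "pattern_gate V (transposition c d) = k \<star> g \<star> gate_inv k"
    unfolding cd g_def k_def pattern_gate_Bij(2)[OF \<rho>(1) V]
    using pattern_gate_mult[OF perms_comp[OF \<rho>(1) ab] perms_inv[OF \<rho>(1)] V] pattern_gate_mult[OF \<rho>(1) ab V]
    by simp
  then have "pattern_gate V (transposition a b) \<star> pattern_gate V (transposition c d) = g \<star> k \<star> gate_inv g \<star> gate_inv k"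
    using gk windowed_Bij[of g] windowed_Bij[of k] unfolding inv_g by (simp add: Sym.m_assoc g_def[symmetric])
  then show ?thesis using Sym.commutator_in_derived[OF gk] by simp
qed

text \<open>Only the cells of \<open>V\<close> off its boundary are free. So, by gluing, a filling is the same as a pattern
  on \<open>V\<close> that extends \<open>p\<close> on \<open>W\<close> and has the boundary values of \<open>x\<close>, which is \<open>card_fillings\<close>
  below.\<close>

definition fillings :: "'g set \<Rightarrow> ('g \<Rightarrow> 'a) \<Rightarrow> 'g set \<Rightarrow> ('g \<Rightarrow> 'a) \<Rightarrow> ('g \<Rightarrow> 'a) set" where
  "fillings V x W p = {z \<in> X. (\<forall>h\<in>carrier G. h \<notin> V \<or> h \<in> bd V \<longrightarrow> z h = x h) \<and> (\<forall>h\<in>W. z h = p h)}"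

lemma card_fillings:
  assumes V: "V \<subseteq> carrier G" "W \<subseteq> V" and x: "x \<in> X"
  shows "card {a \<in> patterns V. restrict a W = restrict p W \<and> restrict a (bd V) = restrict x (bd V)} = card (fillings V x W p)"
proof -
  have "bij_betw (\<lambda>z. restrict z V) (fillings V x W p)
      {a \<in> patterns V. restrict a W = restrict p W \<and> restrict a (bd V) = restrict x (bd V)}" (is "bij_betw ?r _ ?S")
    unfolding bij_betw_def
  proof
    show "inj_on ?r (fillings V x W p)"
    proof (rule inj_onI)
      fix y z assume yz: "y \<in> fillings V x W p" "z \<in> fillings V x W p" "restrict y V = restrict z V"
      then have "y h = z h" if "h \<in> carrier G" for h
        using that unfolding fillings_def restrict_eq_iff by (cases "h \<in> V") auto
      moreover have "y \<in> X" "z \<in> X" using yz unfolding fillings_def by auto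
      ultimately show "y = z" by (intro X_ext)
    qed
    show "?r ` fillings V x W p = ?S"
    proof
      show "?r ` fillings V x W p \<subseteq> ?S"
      proof
        fix a assume "a \<in> ?r ` fillings V x W p"
        then obtain z where z: "z \<in> X" "\<forall>h\<in>carrier G. h \<notin> V \<or> h \<in> bd V \<longrightarrow> z h = x h"
            "\<forall>h\<in>W. z h = p h" "a = restrict z V"
          unfolding fillings_def by blast
        have "a h = x h" if "h \<in> bd V" for h
          using z(2,4) that bd_subset[of V] V(1) by auto
        moreover have "a h = p h" if "h \<in> W" for h using z(3,4) that V(2) by auto
        ultimately show "a \<in> ?S" using z(4) patternsI[OF z(1)] unfolding restrict_eq_iff by blast
      qed
      show "?S \<subseteq> ?r ` fillings V x W p"
      proof
        fix a assume a: "a \<in> ?S"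
        then obtain y where y: "y \<in> X" "a = restrict y V" unfolding patterns_def by blast
        have "y h = x h" if "h \<in> bd V" for h
        proof -
          have "a h = x h" using a that unfolding mem_Collect_eq restrict_eq_iff by blast
          moreover have "h \<in> V" using that bd_subset by blast
          ultimately show ?thesis using y(2) by simp
        qed
        then have "glue V y x \<in> X" using glue_in_X[OF V(1) y(1) x] by blast
        moreover have "y h = p h" if "h \<in> W" for h
        proof -
          have "a h = p h" using a that unfolding mem_Collect_eq restrict_eq_iff by blast
          then show ?thesis using y(2) that V(2) by auto
        qed
        moreover have "glue V y x h = x h" if "h \<in> carrier G" "h \<notin> V \<or> h \<in> bd V" for h
          unfolding glue_apply[OF that(1)] using that(2) \<open>\<And>h. h \<in> bd V \<Longrightarrow> y h = x h\<close> by presburger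
        moreover have "glue V y x h = p h" if "h \<in> W" for h
        proof -
          have "h \<in> V" "h \<in> carrier G" using that V by auto
          then show ?thesis using \<open>\<And>h. h \<in> W \<Longrightarrow> y h = p h\<close>[OF that] by simp
        qed
        ultimately have "glue V y x \<in> fillings V x W p" unfolding fillings_def by blast
        moreover have "restrict (glue V y x) V = a" using y(2) V(1) by (auto simp: fun_eq_iff subset_iff)
        ultimately show "a \<in> ?r ` fillings V x W p" by blast
      qed
    qed
  qed
  then show ?thesis by (rule bij_betw_same_card[symmetric])
qed

abbreviation transposition_gate where
  "transposition_gate V \<equiv> \<lambda>(a, b). pattern_gate V (transposition a b)"

lemma restrict_restrict_subset: "W \<subseteq> V \<Longrightarrow> restrict (restrict x V) W = restrict x W"
  by (simp add: Int_absorb1)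

text \<open>On the patterns on \<open>V\<close> the swap gate is an involution. It moves exactly the patterns that
  restrict to \<open>p\<close> or to \<open>q\<close> on \<open>W\<close>, and the former represent its two-element orbits.\<close>

lemma swap_as_transpositions:
  assumes sw: "swappable W p q" and W: "W \<subseteq> V" and V: "finite V" "V \<subseteq> carrier G"
    and ne: "restrict p W \<noteq> restrict q W"
  shows "\<exists>as f. distinct as \<and> set as = {a \<in> patterns V. restrict a W = restrict p W} \<and>
    (\<forall>a\<in>set as. f a \<in> patterns V \<and> f a \<noteq> a \<and> restrict (f a) (bd V) = restrict a (bd V)) \<and>
    swap W p q = gate_product (transposition_gate V) (map (\<lambda>a. (a, f a)) as)"
proof -
  let ?s = "swap W p q" and ?S = "{a \<in> patterns V. restrict a W = restrict p W}"
  have WG: "W \<subseteq> carrier G" using W V by blast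
  have w: "?s \<in> windowed V" using swap_windowed[OF sw WG] windowed_mono[OF W V(2)] by blast
  have B: "?s \<in> Bij X" using w by (rule windowed_Bij)
  have pq: "p \<in> X" "q \<in> X" using sw unfolding swappable_def by auto
  have to_q: "restrict (?s x) W = restrict q W" if "x \<in> X" "restrict x W = restrict p W" for x
    using that WG unfolding swap_apply[OF that(1) WG] by (auto simp: restrict_eq_iff subset_iff)
  have to_p: "restrict (?s x) W = restrict p W" if "x \<in> X" "restrict x W = restrict q W" for x
    using that ne WG unfolding swap_apply[OF that(1) WG] by (auto simp: restrict_eq_iff subset_iff)
  have fixed: "?s x = x" if "x \<in> X" "restrict x W \<noteq> restrict p W" "restrict x W \<noteq> restrict q W" for x
    using that swap_apply[OF that(1) WG] by simp
  have "?s x h = x h" if "x \<in> X" "h \<in> bd V" for x h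
  proof -
    have hV: "h \<in> V" "h \<in> carrier G" using that(2) bd_subset V(2) by blast+
    show ?thesis
    proof (cases "h \<in> W")
      case True
      then have "p h = q h" using bd_mono[OF W that(2)] sw unfolding swappable_def by blast
      moreover have "restrict y W = restrict z W \<Longrightarrow> y h = z h" for y z
        using True unfolding restrict_eq_iff by blast
      ultimately show ?thesis using to_p[OF that(1)] to_q[OF that(1)] fixed[OF that(1)] by metis
    next
      case False
      then show ?thesis using windowed_off[OF swap_windowed[OF sw WG] that(1) hV(2)] by blast
    qed
  qed
  then obtain \<pi> where \<pi>: "\<pi> \<in> perms V" "?s = pattern_gate V \<pi>"
    "\<And>x. x \<in> X \<Longrightarrow> \<pi> (restrict x V) = restrict (?s x) V"
    using windowed_pattern_gate[OF V w] by blast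
  have out: "\<pi> a = a" if "a \<notin> patterns V" for a
    using \<pi>(1) that permutes_not_in unfolding perms_def by fast
  have inv: "\<pi> (\<pi> a) = a" for a
  proof (cases "a \<in> patterns V")
    case True
    then obtain x where x: "x \<in> X" "a = restrict x V" unfolding patterns_def by blast
    then show ?thesis using \<pi>(3)[OF x(1)] \<pi>(3)[OF Bij_apply[OF B x(1)]] swap_swap[OF sw WG x(1)] by simp
  qed (simp add: out)
  have "finite ?S" using finite_patterns[OF V] by simp
  then obtain as where as: "set as = ?S" "distinct as" using finite_distinct_list by blast
  have moved: "restrict (\<pi> a) W = restrict q W" if a: "a \<in> ?S" for a
  proof -
    obtain x where x: "x \<in> X" "a = restrict x V" using a unfolding patterns_def by blast
    have "restrict a W = restrict p W" using a by blast
    then have "restrict x W = restrict p W" unfolding x(2) restrict_restrict_subset[OF W] .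
    then have "restrict (?s x) W = restrict q W" by (rule to_q[OF x(1)])
    then show ?thesis unfolding x(2) \<pi>(3)[OF x(1)] restrict_restrict_subset[OF W] .
  qed
  have disj: "set as \<inter> \<pi> ` set as = {}" using moved ne unfolding as by fastforce
  have cover: "\<pi> a = a" if "a \<notin> set as \<union> \<pi> ` set as" for a
  proof (cases "a \<in> patterns V")
    case True
    then obtain x where x: "x \<in> X" "a = restrict x V" unfolding patterns_def by blast
    have xW: "restrict a W = restrict x W" using x(2) restrict_restrict_subset[OF W] by simp
    have 1: "restrict x W \<noteq> restrict p W" using that True xW unfolding as by auto
    have 2: "restrict x W \<noteq> restrict q W"
    proof
      assume "restrict x W = restrict q W"
      then have "restrict (?s x) W = restrict p W" by (rule to_p[OF x(1)])
      then have "restrict (\<pi> a) W = restrict p W"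
        unfolding x(2) \<pi>(3)[OF x(1)] restrict_restrict_subset[OF W] .
      then have "\<pi> a \<in> set as" using perms_pattern[OF \<pi>(1) True] unfolding as by simp
      then have "a \<in> \<pi> ` set as" using inv[of a] by (metis imageI)
      then show False using that by blast
    qed
    show ?thesis unfolding x(2) \<pi>(3)[OF x(1)] fixed[OF x(1) 1 2] ..
  qed (rule out)
  have prod: "foldr (\<lambda>(a, b) \<rho>. transposition a b \<circ> \<rho>) (map (\<lambda>a. (a, \<pi> a)) as) id = \<pi>"
  proof
    fix c
    show "foldr (\<lambda>(a, b) \<rho>. transposition a b \<circ> \<rho>) (map (\<lambda>a. (a, \<pi> a)) as) id c = \<pi> c"
      unfolding involution_as_transpositions[OF inv as(2) disj] using cover[of c] by presburger
  qed
  have bd: "restrict (\<pi> a) (bd V) = restrict a (bd V)" if "a \<in> patterns V" for a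
    using perms_bd[OF \<pi>(1) that] unfolding restrict_eq_iff by blast
  have valid: "a \<in> patterns V \<and> b \<in> patterns V \<and> restrict a (bd V) = restrict b (bd V)"
    if "(a, b) \<in> set (map (\<lambda>a. (a, \<pi> a)) as)" for a b
  proof -
    have ab: "a \<in> patterns V" "b = \<pi> a" using that as by auto
    show ?thesis unfolding ab(2) using ab(1) perms_pattern[OF \<pi>(1) ab(1)] bd[OF ab(1)] by simp
  qed
  have "?s = gate_product (transposition_gate V) (map (\<lambda>a. (a, \<pi> a)) as)"
    unfolding \<pi>(2)
    using pattern_gate_product[OF V(2), of "map (\<lambda>a. (a, \<pi> a)) as", OF valid, THEN conjunct2]
    unfolding prod .
  moreover have "\<pi> a \<in> patterns V \<and> \<pi> a \<noteq> a \<and> restrict (\<pi> a) (bd V) = restrict a (bd V)" if "a \<in> set as" for a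
  proof -
    have aV: "a \<in> patterns V" using that as by auto
    have "\<pi> a \<in> \<pi> ` set as" using that by blast
    then have "\<pi> a \<noteq> a" using that disj by (metis Int_iff empty_iff)
    then show ?thesis using perms_pattern[OF \<pi>(1) aV] bd[OF aV] by blast
  qed
  ultimately show ?thesis using as by blast
qed

definition pattern_count :: "'g set \<Rightarrow> ('g \<Rightarrow> 'a) \<Rightarrow> 'g set \<Rightarrow> ('g \<Rightarrow> 'a) \<Rightarrow> nat" where
  "pattern_count V c W p = card {a \<in> patterns V. restrict a W = restrict p W \<and> restrict a (bd V) = c}"

text \<open>Replace each swap gate by its transpositions on \<open>V\<close> and label these by their boundary values:
  products of two transpositions with the same label are commutators, and the hypothesis says that
  each label occurs an even number of times.\<close>

lemma swaps_in_derived: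
  assumes V: "finite V" "V \<subseteq> carrier G"
    and ss: "\<And>W p q. (W, p, q) \<in> set ss \<Longrightarrow> swappable W p q \<and> W \<subseteq> V \<and> restrict p W \<noteq> restrict q W"
    and even: "\<And>x. x \<in> X \<Longrightarrow> even (\<Sum>(W, p, q)\<leftarrow>ss. card (fillings V x W p))"
  shows "gate_product (\<lambda>(W, p, q). swap W p q) ss \<in> derived (BijGroup X) (windowed V)"
proof -
  define valid where "valid = (\<lambda>(a, b). a \<in> patterns V \<and> b \<in> patterns V \<and> a \<noteq> b \<and> restrict a (bd V) = restrict b (bd V))"
  define l where "l = (\<lambda>(a :: 'g \<Rightarrow> 'a, b :: 'g \<Rightarrow> 'a). restrict a (bd V))"
  have tw: "transposition_gate V e \<in> windowed V" if "valid e" for e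
    using that V(2) pattern_gate_windowed[OF transposition_perms] unfolding valid_def by (cases e) auto
  have "\<exists>es. (\<forall>e\<in>set es. valid e) \<and>
      gate_product (\<lambda>(W, p, q). swap W p q) ss = gate_product (transposition_gate V) es \<and>
      (\<forall>c. length (filter (\<lambda>e. l e = c) es) = (\<Sum>(W, p, q)\<leftarrow>ss. pattern_count V c W p))"
    using ss
  proof (induction ss)
    case Nil
    show ?case by (rule exI[of _ "[]"]) simp
  next
    case (Cons s ss)
    obtain W p q where s: "s = (W, p, q)" by (cases s) auto
    have sw: "swappable W p q" "W \<subseteq> V" "restrict p W \<noteq> restrict q W"
      using Cons.prems[of W p q] unfolding s by (metis list.set_intros(1))+
    obtain as f where as: "distinct as" "set as = {a \<in> patterns V. restrict a W = restrict p W}"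
      "\<And>a. a \<in> set as \<Longrightarrow> f a \<in> patterns V \<and> f a \<noteq> a \<and> restrict (f a) (bd V) = restrict a (bd V)"
      "swap W p q = gate_product (transposition_gate V) (map (\<lambda>a. (a, f a)) as)"
      using swap_as_transpositions[OF sw(1,2) V sw(3)] by blast
    have "\<And>W p q. (W, p, q) \<in> set ss \<Longrightarrow> swappable W p q \<and> W \<subseteq> V \<and> restrict p W \<noteq> restrict q W"
      using Cons.prems by (meson list.set_intros(2))
    from Cons.IH[OF this] obtain es where es: "\<And>e. e \<in> set es \<Longrightarrow> valid e"
      "gate_product (\<lambda>(W, p, q). swap W p q) ss = gate_product (transposition_gate V) es"
      "\<And>c. length (filter (\<lambda>e. l e = c) es) = (\<Sum>(W, p, q)\<leftarrow>ss. pattern_count V c W p)"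
      by blast
    let ?es = "map (\<lambda>a. (a, f a)) as"
    have v: "valid e" if e: "e \<in> set ?es" for e
    proof -
      obtain a where a: "a \<in> set as" "e = (a, f a)" using e by auto
      have "a \<in> patterns V" using a(1) unfolding as(2) by blast
      then show ?thesis using as(3)[OF a(1)] unfolding valid_def a(2) by auto
    qed
    have "length (filter (\<lambda>e. l e = c) ?es) = pattern_count V c W p" for c
    proof -
      have "length (filter (\<lambda>e. l e = c) ?es) = length (filter (\<lambda>a. restrict a (bd V) = c) as)"
        by (simp add: filter_map o_def l_def)
      also have "\<dots> = card {a \<in> set as. restrict a (bd V) = c}"
        using distinct_card[OF distinct_filter[OF as(1)]] unfolding set_filter by metis
      also have "{a \<in> set as. restrict a (bd V) = c} =
          {a \<in> patterns V. restrict a W = restrict p W \<and> restrict a (bd V) = c}"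
        unfolding as(2) by blast
      finally show ?thesis unfolding pattern_count_def .
    qed
    then have "length (filter (\<lambda>e. l e = c) (?es @ es)) = (\<Sum>(W, p, q)\<leftarrow>s # ss. pattern_count V c W p)" for c
      using es(3)[of c] unfolding s by simp
    moreover have "gate_product (\<lambda>(W, p, q). swap W p q) (s # ss) = gate_product (transposition_gate V) (?es @ es)"
    proof -
      have "transposition_gate V e \<in> windowed V" if "e \<in> set (?es @ es)" for e
        using that tw v es(1) unfolding set_append by blast
      then have "gate_product (transposition_gate V) (?es @ es) =
          gate_product (transposition_gate V) ?es \<star> gate_product (transposition_gate V) es"
        by (rule gate_product_append)
      then show ?thesis unfolding as(4)[symmetric] es(2)[symmetric] s by simp
    qed
    moreover have "\<forall>e\<in>set (?es @ es). valid e" using v es(1) unfolding set_append by blast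
    ultimately show ?case by blast
  qed
  then obtain es where es: "\<And>e. e \<in> set es \<Longrightarrow> valid e"
      "gate_product (\<lambda>(W, p, q). swap W p q) ss = gate_product (transposition_gate V) es"
      "\<And>c. length (filter (\<lambda>e. l e = c) es) = (\<Sum>(W, p, q)\<leftarrow>ss. pattern_count V c W p)"
    by blast
  show ?thesis
    unfolding es(2)
  proof (rule Sym.foldr_mult_in_derived[OF windowed_subgroup, where l = l])
    show "transposition_gate V e \<in> windowed V" if "e \<in> set es" for e using tw es(1) that by blast
    show "transposition_gate V e \<star> transposition_gate V e' \<in> derived (BijGroup X) (windowed V)"
      if e: "e \<in> set es" "e' \<in> set es" "l e = l e'" for e e'
    proof -
      obtain a b c d where ab: "e = (a, b)" "e' = (c, d)" by (metis surj_pair)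
      show ?thesis
        using es(1)[OF e(1)] es(1)[OF e(2)] e(3) transposition_pair_derived[OF V(2), of a b c d]
        unfolding ab valid_def l_def by simp
    qed
    fix c
    have "even (\<Sum>(W, p, q)\<leftarrow>ss. pattern_count V c W p)"
    proof (cases "\<exists>x\<in>X. c = restrict x (bd V)")
      case True
      then obtain x where x: "x \<in> X" "c = restrict x (bd V)" by blast
      have "(\<Sum>(W, p, q)\<leftarrow>ss. pattern_count V c W p) = (\<Sum>(W, p, q)\<leftarrow>ss. card (fillings V x W p))"
      proof (rule arg_cong[where f = sum_list], rule map_cong[OF refl])
        fix s assume s: "s \<in> set ss"
        obtain W p q where s': "s = (W, p, q)" by (cases s) auto
        have "W \<subseteq> V" using ss s unfolding s' by blast
        then show "(case s of (W, p, q) \<Rightarrow> pattern_count V c W p) = (case s of (W, p, q) \<Rightarrow> card (fillings V x W p))"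
          using card_fillings[OF V(2) _ x(1)] unfolding s' pattern_count_def x(2) by simp
      qed
      then show ?thesis using even[OF x(1)] by simp
    next
      case False
      have "restrict a (bd V) \<noteq> c" if "a \<in> patterns V" for a
      proof -
        obtain x where "x \<in> X" "a = restrict x V" using \<open>a \<in> patterns V\<close> unfolding patterns_def by blast
        then have "restrict a (bd V) = restrict x (bd V)" using restrict_restrict_subset[OF bd_subset] by blast
        then show ?thesis using False \<open>x \<in> X\<close> by blast
      qed
      then have "{a \<in> patterns V. restrict a W = restrict p W \<and> restrict a (bd V) = c} = {}" for W p
        by blast
      then have "pattern_count V c W p = 0" for W p unfolding pattern_count_def by (simp only: card.empty)
      then have "(\<Sum>(W, p, q)\<leftarrow>ss. pattern_count V c W p) = 0" by (induction ss) auto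
      then show ?thesis by presburger
    qed
    then show "even (length (filter (\<lambda>e. l e = c) es))" unfolding es(3) .
  qed
qed

end

section \<open>Subgroups of finite index\<close>

context group
begin

lemma finite_index_subgroup: "finite_index G H \<Longrightarrow> subgroup H G"
  by (simp add: finite_index_def)

lemma finite_index_subset: "finite_index G H \<Longrightarrow> H \<subseteq> carrier G"
  using finite_index_subgroup subgroup.subset by blast

lemma finite_index_Int:
  assumes "finite_index G H" "finite_index G K"
  shows "finite_index G (H \<inter> K)"
proof -
  have HK: "H \<subseteq> carrier G" "K \<subseteq> carrier G" using assms finite_index_subset by auto
  have eq: "(H \<inter> K) #> a = (H #> a) \<inter> (K #> a)" if "a \<in> carrier G" for a
    using that HK by (auto simp: r_coset_def subset_iff)
  have "rcosets (H \<inter> K) \<subseteq> (\<lambda>(C, D). C \<inter> D) ` ((rcosets H) \<times> (rcosets K))"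
    unfolding RCOSETS_def using eq by fastforce
  then have "finite (rcosets (H \<inter> K))"
    using assms unfolding finite_index_def by (meson finite_SigmaI finite_surj)
  then show ?thesis using assms subgroups_Inter_pair unfolding finite_index_def by blast
qed

lemma finite_index_conjugate:
  assumes H: "finite_index G H" and g: "g \<in> carrier G"
  shows "finite_index G (inv g <# (H #> g))"
proof -
  let ?K = "inv g <# (H #> g)"
  have HG: "H \<subseteq> carrier G" using H finite_index_subset by blast
  have sH: "subgroup H G" using H finite_index_subgroup by blast
  have K: "?K = (\<lambda>h. inv g \<otimes> (h \<otimes> g)) ` H" by (auto simp: l_coset_def r_coset_def)
  have sub: "subgroup ?K G"
    unfolding K
  proof (rule subgroupI)
    show "(\<lambda>h. inv g \<otimes> (h \<otimes> g)) ` H \<subseteq> carrier G" using HG g by auto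
    show "(\<lambda>h. inv g \<otimes> (h \<otimes> g)) ` H \<noteq> {}" using subgroup.one_closed[OF sH] by blast
    fix a assume "a \<in> (\<lambda>h. inv g \<otimes> (h \<otimes> g)) ` H"
    then obtain h where h: "h \<in> H" "a = inv g \<otimes> (h \<otimes> g)" by blast
    then have "inv a = inv g \<otimes> (inv h \<otimes> g)" using HG g by (simp add: inv_mult_group m_assoc subset_iff)
    then show "inv a \<in> (\<lambda>h. inv g \<otimes> (h \<otimes> g)) ` H" using subgroup.m_inv_closed[OF sH h(1)] by blast
    fix b assume "b \<in> (\<lambda>h. inv g \<otimes> (h \<otimes> g)) ` H"
    then obtain k where k: "k \<in> H" "b = inv g \<otimes> (k \<otimes> g)" by blast
    have hk: "h \<in> carrier G" "k \<in> carrier G" using h k HG by auto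
    have "a \<otimes> b = inv g \<otimes> (h \<otimes> (g \<otimes> inv g) \<otimes> (k \<otimes> g))" using h(2) k(2) hk g by (simp only: m_assoc m_closed inv_closed)
    also have "\<dots> = inv g \<otimes> (h \<otimes> k \<otimes> g)" using hk g by (simp add: m_assoc)
    finally show "a \<otimes> b \<in> (\<lambda>h. inv g \<otimes> (h \<otimes> g)) ` H" using subgroup.m_closed[OF sH h(1) k(1)] by blast
  qed
  have "rcosets ?K \<subseteq> (\<lambda>C. inv g <# C) ` (rcosets H)"
  proof
    fix C assume "C \<in> rcosets ?K"
    then obtain a where a: "a \<in> carrier G" "C = ?K #> a" unfolding RCOSETS_def by blast
    have "C = inv g <# (H #> (g \<otimes> a))"
      using a g HG unfolding a(2) by (force simp: l_coset_def r_coset_def m_assoc subset_iff)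
    then show "C \<in> (\<lambda>C. inv g <# C) ` (rcosets H)" using a g unfolding RCOSETS_def by blast
  qed
  then have "finite (rcosets ?K)" using H finite_surj unfolding finite_index_def by blast
  then show ?thesis using sub unfolding finite_index_def by blast
qed

text \<open>A coset \<open>L x\<close> is determined by the coset \<open>K x\<close>, from which a representative \<open>y\<close> is chosen, and by
  the coset of \<open>L\<close> in \<open>K\<close> that contains \<open>x y\<^sup>-\<^sup>1\<close>.\<close>

lemma finite_index_trans:
  assumes K: "finite_index G K" and L: "finite_index (G\<lparr>carrier := K\<rparr>) L"
  shows "finite_index G L"
proof -
  have sK: "subgroup K G" and KG: "K \<subseteq> carrier G" using K finite_index_subgroup finite_index_subset by auto
  have sL: "subgroup L (G\<lparr>carrier := K\<rparr>)" using L unfolding finite_index_def by blast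
  have sLG: "subgroup L G" using incl_subgroup[OF sK sL] .
  have LK: "L \<subseteq> K" using subgroup.subset[OF sL] by simp
  define r where "r D = (SOME y. y \<in> carrier G \<and> D = K #> y)" for D
  have "rcosets L \<subseteq> (\<lambda>(C, D). C #> r D) ` ((rcosets\<^bsub>G\<lparr>carrier := K\<rparr>\<^esub> L) \<times> (rcosets K))"
  proof
    fix C assume "C \<in> rcosets L"
    then obtain x where x: "x \<in> carrier G" "C = L #> x" unfolding RCOSETS_def by blast
    define y where "y = r (K #> x)"
    have y: "y \<in> carrier G" "K #> x = K #> y"
      unfolding y_def r_def using someI_ex[of "\<lambda>y. y \<in> carrier G \<and> K #> x = K #> y"] x(1) by blast+
    have "x \<in> K #> y" using rcos_self[OF x(1) sK] y(2) by simp
    then obtain k where k: "k \<in> K" "x = k \<otimes> y" unfolding r_coset_def by blast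
    have "C = (L #> k) #> y" using coset_mult_assoc[of L k y] LK KG k y(1) x(2) by auto
    moreover have "L #> k \<in> rcosets\<^bsub>G\<lparr>carrier := K\<rparr>\<^esub> L" using k(1) unfolding RCOSETS_def r_coset_def by auto
    moreover have "K #> x \<in> rcosets K" using x(1) unfolding RCOSETS_def by blast
    ultimately show "C \<in> (\<lambda>(C, D). C #> r D) ` ((rcosets\<^bsub>G\<lparr>carrier := K\<rparr>\<^esub> L) \<times> (rcosets K))"
      unfolding y_def by (intro image_eqI[of _ _ "(L #> k, K #> x)"]) auto
  qed
  moreover have "finite ((rcosets\<^bsub>G\<lparr>carrier := K\<rparr>\<^esub> L) \<times> (rcosets K))"
    using K L unfolding finite_index_def by blast
  ultimately have "finite (rcosets L)" by (rule finite_surj[rotated])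
  then show ?thesis using sLG unfolding finite_index_def by blast
qed

text \<open>Finite index is stated with right cosets, whereas gate lattices split along left cosets; inversion
  exchanges the two.\<close>

lemma l_coset_as_inv:
  assumes "subgroup K G" "t \<in> carrier G"
  shows "t <# K = (\<lambda>x. inv x) ` (K #> inv t)"
proof -
  have KG: "K \<subseteq> carrier G" using assms subgroup.subset by blast
  show ?thesis
  proof
    show "t <# K \<subseteq> (\<lambda>x. inv x) ` (K #> inv t)"
    proof
      fix x assume "x \<in> t <# K"
      then obtain k where k: "k \<in> K" "x = t \<otimes> k" unfolding l_coset_def by blast
      then have "x = inv (inv k \<otimes> inv t)" using KG assms by (simp add: inv_mult_group subset_iff)
      then show "x \<in> (\<lambda>x. inv x) ` (K #> inv t)"
        using subgroup.m_inv_closed[OF assms(1) k(1)] unfolding r_coset_def by blast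
    qed
    show "(\<lambda>x. inv x) ` (K #> inv t) \<subseteq> t <# K"
    proof
      fix x assume "x \<in> (\<lambda>x. inv x) ` (K #> inv t)"
      then obtain k where k: "k \<in> K" "x = inv (k \<otimes> inv t)" unfolding r_coset_def by blast
      then have "x = t \<otimes> inv k" using KG assms by (simp add: inv_mult_group subset_iff)
      then show "x \<in> t <# K" using subgroup.m_inv_closed[OF assms(1) k(1)] unfolding l_coset_def by blast
    qed
  qed
qed

lemma finite_l_cosets:
  assumes "finite_index G K"
  shows "finite ((\<lambda>t. t <# K) ` carrier G)"
proof -
  have "(\<lambda>t. t <# K) ` carrier G \<subseteq> (\<lambda>C. (\<lambda>x. inv x) ` C) ` (rcosets K)"
    using l_coset_as_inv[OF finite_index_subgroup[OF assms]] unfolding RCOSETS_def by fastforce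
  then show ?thesis using assms finite_surj unfolding finite_index_def by blast
qed

lemma l_cosets_disjoint:
  assumes K: "subgroup K G" and t: "s \<in> carrier G" "t \<in> carrier G" and ne: "s <# K \<noteq> t <# K"
  shows "(s <# K) \<inter> (t <# K) = {}"
proof (rule ccontr)
  assume "(s <# K) \<inter> (t <# K) \<noteq> {}"
  then obtain x where x: "x \<in> s <# K" "x \<in> t <# K" by blast
  then have "s <# K = x <# K" "t <# K = x <# K"
    using l_repr_independence[OF x(1) t(1) K] l_repr_independence[OF x(2) t(2) K] by auto
  then show False using ne by simp
qed

lemma l_cosets_family_disjoint:
  assumes "subgroup K G" "S \<subseteq> carrier G"
  shows "disjoint ((\<lambda>t. t <# K) ` S)"
proof (rule pairwiseI)
  fix C D assume "C \<in> (\<lambda>t. t <# K) ` S" "D \<in> (\<lambda>t. t <# K) ` S" and ne: "C \<noteq> D"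
  then obtain s t where st: "s \<in> S" "C = s <# K" "t \<in> S" "D = t <# K" by blast
  then have "s \<in> carrier G" "t \<in> carrier G" using assms(2) by auto
  then show "disjnt C D" unfolding disjnt_def st(2,4) using ne unfolding st(2,4)
    by (rule l_cosets_disjoint[OF assms(1)])
qed

lemma residually_finite_avoid:
  assumes rf: "residually_finite G" and "finite F" "F \<subseteq> carrier G"
  shows "\<exists>N. N \<lhd> G \<and> finite_index G N \<and> N \<inter> F \<subseteq> {\<one>}"
  using assms(2,3)
proof (induction F rule: finite_induct)
  case empty
  have "carrier G \<lhd> G" by (rule normal_self)
  moreover have "rcosets (carrier G) \<subseteq> {carrier G}"
    unfolding RCOSETS_def using coset_join2[OF _ subgroup_self] by auto
  then have "finite_index G (carrier G)" using subgroup_self finite_subset unfolding finite_index_def by blast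
  ultimately show ?case by blast
next
  case (insert g F)
  then obtain N where N: "N \<lhd> G" "finite_index G N" "N \<inter> F \<subseteq> {\<one>}" by auto
  show ?case
  proof (cases "g = \<one>")
    case True
    then show ?thesis using N by blast
  next
    case False
    then obtain M where M: "M \<lhd> G" "finite_index G M" "g \<notin> M"
      using rf insert.prems unfolding residually_finite_def by blast
    have "N \<inter> M \<lhd> G" using normal_subgroup_intersect[OF N(1) M(1)] .
    moreover have "finite_index G (N \<inter> M)" using N M finite_index_Int by blast
    ultimately show ?thesis using N(3) M(3) by blast
  qed
qed

end

context shift_space
begin

section \<open>Splitting a gate lattice\<close>

lemma one_in_derived: "gate_one \<in> derived (BijGroup X) (windowed V)"
proof -
  have "windowed V \<subseteq> Bij X" by (auto simp: windowed_def)
  then show ?thesis using subgroup.one_closed[OF Sym.derived_is_subgroup] by blast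
qed

abbreviation commutators where
  "commutators \<equiv> derived (BijGroup X) lattice_group"

lemma commutators_subgroup: "subgroup commutators (BijGroup X)"
  using Sym.derived_is_subgroup[of lattice_group] subgroup.subset[OF lattice_subgroup] by simp

lemma inf_prod_Union_in:
  assumes "finite \<S>" "tame \<phi> (\<Union>\<S>)" "disjoint \<S>" "\<And>S. S \<in> \<S> \<Longrightarrow> inf_prod \<phi> S \<in> commutators"
  shows "inf_prod \<phi> (\<Union>\<S>) \<in> commutators"
  using assms
proof (induction \<S> rule: finite_induct)
  case empty
  have "inf_prod \<phi> {} = gate_one"
  proof (rule Bij_ext)
    show "inf_prod \<phi> {} \<in> Bij X" using inf_prod_Bij empty by simp
    show "inf_prod \<phi> {} x = gate_one x" if "x \<in> X" for x
      using that PiE_restrict[OF subsetD[OF X_full that]]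
      by (simp add: inf_prod_def one_apply Sym.finprod_commuting_empty)
  qed simp
  then show ?case using subgroup.one_closed[OF commutators_subgroup] by simp
next
  case (insert S \<S>)
  have t: "tame \<phi> (S \<union> \<Union>\<S>)" using insert.prems(1) by simp
  have d: "S \<inter> \<Union>\<S> = {}" using insert.prems(2) insert.hyps(2) unfolding pairwise_insert disjnt_def by blast
  have "inf_prod \<phi> (\<Union>\<S>) \<in> commutators"
  proof (rule insert.IH)
    show "tame \<phi> (\<Union>\<S>)" using tame_subset[OF t] by blast
    show "disjoint \<S>" using insert.prems(2) unfolding pairwise_insert by blast
    show "inf_prod \<phi> S \<in> commutators" if "S \<in> \<S>" for S using insert.prems(3) that by blast
  qed
  moreover have "inf_prod \<phi> S \<in> commutators" using insert.prems(3) by blast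
  ultimately show ?case
    using inf_prod_union[OF t d] subgroup.m_closed[OF commutators_subgroup] by simp
qed

text \<open>Since \<open>\<phi>\<^sup>t\<^sup>k = (\<phi>\<^sup>t)\<^sup>k\<close>, the part of a gate lattice that belongs to a left coset \<open>t K\<close> is again a gate
  lattice, on \<open>K\<close> itself and for another gate.\<close>

lemma inf_prod_coset:
  assumes "\<phi> \<in> Bij X" "t \<in> carrier G" "K \<subseteq> carrier G" "tame (conj \<phi>) (t <# K)"
  shows "inf_prod (conj \<phi>) (t <# K) = lattice K (conj \<phi> t)" "tame (conj (conj \<phi> t)) K"
proof -
  have im: "t <# K = (\<lambda>k. t \<otimes> k) ` K" by (auto simp: l_coset_def)
  have inj: "inj_on (\<lambda>k. t \<otimes> k) K" using assms(2,3) by (auto simp: inj_on_def subset_iff)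
  have eq: "conj \<phi> (t \<otimes> k) = conj (conj \<phi> t) k" if "k \<in> K" for k
    using conj_conj[OF assms(1,2)] assms(3) that by (simp add: subset_iff)
  have finite_moves: "finite {k \<in> K. moves (conj (conj \<phi> t) k) h}" if h: "h \<in> carrier G" for h
  proof -
    have "(\<lambda>k. t \<otimes> k) ` {k \<in> K. moves (conj (conj \<phi> t) k) h} \<subseteq> {s \<in> t <# K. moves (conj \<phi> s) h}"
      using eq im by auto
    then have "finite ((\<lambda>k. t \<otimes> k) ` {k \<in> K. moves (conj (conj \<phi> t) k) h})"
      using tame_finite[OF assms(4) h] finite_subset by blast
    moreover have "inj_on (\<lambda>k. t \<otimes> k) {k \<in> K. moves (conj (conj \<phi> t) k) h}"
      using inj by (rule inj_on_subset) auto
    ultimately show ?thesis by (simp add: finite_image_iff)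
  qed
  have c: "Sym.commuting (conj \<phi>) ((\<lambda>k. t \<otimes> k) ` K)" using tame_commuting_self[OF assms(4)] unfolding im .
  show t: "tame (conj (conj \<phi> t)) K"
    unfolding tame_def
  proof (intro conjI ballI)
    show "Sym.commuting (conj (conj \<phi> t)) K"
      using c Sym.commuting_cong[of K "\<lambda>k. conj \<phi> (t \<otimes> k)" "conj (conj \<phi> t)", OF eq]
      unfolding Sym.commuting_image by blast
    show "\<exists>V. finite V \<and> V \<subseteq> carrier G \<and> conj (conj \<phi> t) k \<in> windowed V" if "k \<in> K" for k
    proof -
      have "t \<otimes> k \<in> t <# K" using that unfolding im by blast
      then show ?thesis using assms(4) unfolding tame_def eq[OF that, symmetric] by blast
    qed
  qed (rule finite_moves)
  have "inf_prod (conj \<phi>) (t <# K) = inf_prod (\<lambda>k. conj \<phi> (t \<otimes> k)) K"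
    using inf_prod_reindex[OF _ inj, of "conj \<phi>"] assms(4) unfolding im by simp
  also have "\<dots> = inf_prod (conj (conj \<phi> t)) K"
    by (rule inf_prod_cong[OF t, symmetric]) (simp add: eq)
  finally show "inf_prod (conj \<phi>) (t <# K) = lattice K (conj \<phi> t)" unfolding lattice_def .
qed

lemma separated_subset: "separated K V \<Longrightarrow> W \<subseteq> V \<Longrightarrow> separated K W"
  unfolding separated_def r_coset_def by blast

lemma separated_mono: "separated K V \<Longrightarrow> L \<subseteq> K \<Longrightarrow> separated L V"
  unfolding separated_def by blast

text \<open>Normality makes one subgroup sparse for all translates \<open>V t\<close> at once: if \<open>v t k = w t l\<close> then
  \<open>w\<^sup>-\<^sup>1 v\<close> is a conjugate of \<open>l k\<^sup>-\<^sup>1\<close>.\<close>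

lemma separated_avoid:
  assumes N: "N \<lhd> G" "N \<inter> (\<lambda>(v, w). inv w \<otimes> v) ` (V \<times> V) \<subseteq> {\<one>}"
    and V: "V \<subseteq> carrier G" and t: "t \<in> carrier G"
  shows "separated N (V #> t)"
  unfolding separated_def
proof (intro ballI impI)
  have sN: "subgroup N G" using N(1) normal_imp_subgroup by blast
  have NG: "N \<subseteq> carrier G" using subgroup.subset[OF sN] .
  fix k l assume k: "k \<in> N" and l: "l \<in> N" and ne: "k \<noteq> l"
  have kl: "k \<in> carrier G" "l \<in> carrier G" using k l NG by auto
  show "(V #> t #> k) \<inter> (V #> t #> l) = {}"
  proof (rule ccontr)
    assume "(V #> t #> k) \<inter> (V #> t #> l) \<noteq> {}"
    then obtain v w where vw: "v \<in> V" "w \<in> V" "v \<otimes> t \<otimes> k = w \<otimes> t \<otimes> l"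
      unfolding r_coset_def by blast
    have vwG: "v \<in> carrier G" "w \<in> carrier G" using vw V by auto
    have "v = (v \<otimes> t \<otimes> k) \<otimes> inv k \<otimes> inv t" using vwG kl t by (simp add: m_assoc)
    then have "v = w \<otimes> t \<otimes> l \<otimes> inv k \<otimes> inv t" unfolding vw(3) .
    then have "inv w \<otimes> v = inv w \<otimes> (w \<otimes> (t \<otimes> (l \<otimes> inv k) \<otimes> inv t))"
      using vwG kl t by (simp add: m_assoc)
    then have eq: "inv w \<otimes> v = t \<otimes> (l \<otimes> inv k) \<otimes> inv t"
      using vwG kl t by (simp add: m_assoc[symmetric])
    have "l \<otimes> inv k \<in> N" using k l sN by (simp add: subgroup.m_closed subgroup.m_inv_closed)
    then have "inv w \<otimes> v \<in> N" unfolding eq using N(1) t unfolding normal_inv_iff by blast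
    then have "inv w \<otimes> v = \<one>" using N(2) vw(1,2) by fast
    then have "w \<otimes> (inv w \<otimes> v) = w" using vwG by simp
    then have "v = w" using vwG by (simp add: m_assoc[symmetric])
    then have "t \<otimes> k = t \<otimes> l" using vw(3) vwG kl t by (simp add: m_assoc)
    then show False using ne kl t by simp
  qed
qed

end

context glued_shift
begin

text \<open>The gate lattice over \<open>H g = g (g\<^sup>-\<^sup>1 H g)\<close> splits along the left cosets \<open>t K\<close> of any \<open>K\<close> of finite index in
  \<open>g\<^sup>-\<^sup>1 H g\<close>. When \<open>K\<close> is sparse, each part is a product of lattices of swap gates, by decomposing the
  gate.\<close>

lemma perfect_criterion:
  assumes crit: "\<And>U H. finite U \<Longrightarrow> U \<subseteq> carrier G \<Longrightarrow> finite_index G H \<Longrightarrow>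
    \<exists>W K. finite W \<and> W \<subseteq> carrier G \<and> padded U \<subseteq> W \<and> finite_index G K \<and> K \<subseteq> H \<and>
      (\<forall>t\<in>carrier G. separated K (W #> t) \<and>
         (\<forall>p q. swappable W p q \<longrightarrow> lattice K (conj (swap W p q) t) \<in> commutators))"
  shows "lattice_group = commutators"
proof
  show "commutators \<subseteq> lattice_group" using Sym.derived_incl[OF subset_refl lattice_subgroup] .
  have "gate_lattices G A X \<subseteq> commutators"
  proof
    fix f assume "f \<in> gate_lattices G A X"
    then obtain \<phi> U H g where f: "\<phi> \<in> windowed U" "finite U" "U \<subseteq> carrier G" "finite_index G H" "g \<in> carrier G"
      "tame (conj \<phi>) (H #> g)" "f = inf_prod (conj \<phi>) (H #> g)"
      by (rule gate_latticesE)
    have HG: "H \<subseteq> carrier G" using f(4) finite_index_subset by blast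
    have SG: "H #> g \<subseteq> carrier G" using r_coset_subset_G[OF HG f(5)] .
    have \<phi>B: "\<phi> \<in> Bij X" using f(1) windowed_Bij by blast
    obtain W K where W: "finite W" "W \<subseteq> carrier G" "padded U \<subseteq> W"
      and K: "finite_index G K" "K \<subseteq> inv g <# (H #> g)"
      and WK: "\<And>t. t \<in> carrier G \<Longrightarrow> separated K (W #> t)"
        "\<And>t p q. t \<in> carrier G \<Longrightarrow> swappable W p q \<Longrightarrow> lattice K (conj (swap W p q) t) \<in> commutators"
      using crit[OF f(2,3) finite_index_conjugate[OF f(4,5)]] by blast
    have KG: "K \<subseteq> carrier G" and sK: "subgroup K G" using K(1) finite_index_subset finite_index_subgroup by auto
    obtain ss where ss: "\<And>p q. (p, q) \<in> set ss \<Longrightarrow> swappable W p q" "\<phi> = gate_product (\<lambda>(p, q). swap W p q) ss"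
      using windowed_as_swaps[OF f(1) W(3,1,2)] by blast
    have lat: "lattice K (conj \<phi> t) \<in> commutators" if t: "t \<in> carrier G" for t
      unfolding ss(2) using ss(1)
    proof (induction ss)
      case Nil
      have Wt: "finite (W #> t)" "W #> t \<subseteq> carrier G" using W t r_coset_subset_G by (auto simp: r_coset_def)
      show ?case using lattice_derived[OF WK(1)[OF t] K(1) Wt one_in_derived] conj_one[OF t] by simp
    next
      case (Cons s ss)
      obtain p q where s: "s = (p, q)" by fastforce
      let ?P = "gate_product (\<lambda>(p, q). swap W p q) ss"
      have sw: "swappable W p q" using Cons.prems s by simp
      have Wt: "finite (W #> t)" "W #> t \<subseteq> carrier G" using W t r_coset_subset_G by (auto simp: r_coset_def)
      have w: "swap W p q \<in> windowed W" "?P \<in> windowed W"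
        using Cons.prems sw swap_windowed[OF _ W(2)] by (auto intro!: gate_product_windowed)
      have "lattice K (conj (swap W p q \<star> ?P) t) = lattice K (conj (swap W p q) t) \<star> lattice K (conj ?P t)"
        using lattice_mult[OF WK(1)[OF t] KG Wt windowed_conj[OF w(1) t W(2)] windowed_conj[OF w(2) t W(2)]]
          conj_mult[OF windowed_Bij[OF w(1)] windowed_Bij[OF w(2)] t] by simp
      moreover have "lattice K (conj ?P t) \<in> commutators" using Cons by simp
      ultimately show ?case
        using WK(2)[OF t sw] subgroup.m_closed[OF commutators_subgroup] s by simp
    qed
    let ?\<S> = "(\<lambda>t. t <# K) ` (H #> g)"
    have coset_sub: "t <# K \<subseteq> H #> g" if tS: "t \<in> H #> g" for t
    proof
      fix x assume "x \<in> t <# K"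
      then obtain k where k: "k \<in> K" "x = t \<otimes> k" unfolding l_coset_def by blast
      obtain h h' where h: "h \<in> H" "t = h \<otimes> g" "h' \<in> H" "k = inv g \<otimes> (h' \<otimes> g)"
        using tS k(1) K(2) unfolding l_coset_def r_coset_def by blast
      have hG: "h \<in> carrier G" "h' \<in> carrier G" using h HG by auto
      have "x = h \<otimes> (g \<otimes> inv g) \<otimes> (h' \<otimes> g)"
        unfolding k(2) h(2,4) using hG f(5) by (simp only: m_assoc m_closed inv_closed)
      also have "\<dots> = h \<otimes> h' \<otimes> g" using hG f(5) by (simp add: m_assoc)
      finally show "x \<in> H #> g"
        using subgroup.m_closed[OF finite_index_subgroup[OF f(4)] h(1,3)] unfolding r_coset_def by blast
    qed
    have "t \<in> t <# K" if "t \<in> H #> g" for t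
      using that SG subgroup.one_closed[OF sK] unfolding l_coset_def by force
    then have un: "\<Union>?\<S> = H #> g" using coset_sub by blast
    have "inf_prod (conj \<phi>) (\<Union>?\<S>) \<in> commutators"
    proof (rule inf_prod_Union_in)
      show "finite ?\<S>" using finite_l_cosets[OF K(1)] SG by (meson finite_subset image_mono)
      show "tame (conj \<phi>) (\<Union>?\<S>)" unfolding un by (rule f(6))
      show "disjoint ?\<S>"
        by (rule l_cosets_family_disjoint[OF sK SG])
      fix S assume "S \<in> ?\<S>"
      then obtain t where t: "t \<in> H #> g" "S = t <# K" by blast
      then have tG: "t \<in> carrier G" using SG by blast
      show "inf_prod (conj \<phi>) S \<in> commutators"
        using inf_prod_coset(1)[OF \<phi>B tG KG] tame_subset[OF f(6) coset_sub[OF t(1)]] lat[OF tG] t(2) by simp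
    qed
    then show "f \<in> commutators" unfolding un f(7) .
  qed
  then show "lattice_group \<subseteq> commutators"
    unfolding gate_lattice_group_def[of G A X] using Sym.generate_subgroup_incl[OF _ commutators_subgroup]
    unfolding gate_lattice_group_def by blast
qed

lemma trivial_swap: "restrict p W = restrict q W \<Longrightarrow> W \<subseteq> carrier G \<Longrightarrow> swap W p q = gate_one"
  unfolding swap_def by (simp add: pattern_gate_one)

end

lemma even_card_if_even_classes:
  assumes "\<And>z. z \<in> S \<Longrightarrow> even (card {y \<in> S. r y = r z})"
  shows "even (card S)"
proof (cases "finite S")
  case True
  have "card S = (\<Sum>c\<in>r ` S. card {y \<in> S. r y = c})"
    using card_eq_sum[of S] sum.image_gen[OF True, of "\<lambda>_. 1" r] by (simp only: card_eq_sum)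
  moreover have "even (\<Sum>c\<in>r ` S. card {y \<in> S. r y = c})"
    by (rule dvd_sum) (use assms in auto)
  ultimately show ?thesis by simp
qed simp

lemma (in group) finite_r_coset: "finite V \<Longrightarrow> finite (V #> g)"
  by (simp add: r_coset_def)

context shift_space
begin

section \<open>Pairing cosets\<close>

lemma inf_prod_even_Union_in:
  assumes "finite \<S>" "even (card \<S>)" "tame \<phi> (\<Union>\<S>)" "disjoint \<S>"
    "\<And>S T. S \<in> \<S> \<Longrightarrow> T \<in> \<S> \<Longrightarrow> S \<noteq> T \<Longrightarrow> inf_prod \<phi> (S \<union> T) \<in> commutators"
  shows "inf_prod \<phi> (\<Union>\<S>) \<in> commutators"
  using assms
proof (induction "card \<S>" arbitrary: \<S> rule: less_induct)
  case less
  show ?case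
  proof (cases "\<S> = {}")
    case True
    then show ?thesis using inf_prod_Union_in[of "{}" \<phi>] less.prems(3) by simp
  next
    case False
    then obtain S where S: "S \<in> \<S>" by blast
    have "card \<S> \<noteq> 1" using less.prems(2) by auto
    then have "\<S> \<noteq> {S}" by auto
    then obtain T where T: "T \<in> \<S>" "S \<noteq> T" using S by blast
    let ?R = "\<S> - {S, T}"
    have "{S, T} \<subseteq> \<S>" "card {S, T} = 2" using S T by auto
    then have "card \<S> = card ?R + 2"
      using card_Diff_subset[of "{S, T}" \<S>] card_mono[OF less.prems(1), of "{S, T}"] by simp
    then have R: "card ?R < card \<S>" "even (card ?R)" using less.prems(2) by auto
    have un: "\<Union>\<S> = (S \<union> T) \<union> \<Union>?R" using S T by blast
    have "inf_prod \<phi> (\<Union>?R) \<in> commutators"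
    proof (rule less.hyps[OF R(1) _ R(2)])
      show "finite ?R" using less.prems(1) by simp
      show "tame \<phi> (\<Union>?R)" by (rule tame_subset[OF less.prems(3)]) blast
      show "disjoint ?R" using less.prems(4) by (rule pairwise_subset) blast
      show "inf_prod \<phi> (C \<union> D) \<in> commutators" if "C \<in> ?R" "D \<in> ?R" "C \<noteq> D" for C D
        using less.prems(5) that by (metis DiffD1)
    qed
    moreover have "inf_prod \<phi> (S \<union> T) \<in> commutators" using less.prems(5) S T by blast
    moreover have "(S \<union> T) \<inter> \<Union>?R = {}"
    proof -
      have "C \<inter> D = {}" if "C \<in> {S, T}" "D \<in> ?R" for C D
        using less.prems(4) S T(1) that unfolding pairwise_def disjnt_def by (metis DiffE insertE singletonD)
      then show ?thesis by blast
    qed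
    ultimately show ?thesis
      using inf_prod_union[of \<phi> "S \<union> T" "\<Union>?R"] less.prems(3) subgroup.m_closed[OF commutators_subgroup]
      unfolding un by simp
  qed
qed

text \<open>The two parts of the gate lattice are lattices on the same subgroup \<open>L\<close>, so their product is the
  lattice of the product of the two gates.\<close>

lemma inf_prod_coset_pair:
  assumes "\<phi> \<in> Bij X" "finite_index G L" "s \<in> carrier G" "t \<in> carrier G"
    and tame: "tame (conj \<phi>) ((s <# L) \<union> (t <# L))" and disj: "(s <# L) \<inter> (t <# L) = {}"
    and V: "finite V" "V \<subseteq> carrier G" "separated L V" "conj \<phi> s \<in> windowed V" "conj \<phi> t \<in> windowed V"
    and der: "conj \<phi> s \<star> conj \<phi> t \<in> derived (BijGroup X) (windowed V)"
  shows "inf_prod (conj \<phi>) ((s <# L) \<union> (t <# L)) \<in> commutators"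
proof -
  have LG: "L \<subseteq> carrier G" using assms(2) finite_index_subset by blast
  have "inf_prod (conj \<phi>) ((s <# L) \<union> (t <# L)) = inf_prod (conj \<phi>) (s <# L) \<star> inf_prod (conj \<phi>) (t <# L)"
    by (rule inf_prod_union[OF tame disj])
  also have "\<dots> = lattice L (conj \<phi> s) \<star> lattice L (conj \<phi> t)"
    using inf_prod_coset(1)[OF assms(1,3) LG] inf_prod_coset(1)[OF assms(1,4) LG]
      tame_subset[OF tame, of "s <# L"] tame_subset[OF tame, of "t <# L"] by simp
  also have "\<dots> = lattice L (conj \<phi> s \<star> conj \<phi> t)"
    by (rule lattice_mult[OF V(3) LG V(1,2,4,5), symmetric])
  finally show ?thesis using lattice_derived[OF V(3) assms(2) V(1,2) der] by simp
qed

end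

context glued_shift
begin

section \<open>An even number of fillings\<close>

lemma even_fillings_translate:
  assumes F: "F \<subseteq> carrier G" and even: "\<And>x. x \<in> X \<Longrightarrow> even (card {z \<in> X. \<forall>h\<in>carrier G - F. z h = x h})"
    and g: "g \<in> carrier G" and x: "x \<in> X"
  shows "even (card {z \<in> X. \<forall>h\<in>carrier G - (F #> g). z h = x h})"
proof -
  let ?S = "{z \<in> X. \<forall>h\<in>carrier G - (F #> g). z h = x h}"
  let ?T = "{z \<in> X. \<forall>h\<in>carrier G - F. z h = shift G g x h}"
  have mem: "h \<otimes> g \<in> F #> g \<longleftrightarrow> h \<in> F" if "h \<in> carrier G" for h
    using r_coset_mem[of "h \<otimes> g" g F] that g F by (simp add: m_assoc)
  have "bij_betw (shift G g) ?S ?T"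
  proof (rule bij_betw_byWitness[where f' = "shift G (inv g)"])
    show "\<forall>z\<in>?S. shift G (inv g) (shift G g z) = z" "\<forall>z\<in>?T. shift G g (shift G (inv g) z) = z"
      using shift_inv_X[OF g] by auto
    show "shift G g ` ?S \<subseteq> ?T" using shift_in_X g mem by auto
    show "shift G (inv g) ` ?T \<subseteq> ?S"
    proof
      fix y assume "y \<in> shift G (inv g) ` ?T"
      then obtain z where z: "z \<in> ?T" "y = shift G (inv g) z" by blast
      have "y h = x h" if h: "h \<in> carrier G - (F #> g)" for h
      proof -
        have "h \<otimes> inv g \<in> carrier G - F" using h g r_coset_mem[of h g F] F by simp
        then have "z (h \<otimes> inv g) = shift G g x (h \<otimes> inv g)" using z(1) by blast
        then show ?thesis using z(2) h g by (simp add: m_assoc)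
      qed
      then show "y \<in> ?S" using z g shift_in_X by simp
    qed
  qed
  then have "card ?S = card ?T" by (rule bij_betw_same_card)
  then show ?thesis using even[OF shift_in_X[OF x g]] by simp
qed

text \<open>The fillings of \<open>V\<close> fall into classes of points that agree outside \<open>F\<close>. As \<open>F\<close> avoids both \<open>W\<close> and the
  boundary of \<open>V\<close>, each class consists of all fillings of \<open>F\<close> in a fixed surrounding.\<close>

lemma swap_derived_even_fillings:
  assumes W: "W \<subseteq> V" "F \<inter> W = {}" and V: "finite V" "V \<subseteq> carrier G" "padded F \<subseteq> V"
    and even: "\<And>x. x \<in> X \<Longrightarrow> even (card {z \<in> X. \<forall>h\<in>carrier G - F. z h = x h})"
    and sw: "swappable W p q"
  shows "swap W p q \<in> derived (BijGroup X) (windowed V)"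
proof (cases "restrict p W = restrict q W")
  case True
  then show ?thesis using trivial_swap W V one_in_derived by (metis subset_trans)
next
  case False
  have FV: "F \<subseteq> V" using V(3) unfolding padded_def by blast
  have "even (card (fillings V x W p))" if x: "x \<in> X" for x
  proof (rule even_card_if_even_classes[where r = "\<lambda>z. restrict z (carrier G - F)"])
    fix z assume z: "z \<in> fillings V x W p"
    have "{y \<in> fillings V x W p. restrict y (carrier G - F) = restrict z (carrier G - F)} =
        {y \<in> X. \<forall>h\<in>carrier G - F. y h = z h}" (is "?L = ?R")
    proof
      show "?L \<subseteq> ?R" unfolding restrict_eq_iff fillings_def by blast
      show "?R \<subseteq> ?L"
      proof
        fix y assume y: "y \<in> ?R"
        have "y h = x h" if h: "h \<in> carrier G" "h \<notin> V \<or> h \<in> bd V" for h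
        proof -
          have "h \<notin> F" using h padded_bd[OF V(3)] FV by blast
          then have "y h = z h" using y h(1) by blast
          then show ?thesis using z h unfolding fillings_def by simp
        qed
        moreover have "y h = p h" if h: "h \<in> W" for h
        proof -
          have "h \<in> carrier G - F" using h W V(2) by blast
          then have "y h = z h" using y by blast
          then show ?thesis using z h unfolding fillings_def by simp
        qed
        ultimately show "y \<in> ?L" using y unfolding restrict_eq_iff fillings_def by blast
      qed
    qed
    moreover have "z \<in> X" using z unfolding fillings_def by blast
    ultimately show "even (card {y \<in> fillings V x W p. restrict y (carrier G - F) = restrict z (carrier G - F)})"
      using even by simp
  qed
  moreover have "swap W p q = gate_product (\<lambda>(W, p, q). swap W p q) [(W, p, q)]"
    using swap_windowed[OF sw] W(1) V(2) windowed_Bij by (metis (no_types, lifting) Sym.r_one case_prod_conv comp_apply foldr_Cons foldr_Nil id_apply subset_trans)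
  ultimately show ?thesis
    using swaps_in_derived[OF V(1,2), of "[(W, p, q)]"] sw W(1) False by simp
qed

lemma even_fillings_points:
  assumes "even_fillings G A X"
  shows "\<exists>F. finite F \<and> F \<subseteq> carrier G \<and> (\<forall>x\<in>X. even (card {z \<in> X. \<forall>h\<in>carrier G - F. z h = x h}))"
proof -
  obtain F where F: "finite F" "F \<subseteq> carrier G"
    "\<And>x. x \<in> X \<Longrightarrow> even (card {z \<in> F \<rightarrow>\<^sub>E A. merge (carrier G - F) F (restrict x (carrier G - F), z) \<in> X})"
    using assms unfolding even_fillings_def by blast
  have "even (card {z \<in> X. \<forall>h\<in>carrier G - F. z h = x h})" if x: "x \<in> X" for x
  proof -
    let ?m = "\<lambda>z. merge (carrier G - F) F (restrict x (carrier G - F), z)"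
    have m: "?m z h = (if h \<in> F then z h else if h \<in> carrier G then x h else undefined)" for z h
      using F(2) by (auto simp: merge_def)
    have "bij_betw ?m {z \<in> F \<rightarrow>\<^sub>E A. ?m z \<in> X} {z \<in> X. \<forall>h\<in>carrier G - F. z h = x h}"
    proof (rule bij_betw_byWitness[where f' = "\<lambda>z. restrict z F"])
      show "\<forall>z\<in>{z \<in> F \<rightarrow>\<^sub>E A. ?m z \<in> X}. restrict (?m z) F = z"
        by (auto simp: fun_eq_iff m PiE_iff extensional_def)
      have recover: "?m (restrict z F) = z" if "z \<in> X" "\<forall>h\<in>carrier G - F. z h = x h" for z
      proof
        fix h
        have "z \<in> carrier G \<rightarrow>\<^sub>E A" using that(1) X_full by blast
        then show "?m (restrict z F) h = z h" using that(2) m by (auto simp: PiE_iff extensional_def)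
      qed
      then show "\<forall>z\<in>{z \<in> X. \<forall>h\<in>carrier G - F. z h = x h}. ?m (restrict z F) = z" by blast
      show "?m ` {z \<in> F \<rightarrow>\<^sub>E A. ?m z \<in> X} \<subseteq> {z \<in> X. \<forall>h\<in>carrier G - F. z h = x h}"
        using m by auto
      show "(\<lambda>z. restrict z F) ` {z \<in> X. \<forall>h\<in>carrier G - F. z h = x h} \<subseteq> {z \<in> F \<rightarrow>\<^sub>E A. ?m z \<in> X}"
      proof
        fix a assume "a \<in> (\<lambda>z. restrict z F) ` {z \<in> X. \<forall>h\<in>carrier G - F. z h = x h}"
        then obtain z where z: "z \<in> X" "\<forall>h\<in>carrier G - F. z h = x h" "a = restrict z F" by blast
        have "z h \<in> A" if "h \<in> F" for h using PiE_mem[OF subsetD[OF X_full z(1)], of h] that F(2) by blast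
        then have "restrict z F \<in> F \<rightarrow>\<^sub>E A" by (simp add: restrict_PiE_iff)
        then show "a \<in> {z \<in> F \<rightarrow>\<^sub>E A. ?m z \<in> X}" unfolding z(3) mem_Collect_eq recover[OF z(1,2)] using z(1) by blast
      qed
    qed
    then have "card {z \<in> F \<rightarrow>\<^sub>E A. ?m z \<in> X} = card {z \<in> X. \<forall>h\<in>carrier G - F. z h = x h}"
      by (rule bij_betw_same_card)
    then show ?thesis using F(3)[OF x] by simp
  qed
  then show ?thesis using F by blast
qed

text \<open>As the group is infinite, some translate of the set with an even number of fillings is
  disjoint from the window of the swap gates.\<close>

lemma perfect_even_fillings:
  assumes rf: "residually_finite G" and inf: "infinite (carrier G)" and ef: "even_fillings G A X"
  shows "lattice_group = commutators"
proof (rule perfect_criterion)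
  fix U H assume U: "finite U" "U \<subseteq> carrier G" and H: "finite_index G H"
  obtain F where F: "finite F" "F \<subseteq> carrier G"
    "\<And>x. x \<in> X \<Longrightarrow> even (card {z \<in> X. \<forall>h\<in>carrier G - F. z h = x h})"
    using even_fillings_points[OF ef] by blast
  define W where "W = padded U"
  have W: "finite W" "W \<subseteq> carrier G" unfolding W_def using padded_finite[OF U] by auto
  have "finite ((\<lambda>(f, w). inv f \<otimes> w) ` (F \<times> W))" using F(1) W(1) by blast
  then obtain g where g: "g \<in> carrier G" "g \<notin> (\<lambda>(f, w). inv f \<otimes> w) ` (F \<times> W)"
    using Diff_infinite_finite[OF _ inf] by (metis DiffE finite.emptyI all_not_in_conv)
  have FG: "F #> g \<subseteq> carrier G" "finite (F #> g)" using F g(1) r_coset_subset_G by (auto simp: r_coset_def)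
  have disj: "(F #> g) \<inter> W = {}"
  proof (rule ccontr)
    assume "(F #> g) \<inter> W \<noteq> {}"
    then obtain f where f: "f \<in> F" "f \<otimes> g \<in> W" unfolding r_coset_def by blast
    then have "g = inv f \<otimes> (f \<otimes> g)" using F(2) g(1) by (simp add: m_assoc[symmetric] subset_iff)
    then show False using g(2) f by (metis (no_types, lifting) SigmaI case_prod_conv image_eqI)
  qed
  define V where "V = W \<union> padded (F #> g)"
  have V: "finite V" "V \<subseteq> carrier G" "padded (F #> g) \<subseteq> V" "W \<subseteq> V"
    unfolding V_def using W padded_finite[OF FG(2,1)] by auto
  have "finite ((\<lambda>(v, w). inv w \<otimes> v) ` (V \<times> V))" "(\<lambda>(v, w). inv w \<otimes> v) ` (V \<times> V) \<subseteq> carrier G"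
    using V(1,2) by auto
  then obtain N where N: "N \<lhd> G" "finite_index G N" "N \<inter> (\<lambda>(v, w). inv w \<otimes> v) ` (V \<times> V) \<subseteq> {\<one>}"
    using residually_finite_avoid[OF rf] by meson
  have K: "finite_index G (H \<inter> N)" using finite_index_Int[OF H N(2)] .
  have sep: "separated (H \<inter> N) (V #> t)" if "t \<in> carrier G" for t
    using separated_mono[OF separated_avoid[OF N(1,3) V(2) that]] by blast
  have "separated (H \<inter> N) (W #> t) \<and> (\<forall>p q. swappable W p q \<longrightarrow> lattice (H \<inter> N) (conj (swap W p q) t) \<in> commutators)"
    if t: "t \<in> carrier G" for t
  proof (intro conjI allI impI)
    have "W #> t \<subseteq> V #> t" using V(4) unfolding r_coset_def by blast
    then show "separated (H \<inter> N) (W #> t)" using separated_subset[OF sep[OF t]] by blast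
    fix p q assume sw: "swappable W p q"
    have "swap W p q \<in> derived (BijGroup X) (windowed V)"
      using even_fillings_translate[OF F(2,3) g(1)]
      by (intro swap_derived_even_fillings[OF V(4) disj V(1-3) _ sw]) blast
    then have "conj (swap W p q) t \<in> derived (BijGroup X) (windowed (V #> t))"
      using derived_conj t V(2) by blast
    then show "lattice (H \<inter> N) (conj (swap W p q) t) \<in> commutators"
      using lattice_derived[OF sep[OF t] K] V(1,2) t r_coset_subset_G[OF V(2) t] by (simp add: r_coset_def)
  qed
  then show "\<exists>W K. finite W \<and> W \<subseteq> carrier G \<and> padded U \<subseteq> W \<and> finite_index G K \<and> K \<subseteq> H \<and>
      (\<forall>t\<in>carrier G. separated K (W #> t) \<and>
         (\<forall>p q. swappable W p q \<longrightarrow> lattice K (conj (swap W p q) t) \<in> commutators))"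
    using W K unfolding W_def by (intro exI[of _ "padded U"] exI[of _ "H \<inter> N"]) auto
qed

section \<open>Full shifts over groups with halvable subgroups\<close>

text \<open>With \<open>B\<close> empty there are no boundaries, and the cells of \<open>V\<close> outside \<open>W\<close> can be filled
  arbitrarily.\<close>

lemma full_fillings_card:
  assumes "X = full_shift G A" "B = {}" "x \<in> X" "p \<in> X" "finite V" "W \<subseteq> V" "V \<subseteq> carrier G"
  shows "card (fillings V x W p) = card A ^ card (V - W)"
proof -
  have bd: "bd V = {}" unfolding boundary_def assms(2) by (simp add: r_coset_def)
  have full: "y \<in> X \<longleftrightarrow> y \<in> carrier G \<rightarrow>\<^sub>E A" for y unfolding assms(1) full_shift_def ..
  let ?f = "\<lambda>a. \<lambda>h\<in>carrier G. if h \<in> W then p h else if h \<in> V then a h else x h"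
  have "bij_betw ?f ((V - W) \<rightarrow>\<^sub>E A) (fillings V x W p)"
  proof (rule bij_betw_byWitness[where f' = "\<lambda>z. restrict z (V - W)"])
    show "\<forall>a\<in>(V - W) \<rightarrow>\<^sub>E A. restrict (?f a) (V - W) = a"
      using assms(7) by (auto simp: fun_eq_iff PiE_iff extensional_def)
    show "\<forall>z\<in>fillings V x W p. ?f (restrict z (V - W)) = z"
      unfolding fillings_def bd full by (auto simp: fun_eq_iff PiE_iff extensional_def)
    show "?f ` ((V - W) \<rightarrow>\<^sub>E A) \<subseteq> fillings V x W p"
      using assms(3,4,6,7) unfolding fillings_def bd full by (auto simp: PiE_iff)
    show "(\<lambda>z. restrict z (V - W)) ` fillings V x W p \<subseteq> (V - W) \<rightarrow>\<^sub>E A"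
    proof (rule image_subsetI)
      fix z assume "z \<in> fillings V x W p"
      then have z: "z \<in> carrier G \<rightarrow>\<^sub>E A" unfolding fillings_def full by blast
      have "z h \<in> A" if "h \<in> V - W" for h using PiE_mem[OF z, of h] that assms(7) by blast
      then show "restrict z (V - W) \<in> (V - W) \<rightarrow>\<^sub>E A" by (simp add: restrict_PiE_iff)
    qed
  qed
  then have "card (fillings V x W p) = card ((V - W) \<rightarrow>\<^sub>E A)" by (rule bij_betw_same_card[symmetric])
  also have "\<dots> = card A ^ card (V - W)" using assms(5) by (simp add: card_PiE)
  finally show ?thesis .
qed

lemma card_r_coset: "V \<subseteq> carrier G \<Longrightarrow> g \<in> carrier G \<Longrightarrow> card (V #> g) = card V"
proof -
  assume V: "V \<subseteq> carrier G" "g \<in> carrier G"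
  have "V #> g = (\<lambda>v. v \<otimes> g) ` V" unfolding r_coset_def by blast
  moreover have "inj_on (\<lambda>v. v \<otimes> g) V" using V by (auto simp: inj_on_def subset_iff)
  ultimately show ?thesis by (simp add: card_image)
qed

text \<open>For the two factors together the parity condition can hold although it fails for each of them;
  this is what the pairing of cosets exploits.\<close>

lemma swap_pair_in_derived:
  assumes V: "finite V" "V \<subseteq> carrier G" and W: "W \<subseteq> carrier G" "g \<in> carrier G" "W \<subseteq> V" "W #> g \<subseteq> V"
    and sw: "swappable W p q"
    and parity: "\<And>x. x \<in> X \<Longrightarrow>
       even (card (fillings V x W p) + card (fillings V x (W #> g) (shift G (inv g) p)))"
  shows "swap W p q \<star> conj (swap W p q) g \<in> derived (BijGroup X) (windowed V)"
proof -
  have c: "conj (swap W p q) g = swap (W #> g) (shift G (inv g) p) (shift G (inv g) q)"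
    by (rule conj_swap[OF sw W(1,2)])
  have sw': "swappable (W #> g) (shift G (inv g) p) (shift G (inv g) q)" by (rule swappable_shift[OF sw W(1,2)])
  have B: "swap (W #> g) (shift G (inv g) p) (shift G (inv g) q) \<in> Bij X"
    using swap_windowed[OF sw'] V(2) W(4) windowed_Bij by blast
  show ?thesis
  proof (cases "restrict p W = restrict q W")
    case True
    then have "swap W p q = gate_one" using trivial_swap W(1) by blast
    then show ?thesis using conj_one[OF W(2)] one_in_derived by simp
  next
    case False
    have ne': "restrict (shift G (inv g) p) (W #> g) \<noteq> restrict (shift G (inv g) q) (W #> g)"
      using False restrict_shift_iff[OF W(2,1), of "shift G (inv g) p" q] shift_inv_X(1)[OF W(2)] sw
      unfolding swappable_def by simp
    have "gate_product (\<lambda>(W, p, q). swap W p q) [(W, p, q), (W #> g, shift G (inv g) p, shift G (inv g) q)]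
        \<in> derived (BijGroup X) (windowed V)"
    proof (rule swaps_in_derived[OF V])
      fix W' p' q' assume "(W', p', q') \<in> set [(W, p, q), (W #> g, shift G (inv g) p, shift G (inv g) q)]"
      then consider "W' = W" "p' = p" "q' = q" | "W' = W #> g" "p' = shift G (inv g) p" "q' = shift G (inv g) q"
        by auto
      then show "swappable W' p' q' \<and> W' \<subseteq> V \<and> restrict p' W' \<noteq> restrict q' W'"
        using sw sw' W False ne' by cases blast+
    qed (use parity in simp)
    then show ?thesis unfolding c using B by simp
  qed
qed

text \<open>The left cosets of a subgroup \<open>L\<close> of even index in a sparse subgroup \<open>K\<close> are grouped in pairs \<open>k L\<close>, \<open>l L\<close>. The
  window of such a pair is \<open>W t k \<union> W t l\<close>, for which \<open>L\<close> is sparse since \<open>K\<close> is sparse for \<open>W t\<close>.\<close>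

lemma perfect_full_shift:
  assumes rf: "residually_finite G" and full: "X = full_shift G A" "B = {}"
    and half: "halvable_finite_index_subgroups G"
  shows "lattice_group = commutators"
proof (rule perfect_criterion)
  fix U H assume U: "finite U" "U \<subseteq> carrier G" and H: "finite_index G H"
  define W where "W = padded U"
  have W: "finite W" "W \<subseteq> carrier G" unfolding W_def using padded_finite[OF U] by auto
  have "finite ((\<lambda>(v, w). inv w \<otimes> v) ` (W \<times> W))" "(\<lambda>(v, w). inv w \<otimes> v) ` (W \<times> W) \<subseteq> carrier G"
    using W by auto
  then obtain N where N: "N \<lhd> G" "finite_index G N" "N \<inter> (\<lambda>(v, w). inv w \<otimes> v) ` (W \<times> W) \<subseteq> {\<one>}"
    using residually_finite_avoid[OF rf] by meson
  define K where "K = H \<inter> N"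
  have K: "finite_index G K" unfolding K_def using finite_index_Int[OF H N(2)] .
  have KG: "K \<subseteq> carrier G" and sK: "subgroup K G" using K finite_index_subset finite_index_subgroup by auto
  have sep: "separated K (W #> t)" if "t \<in> carrier G" for t
    using separated_mono[OF separated_avoid[OF N(1,3) W(2) that]] unfolding K_def by blast
  obtain L where L: "finite_index (G\<lparr>carrier := K\<rparr>) L" "even (card (rcosets\<^bsub>G\<lparr>carrier := K\<rparr>\<^esub> L))"
    using half K unfolding halvable_finite_index_subgroups_def by blast
  have LG: "finite_index G L" using finite_index_trans[OF K L(1)] .
  have sL: "subgroup L G" using LG finite_index_subgroup by blast
  have LK: "L \<subseteq> K" using L(1) subgroup.subset unfolding finite_index_def by fastforce
  let ?\<S> = "(\<lambda>k. k <# L) ` K"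
  have rc: "rcosets\<^bsub>G\<lparr>carrier := K\<rparr>\<^esub> L = (\<lambda>k. L #> k) ` K" unfolding RCOSETS_def r_coset_def by auto
  have "?\<S> = (\<lambda>C. (\<lambda>x. inv x) ` C) ` ((\<lambda>k. L #> k) ` K)"
  proof -
    have inK: "inv k \<in> K" if "k \<in> K" for k using subgroup.m_inv_closed[OF sK that] .
    have 1: "k <# L = (\<lambda>x. inv x) ` (L #> inv k)" if "k \<in> K" for k
      using l_coset_as_inv[OF sL subsetD[OF KG that]] .
    have 2: "(\<lambda>x. inv x) ` (L #> k) = inv k <# L" if "k \<in> K" for k
      using 1[OF inK[OF that]] subsetD[OF KG that] by simp
    show ?thesis
    proof
      show "?\<S> \<subseteq> (\<lambda>C. (\<lambda>x. inv x) ` C) ` ((\<lambda>k. L #> k) ` K)"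
        by (rule image_subsetI, subst 1) (use inK in blast)+
      show "(\<lambda>C. (\<lambda>x. inv x) ` C) ` ((\<lambda>k. L #> k) ` K) \<subseteq> ?\<S>"
        unfolding image_image by (rule image_subsetI, subst 2) (use inK in blast)+
    qed
  qed
  moreover have "inj_on (\<lambda>C. (\<lambda>x. inv x) ` C) ((\<lambda>k. L #> k) ` K)"
  proof (rule inj_on_inverseI[where g = "\<lambda>C. (\<lambda>x. inv x) ` C"])
    fix C assume "C \<in> (\<lambda>k. L #> k) ` K"
    then have "C \<subseteq> carrier G" using r_coset_subset_G[of L] LK KG by blast
    then show "(\<lambda>x. inv x) ` (\<lambda>x. inv x) ` C = C" by (force simp: image_iff subset_iff)
  qed
  ultimately have card: "card ?\<S> = card ((\<lambda>k. L #> k) ` K)" "finite ?\<S>"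
    using L(1) unfolding finite_index_def rc by (simp_all add: card_image)
  then have ev: "even (card ?\<S>)" using L(2) unfolding rc by simp
  have coset_sub: "k <# L \<subseteq> K" if "k \<in> K" for k
    using that LK subgroup.m_closed[OF sK] unfolding l_coset_def by blast
  have un: "\<Union>?\<S> = K"
  proof
    show "K \<subseteq> \<Union>?\<S>"
    proof
      fix k assume k: "k \<in> K"
      then have "k = k \<otimes> \<one>" using KG by auto
      then have "k \<in> k <# L" using subgroup.one_closed[OF sL] unfolding l_coset_def by blast
      then show "k \<in> \<Union>?\<S>" using k by blast
    qed
  qed (use coset_sub in blast)
  have "lattice K (conj (swap W p q) t) \<in> commutators" if t: "t \<in> carrier G" and sw: "swappable W p q" for t p q
  proof -
    define \<phi> where "\<phi> = conj (swap W p q) t"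
    let ?W = "W #> t"
    define p' q' where "p' = shift G (inv t) p" and "q' = shift G (inv t) q"
    have Wt: "finite ?W" "?W \<subseteq> carrier G" using W t r_coset_subset_G by (auto simp: r_coset_def)
    have \<phi>: "\<phi> = swap ?W p' q'" unfolding \<phi>_def p'_def q'_def by (rule conj_swap[OF sw W(2) t])
    have sw': "swappable ?W p' q'" unfolding p'_def q'_def by (rule swappable_shift[OF sw W(2) t])
    have w: "\<phi> \<in> windowed ?W" unfolding \<phi> by (rule swap_windowed[OF sw' Wt(2)])
    have B: "\<phi> \<in> Bij X" using w windowed_Bij by blast
    have tame: "tame (conj \<phi>) K" using separated_tame[OF sep[OF t] KG Wt w] .
    have "inf_prod (conj \<phi>) (\<Union>?\<S>) \<in> commutators"
    proof (rule inf_prod_even_Union_in[OF card(2) ev])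
      show "tame (conj \<phi>) (\<Union>?\<S>)" unfolding un by (rule tame)
      show "disjoint ?\<S>"
        by (rule l_cosets_family_disjoint[OF sL KG])
      fix C D assume "C \<in> ?\<S>" "D \<in> ?\<S>" and ne: "C \<noteq> D"
      then obtain k l where kl: "k \<in> K" "C = k <# L" "l \<in> K" "D = l <# L" by blast
      have klG: "k \<in> carrier G" "l \<in> carrier G" using kl KG by auto
      have disj: "C \<inter> D = {}" using l_cosets_disjoint[OF sL klG] ne kl by blast
      let ?V = "(?W #> k) \<union> (?W #> l)"
      have V: "finite ?V" "?V \<subseteq> carrier G"
        using finite_r_coset[OF Wt(1)] klG r_coset_subset_G[OF Wt(2)] by auto
      define g where "g = inv k \<otimes> l"
      have g: "g \<in> carrier G" "k \<otimes> g = l" unfolding g_def using klG by (simp_all add: m_assoc[symmetric])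
      have Wk: "?W #> k \<subseteq> carrier G" "?W #> l \<subseteq> carrier G" "(?W #> k) #> g = ?W #> l"
        using r_coset_subset_G[OF Wt(2)] klG coset_mult_assoc[OF Wt(2) klG(1) g(1)] g(2) by auto
      have ck: "conj \<phi> k = swap (?W #> k) (shift G (inv k) p') (shift G (inv k) q')"
        unfolding \<phi> by (rule conj_swap[OF sw' Wt(2) klG(1)])
      have swk: "swappable (?W #> k) (shift G (inv k) p') (shift G (inv k) q')"
        by (rule swappable_shift[OF sw' Wt(2) klG(1)])
      then have pX: "shift G (inv k) p' \<in> X" "shift G (inv g) (shift G (inv k) p') \<in> X"
        using shift_in_X g(1) unfolding swappable_def by auto
      have cl: "conj \<phi> l = conj (swap (?W #> k) (shift G (inv k) p') (shift G (inv k) q')) g"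
        unfolding ck[symmetric] conj_conj[OF B klG(1) g(1)] g(2) ..
      have cards: "card (?W #> k) = card (?W #> l)" using card_r_coset[OF Wt(2)] klG by simp
      have "card (?V - (?W #> k)) = card (?V - (?W #> l))"
        using card_Diff_subset[of "?W #> k" ?V] card_Diff_subset[of "?W #> l" ?V] V(1) cards
        by (simp add: finite_subset)
      then have der: "conj \<phi> k \<star> conj \<phi> l \<in> derived (BijGroup X) (windowed ?V)"
        unfolding cl ck
        using full_fillings_card[OF full _ pX(1) V(1) _ V(2), of _ "?W #> k"]
          full_fillings_card[OF full _ pX(2) V(1) _ V(2), of _ "?W #> l"]
        by (intro swap_pair_in_derived V Wk(1) g(1) swk) (simp_all add: Wk(3))
      have wkl: "conj \<phi> k \<in> windowed ?V" "conj \<phi> l \<in> windowed ?V"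
        using windowed_conj[OF w klG(1) Wt(2)] windowed_conj[OF w klG(2) Wt(2)]
          windowed_mono[of "?W #> k" ?V] windowed_mono[of "?W #> l" ?V] V(2) by auto
      have sepV: "separated L ?V"
        unfolding separated_def
      proof (intro ballI impI)
        fix m n assume mn: "m \<in> L" "n \<in> L" "m \<noteq> n"
        have mnG: "m \<in> carrier G" "n \<in> carrier G" using mn LK KG by auto
        have far: "(?W #> a #> m) \<inter> (?W #> b #> n) = {}"
          if ab: "a \<in> {k, l}" "b \<in> {k, l}" for a b
        proof -
          have abK: "a \<in> K" "b \<in> K" "a \<in> carrier G" "b \<in> carrier G" using ab kl klG by auto
          have "a \<otimes> m \<noteq> b \<otimes> n"
          proof (cases "a = b")
            case True
            then show ?thesis using mn(3) mnG abK by simp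
          next
            case False
            then have "(a <# L) \<inter> (b <# L) = {}" using disj kl ab by auto
            then show ?thesis using mn(1,2) unfolding l_coset_def by blast
          qed
          moreover have "a \<otimes> m \<in> K" "b \<otimes> n \<in> K"
            using abK mn LK subgroup.m_closed[OF sK] by auto
          ultimately have "(?W #> (a \<otimes> m)) \<inter> (?W #> (b \<otimes> n)) = {}"
            using sep[OF t] unfolding separated_def by blast
          then show ?thesis
            using coset_mult_assoc[OF Wt(2) abK(3) mnG(1)] coset_mult_assoc[OF Wt(2) abK(4) mnG(2)] by simp
        qed
        have un': "?V #> m = (?W #> k #> m) \<union> (?W #> l #> m)" for m unfolding r_coset_def by blast
        show "(?V #> m) \<inter> (?V #> n) = {}" unfolding un' using far by blast
      qed
      show "inf_prod (conj \<phi>) (C \<union> D) \<in> commutators"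
        unfolding kl(2,4)
      proof (rule inf_prod_coset_pair[OF B LG klG _ _ V sepV wkl der])
        show "tame (conj \<phi>) ((k <# L) \<union> (l <# L))"
          using tame_subset[OF tame] coset_sub kl by (metis le_sup_iff)
        show "(k <# L) \<inter> (l <# L) = {}" using disj kl by simp
      qed
    qed
    then show ?thesis unfolding un lattice_def \<phi>_def .
  qed
  then show "\<exists>W K. finite W \<and> W \<subseteq> carrier G \<and> padded U \<subseteq> W \<and> finite_index G K \<and> K \<subseteq> H \<and>
      (\<forall>t\<in>carrier G. separated K (W #> t) \<and>
         (\<forall>p q. swappable W p q \<longrightarrow> lattice K (conj (swap W p q) t) \<in> commutators))"
    using W K sep unfolding W_def K_def by (intro exI[of _ "padded U"] exI[of _ "H \<inter> N"]) auto
qed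

end

section \<open>Shifts over the integers\<close>

text \<open>Enlarging \<open>B\<close> to an interval makes the boundaries of intervals explicit.\<close>

locale int_shift = glued_shift G A X B
  for G :: "('g, 'm) monoid_scheme" (structure) and A :: "'a set" and X and B +
  fixes e :: "int \<Rightarrow> 'g" and r :: int
  assumes e_bij: "bij_betw e UNIV (carrier G)"
    and e_add: "e (m + n) = e m \<otimes> e n"
    and B_eq: "B = e ` {-r..r}"
    and r_nonneg: "0 \<le> r"
begin

lemma e_in [simp]: "e n \<in> carrier G" using e_bij by (auto simp: bij_betw_def)

lemma e_inj: "inj e" using e_bij by (simp add: bij_betw_def)

lemma e_eq [simp]: "e m = e n \<longleftrightarrow> m = n" using e_inj by (auto dest: injD)

lemma e_mem [simp]: "e n \<in> e ` S \<longleftrightarrow> n \<in> S" using e_inj by (rule inj_image_mem_iff)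

lemma e_surj: "h \<in> carrier G \<Longrightarrow> \<exists>n. h = e n" using e_bij by (auto simp: bij_betw_def)

lemma e_zero: "e 0 = \<one>"
proof -
  have "e 0 \<otimes> e 0 = e 0" using e_add[of 0 0] by simp
  then show ?thesis by simp
qed

lemma e_minus: "inv (e n) = e (- n)"
  by (rule inv_equality) (simp_all add: e_add[symmetric] e_zero)

lemma e_commute: "e m \<otimes> e n = e n \<otimes> e m"
  using e_add[of m n] e_add[of n m] by (simp add: add.commute)

lemma e_image_sub: "e ` S \<subseteq> carrier G" by auto

lemma e_coset: "e ` S #> e n = (\<lambda>k. e (k + n)) ` S"
  by (auto simp: r_coset_def e_add)

lemma e_coset_interval: "e ` {a..<b} #> e n = e ` {a + n..<b + n}"
proof -
  have "(\<lambda>k. e (k + n)) ` {a..<b} = e ` ((\<lambda>k. k + n) ` {a..<b})" by (rule image_image[symmetric])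
  also have "(\<lambda>k. k + n) ` {a..<b} = {a + n..<b + n}" by (rule image_add_atLeastLessThan')
  finally show ?thesis unfolding e_coset .
qed

lemma shift_e: "shift G (e t) x (e n) = x (e (n + t))"
  by (simp add: e_add)

lemma point_eqI: "x \<in> X \<Longrightarrow> y \<in> X \<Longrightarrow> (\<And>n. x (e n) = y (e n)) \<Longrightarrow> x = y"
  using e_surj by (intro X_ext) auto

lemma B_coset: "B #> e n = e ` {n - r..n + r}"
proof -
  have "(\<lambda>k. e (k + n)) ` {-r..r} = e ` ((\<lambda>k. k + n) ` {-r..r})" by (rule image_image[symmetric])
  also have "(\<lambda>k. k + n) ` {-r..r} = {n - r..n + r}"
    using image_add_atLeastAtMost'[of n "-r" r] by (simp add: add.commute)
  finally show ?thesis unfolding B_eq e_coset .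
qed

lemma bd_e: "e j \<in> bd (e ` S) \<longleftrightarrow> j \<in> S \<and> (\<exists>n. n - r \<le> j \<and> j \<le> n + r \<and> \<not> {n - r..n + r} \<subseteq> S)"
proof -
  have "e ` {n - r..n + r} \<subseteq> e ` S \<longleftrightarrow> {n - r..n + r} \<subseteq> S" for n
    using e_inj by (rule inj_image_subset_iff)
  moreover have "(\<exists>g\<in>carrier G. P g) \<longleftrightarrow> (\<exists>n. P (e n))" for P using e_surj e_in by metis
  ultimately show ?thesis unfolding boundary_def by (simp add: B_coset)
qed

lemma bd_interval: "e j \<in> bd (e ` {a..<b}) \<longleftrightarrow> a \<le> j \<and> j < b \<and> (j < a + 2 * r \<or> b - 2 * r \<le> j)"
proof
  assume "e j \<in> bd (e ` {a..<b})"
  then obtain n where n: "a \<le> j" "j < b" "n - r \<le> j" "j \<le> n + r" "\<not> {n - r..n + r} \<subseteq> {a..<b}"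
    unfolding bd_e by auto
  then have "n - r < a \<or> b \<le> n + r" by auto
  then show "a \<le> j \<and> j < b \<and> (j < a + 2 * r \<or> b - 2 * r \<le> j)" using n by auto
next
  assume j: "a \<le> j \<and> j < b \<and> (j < a + 2 * r \<or> b - 2 * r \<le> j)"
  then consider "j < a + 2 * r" | "b - 2 * r \<le> j" by blast
  then have "\<exists>n. n - r \<le> j \<and> j \<le> n + r \<and> \<not> {n - r..n + r} \<subseteq> {a..<b}"
  proof cases
    case 1
    have "j - r - r \<in> {j - r - r..j - r + r}" "j - r - r \<notin> {a..<b}" using 1 r_nonneg by auto
    then have "\<not> {j - r - r..j - r + r} \<subseteq> {a..<b}" by blast
    then show ?thesis using r_nonneg by (intro exI[of _ "j - r"]) simp
  next
    case 2
    have "j + r + r \<in> {j + r - r..j + r + r}" "j + r + r \<notin> {a..<b}" using 2 r_nonneg by auto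
    then have "\<not> {j + r - r..j + r + r} \<subseteq> {a..<b}" by blast
    then show ?thesis using r_nonneg by (intro exI[of _ "j + r"]) simp
  qed
  then show "e j \<in> bd (e ` {a..<b})" unfolding bd_e using j by auto
qed

definition join :: "int \<Rightarrow> ('g \<Rightarrow> 'a) \<Rightarrow> ('g \<Rightarrow> 'a) \<Rightarrow> ('g \<Rightarrow> 'a)" where
  "join c x y = glue (e ` {..<c}) x y"

lemma join_apply [simp]: "join c x y (e n) = (if n < c then x (e n) else y (e n))"
  by (simp add: join_def)

lemma join_in_X:
  assumes "x \<in> X" "y \<in> X" "\<And>n. c - 2 * r \<le> n \<Longrightarrow> n < c \<Longrightarrow> x (e n) = y (e n)"
  shows "join c x y \<in> X"
  unfolding join_def
proof (rule glue_in_X[OF e_image_sub assms(1,2)])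
  fix h assume h: "h \<in> bd (e ` {..<c})"
  then obtain j where j: "h = e j" using bd_subset by blast
  then obtain n where n: "j < c" "n - r \<le> j" "\<not> {n - r..n + r} \<subseteq> {..<c}"
    using h unfolding j bd_e by auto
  then have "c \<le> n + r" by auto
  then show "x h = y h" unfolding j using n assms(3) by simp
qed

definition gap :: "('g \<Rightarrow> 'a) \<Rightarrow> ('g \<Rightarrow> 'a) \<Rightarrow> int \<Rightarrow> int \<Rightarrow> ('g \<Rightarrow> 'a) set" where
  "gap x y a b = {z \<in> X. (\<forall>n<a. z (e n) = x (e n)) \<and> (\<forall>n\<ge>b. z (e n) = y (e n))}"

lemma gap_in_X: "z \<in> gap x y a b \<Longrightarrow> z \<in> X"
  by (simp add: gap_def)

text \<open>Only the words of length \<open>2 r\<close> next to the gap matter: exchanging the rest of \<open>x\<close> and \<open>y\<close> for that of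
  \<open>x'\<close> and \<open>y'\<close> keeps the point in \<open>X\<close>, by gluing along these words.\<close>

lemma card_gap_cong:
  assumes X: "x \<in> X" "y \<in> X" "x' \<in> X" "y' \<in> X" and "a \<le> b"
    and x: "\<And>n. a - 2 * r \<le> n \<Longrightarrow> n < a \<Longrightarrow> x (e n) = x' (e n)"
    and y: "\<And>n. b \<le> n \<Longrightarrow> n < b + 2 * r \<Longrightarrow> y (e n) = y' (e n)"
  shows "card (gap x y a b) = card (gap x' y' a b)"
proof -
  define f where "f x y z = join a x (join b z y)" for x y z
  have f_apply: "f x y z (e n) = (if n < a then x (e n) else if n < b then z (e n) else y (e n))" for x y z n
    using \<open>a \<le> b\<close> by (simp add: f_def)
  have f: "f x' y' z \<in> gap x' y' a b"
    if X: "x' \<in> X" "y' \<in> X" and z: "z \<in> gap x y a b"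
      and eq: "\<And>n. a - 2 * r \<le> n \<Longrightarrow> n < a \<Longrightarrow> x (e n) = x' (e n)" "\<And>n. b \<le> n \<Longrightarrow> n < b + 2 * r \<Longrightarrow> y (e n) = y' (e n)"
    for x y x' y' z
  proof -
    have zX: "z \<in> X" and zx: "\<And>n. n < a \<Longrightarrow> z (e n) = x (e n)" and zy: "\<And>n. b \<le> n \<Longrightarrow> z (e n) = y (e n)"
      using z unfolding gap_def by auto
    (* Gluing needs agreement to the left of the cut, so the cut is made at b + 2 * r instead of b. *)
    have u: "join (b + 2 * r) z y' \<in> X"
      by (rule join_in_X[OF zX X(2)]) (use zy eq(2) in auto)
    have "join a x' (join (b + 2 * r) z y') \<in> X"
      by (rule join_in_X[OF X(1) u]) (use zx eq(1) \<open>a \<le> b\<close> r_nonneg in auto)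
    moreover have "f x' y' z = join a x' (join (b + 2 * r) z y')"
    proof
      fix h
      show "f x' y' z h = join a x' (join (b + 2 * r) z y') h"
      proof (cases "h \<in> carrier G")
        case True
        then obtain n where "h = e n" using e_surj by blast
        then show ?thesis using \<open>a \<le> b\<close> zy eq(2) r_nonneg by (auto simp: f_apply)
      qed (simp add: f_def join_def glue_def)
    qed
    ultimately have "f x' y' z \<in> X" by simp
    then show ?thesis unfolding gap_def using \<open>a \<le> b\<close> by (auto simp: f_apply)
  qed
  have m1: "f x' y' z \<in> gap x' y' a b" if "z \<in> gap x y a b" for z
    by (rule f[OF X(3,4) that x y])
  have m2: "f x y z \<in> gap x y a b" if "z \<in> gap x' y' a b" for z
    by (rule f[OF X(1,2) that x[symmetric] y[symmetric]])
  have "bij_betw (f x' y') (gap x y a b) (gap x' y' a b)"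
  proof (rule bij_betw_byWitness[where f' = "f x y"])
    show "f x' y' ` gap x y a b \<subseteq> gap x' y' a b" using m1 by (rule image_subsetI)
    show "f x y ` gap x' y' a b \<subseteq> gap x y a b" using m2 by (rule image_subsetI)
    show "\<forall>z\<in>gap x y a b. f x y (f x' y' z) = z"
    proof
      fix z assume z: "z \<in> gap x y a b"
      show "f x y (f x' y' z) = z"
      proof (rule point_eqI[OF gap_in_X[OF m2[OF m1[OF z]]] gap_in_X[OF z]])
        fix n
        have "n < a \<Longrightarrow> z (e n) = x (e n)" "b \<le> n \<Longrightarrow> z (e n) = y (e n)"
          using z unfolding gap_def by auto
        then show "f x y (f x' y' z) (e n) = z (e n)" by (simp add: f_apply)
      qed
    qed
    show "\<forall>z\<in>gap x' y' a b. f x' y' (f x y z) = z"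
    proof
      fix z assume z: "z \<in> gap x' y' a b"
      show "f x' y' (f x y z) = z"
      proof (rule point_eqI[OF gap_in_X[OF m1[OF m2[OF z]]] gap_in_X[OF z]])
        fix n
        have "n < a \<Longrightarrow> z (e n) = x' (e n)" "b \<le> n \<Longrightarrow> z (e n) = y' (e n)"
          using z unfolding gap_def by auto
        then show "f x' y' (f x y z) (e n) = z (e n)" by (simp add: f_apply)
      qed
    qed
  qed
  then show ?thesis by (rule bij_betw_same_card)
qed

lemma card_gap_shift:
  "card (gap (shift G (e t) x) (shift G (e t) y) a b) = card (gap x y (a + t) (b + t))"
proof -
  have "bij_betw (shift G (e t)) (gap x y (a + t) (b + t)) (gap (shift G (e t) x) (shift G (e t) y) a b)"
  proof (rule bij_betw_byWitness[where f' = "shift G (e (- t))"])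
    show "\<forall>z\<in>gap x y (a + t) (b + t). shift G (e (- t)) (shift G (e t) z) = z"
      "\<forall>z\<in>gap (shift G (e t) x) (shift G (e t) y) a b. shift G (e t) (shift G (e (- t)) z) = z"
      using shift_inv_X[OF e_in] unfolding e_minus gap_def by auto
    show "shift G (e t) ` gap x y (a + t) (b + t) \<subseteq> gap (shift G (e t) x) (shift G (e t) y) a b"
      unfolding gap_def using shift_in_X[OF _ e_in] by (auto simp: shift_e simp del: shift_apply)
    show "shift G (e (- t)) ` gap (shift G (e t) x) (shift G (e t) y) a b \<subseteq> gap x y (a + t) (b + t)"
      unfolding gap_def using shift_in_X[OF _ e_in] by (auto simp: shift_e simp del: shift_apply)
  qed
  then show ?thesis by (rule bij_betw_same_card[symmetric])
qed

text \<open>The fixed block \<open>[a, b)\<close> is at least \<open>2 r\<close> long, so the choices to its left and to its right are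
  independent. The boundary of the outer interval consists of the outermost \<open>2 r\<close> cells on each side,
  which leaves the gaps \<open>[a', a)\<close> and \<open>[b, b')\<close>.\<close>

lemma card_fillings_gaps:
  assumes X: "x \<in> X" "y \<in> X" and ab: "a' \<le> a" "a + 2 * r \<le> b" "b \<le> b'"
  shows "card (fillings (e ` {a' - 2 * r..<b' + 2 * r}) x (e ` {a..<b}) y) = card (gap x y a' a) * card (gap y x b b')"
proof -
  let ?F = "fillings (e ` {a' - 2 * r..<b' + 2 * r}) x (e ` {a..<b}) y"
  have F: "z \<in> ?F \<longleftrightarrow> z \<in> X \<and> (\<forall>n<a'. z (e n) = x (e n)) \<and> (\<forall>n\<ge>b'. z (e n) = x (e n)) \<and>
      (\<forall>n\<ge>a. n < b \<longrightarrow> z (e n) = y (e n))" for z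
  proof -
    have "(\<forall>h\<in>carrier G. P h) \<longleftrightarrow> (\<forall>n. P (e n))" for P using e_surj e_in by metis
    moreover have "n \<notin> {a' - 2 * r..<b' + 2 * r} \<or> e n \<in> bd (e ` {a' - 2 * r..<b' + 2 * r}) \<longleftrightarrow> n < a' \<or> b' \<le> n" for n
      using ab r_nonneg by (auto simp: bd_interval)
    ultimately show ?thesis unfolding fillings_def by (auto simp del: atLeastLessThan_iff) auto
  qed
  have "bij_betw (\<lambda>z. (join b z y, join b y z)) ?F (gap x y a' a \<times> gap y x b b')"
  proof (rule bij_betw_byWitness[where f' = "\<lambda>(u, v). join b u v"])
    have inX: "join b z y \<in> X" "join b y z \<in> X" if "z \<in> ?F" for z
      using that ab X unfolding F by (auto intro!: join_in_X)
    have outX: "join b u v \<in> X" if "u \<in> gap x y a' a" "v \<in> gap y x b b'" for u v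
      using that ab unfolding gap_def by (intro join_in_X) auto
    show "\<forall>z\<in>?F. (case (join b z y, join b y z) of (u, v) \<Rightarrow> join b u v) = z"
    proof
      fix z assume z: "z \<in> ?F"
      then have "z \<in> X" unfolding F by blast
      moreover from this have "join b (join b z y) (join b y z) = z"
        using X_full by (auto simp: join_def glue_def fun_eq_iff PiE_iff extensional_def subset_iff)
      ultimately show "(case (join b z y, join b y z) of (u, v) \<Rightarrow> join b u v) = z" by simp
    qed
    show "\<forall>p\<in>gap x y a' a \<times> gap y x b b'. (\<lambda>z. (join b z y, join b y z)) (case p of (u, v) \<Rightarrow> join b u v) = p"
    proof
      fix p assume "p \<in> gap x y a' a \<times> gap y x b b'"
      then obtain u v where p: "p = (u, v)" and uv: "u \<in> gap x y a' a" "v \<in> gap y x b b'" by blast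
      have uvX: "u \<in> X" "v \<in> X" using uv unfolding gap_def by auto
      have j: "join b u v \<in> ?F" using outX[OF uv] uv ab r_nonneg unfolding F gap_def by auto
      have "join b (join b u v) y = u" "join b y (join b u v) = v"
        using inX[OF j] uvX uv ab r_nonneg unfolding gap_def by (auto intro!: point_eqI)
      then show "(\<lambda>z. (join b z y, join b y z)) (case p of (u, v) \<Rightarrow> join b u v) = p" unfolding p by simp
    qed
    show "(\<lambda>z. (join b z y, join b y z)) ` ?F \<subseteq> gap x y a' a \<times> gap y x b b'"
      using inX ab r_nonneg unfolding gap_def by (auto simp: F)
    show "(\<lambda>(u, v). join b u v) ` (gap x y a' a \<times> gap y x b b') \<subseteq> ?F"
    proof clarify
      fix u v assume uv: "u \<in> gap x y a' a" "v \<in> gap y x b b'"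
      then show "join b u v \<in> ?F" using outX[OF uv] ab r_nonneg unfolding F gap_def by auto
    qed
  qed
  then have "card ?F = card (gap x y a' a \<times> gap y x b b')" by (rule bij_betw_same_card)
  then show ?thesis by (simp add: card_cartesian_product)
qed

text \<open>The pairs of words that border a gap of length \<open>m\<close> with an odd number of fillings. The second word
  is read at the origin instead of at \<open>m\<close>, so that these sets can be compared for different \<open>m\<close>. They take
  finitely many values, to which the pigeonhole principle applies.\<close>

definition parities :: "int \<Rightarrow> (('g \<Rightarrow> 'a) \<times> ('g \<Rightarrow> 'a)) set" where
  "parities m = {(restrict x (e ` {-2 * r..<0}), restrict y (e ` {0..<2 * r})) | x y.
     x \<in> X \<and> y \<in> X \<and> odd (card (gap x (shift G (e (- m)) y) 0 m))}"

lemma finite_parities: "finite (range parities)"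
proof -
  have "parities m \<in> Pow (patterns (e ` {-2 * r..<0}) \<times> patterns (e ` {0..<2 * r}))" for m
    unfolding parities_def using patternsI by auto
  moreover have "finite (Pow (patterns (e ` {-2 * r..<0}) \<times> patterns (e ` {0..<2 * r})))"
    by (intro finite_Pow_iff[THEN iffD2] finite_cartesian_product finite_patterns) auto
  ultimately show ?thesis by (meson finite_subset image_subsetI)
qed

lemma parities_iff:
  assumes "x \<in> X" "y \<in> X" "0 \<le> m"
  shows "(restrict x (e ` {-2 * r..<0}), restrict y (e ` {0..<2 * r})) \<in> parities m \<longleftrightarrow>
     odd (card (gap x (shift G (e (- m)) y) 0 m))"
proof
  assume "(restrict x (e ` {-2 * r..<0}), restrict y (e ` {0..<2 * r})) \<in> parities m"
  then obtain x' y' where x': "x' \<in> X" "y' \<in> X" "odd (card (gap x' (shift G (e (- m)) y') 0 m))"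
    "restrict x (e ` {-2 * r..<0}) = restrict x' (e ` {-2 * r..<0})"
    "restrict y (e ` {0..<2 * r}) = restrict y' (e ` {0..<2 * r})"
    unfolding parities_def by blast
  have "card (gap x (shift G (e (- m)) y) 0 m) = card (gap x' (shift G (e (- m)) y') 0 m)"
  proof (rule card_gap_cong[OF assms(1) shift_in_X[OF assms(2) e_in] x'(1) shift_in_X[OF x'(2) e_in] assms(3)])
    show "x (e n) = x' (e n)" if "0 - 2 * r \<le> n" "n < 0" for n
      using x'(4) that unfolding restrict_eq_iff by auto
    show "shift G (e (- m)) y (e n) = shift G (e (- m)) y' (e n)" if "m \<le> n" "n < m + 2 * r" for n
      using x'(5) that unfolding restrict_eq_iff shift_e by auto
  qed
  then show "odd (card (gap x (shift G (e (- m)) y) 0 m))" using x'(3) by simp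
qed (use assms in \<open>auto simp: parities_def\<close>)

lemma parities_eq:
  assumes "x \<in> X" "y \<in> X" "0 \<le> m" "0 \<le> m'" "parities m = parities m'"
  shows "odd (card (gap x (shift G (e (- m)) y) 0 m)) \<longleftrightarrow> odd (card (gap x (shift G (e (- m')) y) 0 m'))"
  using parities_iff[OF assms(1,2,3)] parities_iff[OF assms(1,2,4)] assms(5) by blast

text \<open>With the block at \<open>[-c, c)\<close> the two gaps have lengths \<open>m\<close> and \<open>m + t\<close>; after moving it by \<open>t\<close> they have
  lengths \<open>m + t\<close> and \<open>m\<close>. The bordering words are the same, so the hypothesis on \<open>parities\<close> compares the left gaps
  with each other, and likewise the right gaps.\<close>

lemma fillings_parity:
  assumes X: "x \<in> X" "y \<in> X" and m: "0 \<le> m" "0 \<le> t" "parities m = parities (m + t)"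
    and c: "r \<le> c"
  defines "V \<equiv> e ` {-c - m - 2 * r..<c + t + m + 2 * r}"
  shows "even (card (fillings V x (e ` {-c..<c}) y) +
     card (fillings V x (e ` {-c..<c} #> e t) (shift G (inv (e t)) y)))"
proof -
  let ?y = "shift G (e (- t)) y"
  have y: "?y \<in> X" using shift_in_X[OF X(2) e_in] .
  have ss: "shift G (e i) (shift G (e j) z) = shift G (e (i + j)) z" for i j z
    using shift_shift[OF e_in e_in] by (simp add: e_add)
  have 1: "card (fillings V x (e ` {-c..<c}) y) = card (gap x y (-c - m) (-c)) * card (gap y x c (c + t + m))"
    unfolding V_def using m c by (intro card_fillings_gaps X) auto
  have 2: "card (fillings V x (e ` {-c..<c} #> e t) (shift G (inv (e t)) y)) =
      card (gap x ?y (-c - m) (-c + t)) * card (gap ?y x (c + t) (c + t + m))"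
    unfolding V_def e_coset_interval e_minus using m c by (intro card_fillings_gaps X y) auto
  have left: "odd (card (gap x y (-c - m) (-c))) \<longleftrightarrow> odd (card (gap x ?y (-c - m) (-c + t)))"
  proof -
    have "card (gap x y (-c - m) (-c)) = card (gap (shift G (e (-c - m)) x) (shift G (e (- m)) (shift G (e (- c)) y)) 0 m)"
      using card_gap_shift[of "-c - m" x y 0 m] by (simp add: ss algebra_simps)
    moreover have "card (gap x ?y (-c - m) (-c + t)) =
        card (gap (shift G (e (-c - m)) x) (shift G (e (- (m + t))) (shift G (e (- c)) y)) 0 (m + t))"
      using card_gap_shift[of "-c - m" x ?y 0 "m + t"] by (simp add: ss algebra_simps)
    ultimately show ?thesis using parities_eq[OF shift_in_X[OF X(1) e_in] shift_in_X[OF X(2) e_in] m(1) _ m(3)] m by simp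
  qed
  have right: "odd (card (gap y x c (c + t + m))) \<longleftrightarrow> odd (card (gap ?y x (c + t) (c + t + m)))"
  proof -
    have "card (gap y x c (c + t + m)) =
        card (gap (shift G (e c) y) (shift G (e (- (m + t))) (shift G (e (c + t + m)) x)) 0 (m + t))"
      using card_gap_shift[of c y x 0 "m + t"] by (simp add: ss algebra_simps)
    moreover have "card (gap ?y x (c + t) (c + t + m)) =
        card (gap (shift G (e c) y) (shift G (e (- m)) (shift G (e (c + t + m)) x)) 0 m)"
      using card_gap_shift[of "c + t" ?y x 0 m] by (simp add: ss algebra_simps)
    ultimately show ?thesis using parities_eq[OF shift_in_X[OF X(2) e_in] shift_in_X[OF X(1) e_in] m(1) _ m(3)] m by simp
  qed
  show ?thesis unfolding 1 2 using left right by simp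
qed

section \<open>Subgroups of the integers\<close>

abbreviation multiples :: "int \<Rightarrow> 'g set" where
  "multiples s \<equiv> (\<lambda>k. e (s * k)) ` UNIV"

lemma multiples_subgroup: "subgroup (multiples s) G"
proof (rule subgroupI)
  fix a b assume "a \<in> multiples s" "b \<in> multiples s"
  then obtain k l where kl: "a = e (s * k)" "b = e (s * l)" by blast
  have "inv a = e (s * (- k))" unfolding kl e_minus by simp
  then show "inv a \<in> multiples s" by blast
  have "a \<otimes> b = e (s * (k + l))" unfolding kl by (simp add: e_add[symmetric] distrib_left)
  then show "a \<otimes> b \<in> multiples s" by blast
qed auto

lemma multiples_finite_index:
  assumes "0 < s"
  shows "finite_index G (multiples s)"
proof -
  have "rcosets (multiples s) \<subseteq> (\<lambda>n. multiples s #> e n) ` {0..<s}"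
  proof
    fix C assume "C \<in> rcosets (multiples s)"
    then obtain n where n: "C = multiples s #> e n" unfolding RCOSETS_def using e_surj by blast
    have "e n \<in> multiples s #> e (n mod s)"
    proof -
      have "e n = e (s * (n div s)) \<otimes> e (n mod s)" unfolding e_add[symmetric] by simp
      then show ?thesis unfolding r_coset_def by blast
    qed
    then have "C = multiples s #> e (n mod s)"
      unfolding n using repr_independence[OF _ e_in multiples_subgroup] by blast
    moreover have "n mod s \<in> {0..<s}" using assms by simp
    ultimately show "C \<in> (\<lambda>n. multiples s #> e n) ` {0..<s}" by blast
  qed
  then have "finite (rcosets (multiples s))" by (meson finite_atLeastLessThan_int finite_surj)
  then show ?thesis using multiples_subgroup unfolding finite_index_def by blast
qed

text \<open>Two of the cosets \<open>H e(n)\<close> with \<open>n \<ge> 0\<close> coincide, and the difference of the two numbers generates a subgroup of \<open>H\<close>.\<close>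

lemma finite_index_contains_multiples:
  assumes H: "finite_index G H"
  shows "\<exists>s>0. multiples s \<subseteq> H"
proof -
  have sH: "subgroup H G" using H finite_index_subgroup by blast
  have "\<not> inj (\<lambda>n::nat. H #> e (int n))"
  proof
    assume "inj (\<lambda>n::nat. H #> e (int n))"
    moreover have "range (\<lambda>n::nat. H #> e (int n)) \<subseteq> rcosets H" unfolding RCOSETS_def using e_in by blast
    ultimately have "finite (UNIV :: nat set)"
      using H inj_on_finite[of "\<lambda>n::nat. H #> e (int n)" UNIV "rcosets H"] unfolding finite_index_def by blast
    then show False by simp
  qed
  then obtain i j :: nat where ij: "i < j" "H #> e (int i) = H #> e (int j)"
    unfolding inj_def by (metis linorder_neqE_nat)
  have "e (int j) \<in> H #> e (int i)" using rcos_self[OF e_in sH, of "int j"] ij(2) by simp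
  then obtain h where h: "h \<in> H" "e (int j) = h \<otimes> e (int i)" unfolding r_coset_def by blast
  define s where "s = int j - int i"
  have "h \<in> carrier G" using h(1) subgroup.subset[OF sH] by blast
  then have "h = e (int j) \<otimes> inv (e (int i))" unfolding h(2) by (simp add: m_assoc)
  then have s: "0 < s" "e s \<in> H" using h(1) ij(1) unfolding s_def e_minus e_add[symmetric] by auto
  have "e (s * k) \<in> H" for k
  proof (induction k rule: int_induct[where k = 0])
    case base
    then show ?case using subgroup.one_closed[OF sH] by (simp add: e_zero)
  next
    case (step1 k)
    have "e (s * (k + 1)) = e (s * k) \<otimes> e s" by (simp add: e_add[symmetric] distrib_left)
    then show ?case using step1 s(2) subgroup.m_closed[OF sH] by simp
  next
    case (step2 k)
    have "e (s * (k - 1)) = e (s * k) \<otimes> inv (e s)"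
      unfolding e_minus by (simp add: e_add[symmetric] right_diff_distrib)
    then show ?case using step2 s(2) subgroup.m_closed[OF sH] subgroup.m_inv_closed[OF sH] by simp
  qed
  then show ?thesis using s(1) by blast
qed

lemma multiples_separated:
  assumes "b - a \<le> s" "0 < s"
  shows "separated (multiples s) (e ` {a..<b})"
  unfolding separated_def
proof (intro ballI impI)
  fix k l assume "k \<in> multiples s" "l \<in> multiples s" "k \<noteq> l"
  then obtain i j where ij: "k = e (s * i)" "l = e (s * j)" "i \<noteq> j" by blast
  have "s \<le> \<bar>s * i - s * j\<bar>"
  proof -
    have "1 \<le> \<bar>i - j\<bar>" using ij(3) by simp
    then have "s * 1 \<le> s * \<bar>i - j\<bar>" using assms(2) by (intro mult_left_mono) auto
    also have "\<dots> = \<bar>s * i - s * j\<bar>" using assms(2) by (simp add: right_diff_distrib[symmetric] abs_mult)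
    finally show ?thesis by simp
  qed
  then have "{a + s * i..<b + s * i} \<inter> {a + s * j..<b + s * j} = {}" using assms(1) by auto
  then show "(e ` {a..<b} #> k) \<inter> (e ` {a..<b} #> l) = {}"
    unfolding ij(1,2) e_coset_interval using e_inj by (simp add: image_Int[symmetric])
qed

text \<open>By the pigeonhole principle there are arbitrarily large multiples \<open>t\<close> of \<open>s\<close> such that
  \<open>parities m = parities (m + t)\<close>. For \<open>t\<close> large compared with \<open>m\<close> and \<open>W\<close>, the window \<open>V\<close> that contains \<open>W\<close>, its
  translate by \<open>t\<close> and both gaps is no longer than \<open>2 t\<close>, so \<open>2t\<int>\<close> is sparse for it. Then the lattice on \<open>t\<int>\<close> of a swap
  gate is the lattice on \<open>2t\<int>\<close> of the product of the gate and its translate by \<open>t\<close>.\<close>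

lemma perfect_integers: "lattice_group = commutators"
proof (rule perfect_criterion)
  fix U H assume U: "finite U" "U \<subseteq> carrier G" and H: "finite_index G H"
  have "finite (padded U)" "padded U \<subseteq> carrier G" using padded_finite[OF U] by auto
  then obtain P where P: "finite P" "padded U = e ` P"
    using e_bij by (metis bij_betw_def finite_subset_image subset_UNIV)
  define c where "c = Max (insert r ((\<lambda>n. \<bar>n\<bar> + 1) ` P))"
  have c: "r \<le> c" "\<And>n. n \<in> P \<Longrightarrow> \<bar>n\<bar> + 1 \<le> c"
    unfolding c_def using P(1) by (auto intro!: Max_ge)
  define W where "W = e ` {-c..<c}"
  have "n \<in> {-c..<c}" if "n \<in> P" for n using c(2)[OF that] by auto
  then have W: "finite W" "W \<subseteq> carrier G" "padded U \<subseteq> W" unfolding W_def P(2) by auto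
  obtain s where s: "0 < s" "multiples s \<subseteq> H" using finite_index_contains_multiples[OF H] by blast
  have "finite ((\<lambda>i::nat. parities (s * int i)) ` UNIV)"
    using finite_parities by (rule finite_subset[rotated]) auto
  then obtain i0 where i0: "infinite {i \<in> UNIV. parities (s * int i) = parities (s * int i0)}"
    using pigeonhole_infinite[of "UNIV :: nat set" "\<lambda>i. parities (s * int i)"] by auto
  define m where "m = s * int i0"
  (* t >= M makes the length 2 * c + t + 2 * m + 4 * r of V at most 2 * t. *)
  define M where "M = nat (2 * c + 2 * m + 4 * r + 1)"
  have "\<exists>i\<ge>i0 + M. i \<in> {i \<in> UNIV. parities (s * int i) = parities (s * int i0)}"
    using i0 unfolding infinite_nat_iff_unbounded_le by blast
  then obtain i where i: "i0 + M \<le> i" "parities (s * int i) = parities (s * int i0)" by blast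
  define t where "t = s * (int i - int i0)"
  have "int M \<le> int i - int i0" using i(1) by linarith
  also have "\<dots> \<le> s * (int i - int i0)" using s(1) i(1) by (simp add: mult_le_cancel_right1)
  finally have tM: "2 * c + 2 * m + 4 * r + 1 \<le> t" unfolding M_def t_def by linarith
  have m0: "0 \<le> m" unfolding m_def using s(1) by simp
  then have t0: "0 < t" using tM c(1) r_nonneg by linarith
  have par: "parities m = parities (m + t)"
    using i(2) unfolding m_def t_def by (simp add: right_diff_distrib)
  define V where "V = e ` {-c - m - 2 * r..<c + t + m + 2 * r}"
  have V: "finite V" "V \<subseteq> carrier G" unfolding V_def by auto
  let ?K = "multiples t" and ?L = "multiples (2 * t)"
  have K: "finite_index G ?K" using multiples_finite_index[OF t0] .
  have L: "finite_index G ?L" using multiples_finite_index[of "2 * t"] t0 by simp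
  have KG: "?K \<subseteq> carrier G" by auto
  have "?K \<subseteq> multiples s"
  proof
    fix h assume "h \<in> ?K"
    then obtain k where "h = e (s * ((int i - int i0) * k))" unfolding t_def by (auto simp: mult.assoc)
    then show "h \<in> multiples s" by blast
  qed
  then have KH: "?K \<subseteq> H" using s(2) by blast
  have K_split: "(\<one> <# ?L) \<union> (e t <# ?L) = ?K" "(\<one> <# ?L) \<inter> (e t <# ?L) = {}"
  proof -
    have 1: "\<one> <# ?L = (\<lambda>k. e (t * (2 * k))) ` UNIV"
      using lcos_mult_one[of ?L] by (simp add: image_subset_iff mult.assoc mult.left_commute)
    have 2: "e t <# ?L = (\<lambda>k. e (t * (2 * k + 1))) ` UNIV"
    proof -
      have "e t <# ?L = (\<lambda>k. e t \<otimes> e (2 * t * k)) ` UNIV" unfolding l_coset_def by blast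
      moreover have "t + 2 * t * k = t * (2 * k + 1)" for k by (simp add: algebra_simps)
      ultimately show ?thesis by (simp only: e_add[symmetric])
    qed
    show "(\<one> <# ?L) \<union> (e t <# ?L) = ?K"
    proof
      show "?K \<subseteq> (\<one> <# ?L) \<union> (e t <# ?L)"
      proof
        fix h assume "h \<in> ?K"
        then obtain k where k: "h = e (t * k)" by blast
        show "h \<in> (\<one> <# ?L) \<union> (e t <# ?L)"
          unfolding 1 2 k by (cases "even k") (auto elim!: evenE oddE)
      qed
    qed (auto simp: 1 2)
    have "2 * k \<noteq> 2 * l + 1" for k l :: int by presburger
    then show "(\<one> <# ?L) \<inter> (e t <# ?L) = {}" unfolding 1 2 using t0 by auto
  qed
  have sepK: "separated ?K (W #> e j)" for j
    unfolding W_def e_coset_interval by (rule multiples_separated) (use tM m0 r_nonneg t0 in auto)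
  have sepL: "separated ?L (V #> e j)" for j
    unfolding V_def e_coset_interval by (rule multiples_separated) (use tM m0 r_nonneg t0 in auto)
  have WV: "W \<subseteq> V" "W #> e t \<subseteq> V"
    unfolding W_def V_def e_coset_interval using m0 r_nonneg t0 by (auto intro!: image_mono)
  have main: "lattice ?K (conj (swap W p q) g) \<in> commutators" if g: "g \<in> carrier G" and sw: "swappable W p q" for g p q
  proof -
    obtain j where j: "g = e j" using e_surj[OF g] by blast
    define \<sigma> where "\<sigma> = swap W p q"
    have w: "\<sigma> \<in> windowed W" unfolding \<sigma>_def using swap_windowed[OF sw W(2)] .
    have B: "\<sigma> \<in> Bij X" "conj \<sigma> g \<in> Bij X" using windowed_Bij[OF w] conj_Bij g by auto
    have Wg: "finite (W #> g)" "W #> g \<subseteq> carrier G" using finite_r_coset[OF W(1)] r_coset_subset_G[OF W(2) g] by auto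
    have Vg: "finite (V #> g)" "V #> g \<subseteq> carrier G" using finite_r_coset[OF V(1)] r_coset_subset_G[OF V(2) g] by auto
    have pX: "p \<in> X" using sw unfolding swappable_def by blast
    have "\<sigma> \<star> conj \<sigma> (e t) \<in> derived (BijGroup X) (windowed V)"
      unfolding \<sigma>_def
    proof (rule swap_pair_in_derived[OF V W(2) e_in WV sw])
      show "even (card (fillings V x W p) + card (fillings V x (W #> e t) (shift G (inv (e t)) p)))" if "x \<in> X" for x
        unfolding V_def W_def using t0 by (intro fillings_parity that pX m0 par c(1)) simp
    qed
    then have "conj (\<sigma> \<star> conj \<sigma> (e t)) g \<in> derived (BijGroup X) (windowed (V #> g))"
      using derived_conj g V(2) by blast
    moreover have swapped: "conj (conj \<sigma> g) (e t) = conj (conj \<sigma> (e t)) g"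
      unfolding j conj_conj[OF B(1) e_in e_in] by (simp add: e_commute)
    ultimately have der: "conj (conj \<sigma> g) \<one> \<star> conj (conj \<sigma> g) (e t) \<in> derived (BijGroup X) (windowed (V #> g))"
      using conj_mult[OF B(1) conj_Bij[OF B(1) e_in] g] conj_at_one[OF B(2)] by simp
    have "\<sigma> \<in> windowed V" using w windowed_mono[OF WV(1) V(2)] by blast
    moreover have "conj \<sigma> (e t) \<in> windowed V"
      using windowed_conj[OF w e_in W(2)] windowed_mono[OF WV(2) V(2)] by blast
    ultimately have wV: "conj (conj \<sigma> g) \<one> \<in> windowed (V #> g)" "conj (conj \<sigma> g) (e t) \<in> windowed (V #> g)"
      unfolding conj_at_one[OF B(2)] swapped using windowed_conj g V(2) by blast+
    have tame: "tame (conj (conj \<sigma> g)) ?K"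
      using separated_tame[OF _ KG Wg windowed_conj[OF w g W(2)]] sepK unfolding j by blast
    have "inf_prod (conj (conj \<sigma> g)) ((\<one> <# ?L) \<union> (e t <# ?L)) \<in> commutators"
      using tame K_split sepL unfolding j[symmetric]
      by (intro inf_prod_coset_pair[OF B(2) L one_closed e_in _ _ Vg _ wV der]) (simp_all add: j)
    then show ?thesis unfolding K_split(1) lattice_def \<sigma>_def .
  qed
  show "\<exists>W K. finite W \<and> W \<subseteq> carrier G \<and> padded U \<subseteq> W \<and> finite_index G K \<and> K \<subseteq> H \<and>
      (\<forall>t\<in>carrier G. separated K (W #> t) \<and>
         (\<forall>p q. swappable W p q \<longrightarrow> lattice K (conj (swap W p q) t) \<in> commutators))"
  proof (intro exI conjI ballI allI impI)
    show "finite W" "W \<subseteq> carrier G" "padded U \<subseteq> W" "finite_index G ?K" "?K \<subseteq> H"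
      using W K KH by auto
    fix g assume g: "g \<in> carrier G"
    show "separated ?K (W #> g)" using sepK e_surj[OF g] by auto
    show "lattice ?K (conj (swap W p q) g) \<in> commutators" if "swappable W p q" for p q
      by (rule main[OF g that])
  qed
qed

end

theorem theorem4:
  fixes G :: "('g, 'm) monoid_scheme" and A :: "'a set" and X :: "('g \<Rightarrow> 'a) set"
  assumes "group G" and "countable (carrier G)" and "infinite (carrier G)"
    and "residually_finite G"
    and "finite A"
    and "SFT G A X" and "EFP G X"
    and "G \<cong> integer_group
         \<or> even_fillings G A X
         \<or> (X = full_shift G A \<and> halvable_finite_index_subgroups G)"
  shows "gate_lattice_group G A X = derived (BijGroup X) (gate_lattice_group G A X)"
proof -
  interpret shift_space G A X
    using assms(1,5,6) unfolding SFT_def by (simp add: shift_space_def shift_space_axioms_def)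
  obtain B where B: "gluing B" using SFT_gluing[OF assms(6)] by blast
  from assms(8) show ?thesis
  proof (elim disjE conjE)
    assume "G \<cong> integer_group"
    then have "integer_group \<cong> G" using iso_sym by blast
    then obtain e where e: "e \<in> iso integer_group G" unfolding is_iso_def by blast
    then have e_bij: "bij_betw e UNIV (carrier G)" and e_add: "\<And>m n. e (m + n) = e m \<otimes>\<^bsub>G\<^esub> e n"
      unfolding iso_def hom_def by auto
    have "finite B" "B \<subseteq> carrier G" using B unfolding gluing_def by auto
    then obtain P where P: "finite P" "B = e ` P"
      using e_bij by (metis bij_betw_def finite_subset_image subset_UNIV)
    define r where "r = Max (insert 0 (abs ` P))"
    have r: "0 \<le> r" "\<And>n. n \<in> P \<Longrightarrow> \<bar>n\<bar> \<le> r" unfolding r_def using P(1) by auto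
    have "P \<subseteq> {-r..r}" using r(2) by fastforce
    then have "gluing (e ` {-r..r})"
      using e_bij unfolding P(2) by (intro gluing_mono[OF B[unfolded P(2)]]) (auto simp: bij_betw_def)
    then interpret int_shift G A X "e ` {-r..r}" e r
      using e_bij e_add r(1) by unfold_locales auto
    show ?thesis by (rule perfect_integers)
  next
    assume ef: "even_fillings G A X"
    interpret glued_shift G A X B using B by unfold_locales
    show ?thesis by (rule perfect_even_fillings[OF assms(4,3) ef])
  next
    assume full: "X = full_shift G A" and half: "halvable_finite_index_subgroups G"
    interpret glued_shift G A X "{}" using full_shift_gluing[OF full] by unfold_locales
    show ?thesis by (rule perfect_full_shift[OF assms(4) full refl half])
  qed
qed

end
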